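(* Let $r,s$ be von Neumann algebras and let $X: r_0 \to r$ and $Y: r_0\to s$ be generating 1-morphisms in $W^*\text{-}\mathrm{Alg}$. Let $f: \mathrm{End}(X) \to \mathrm{End}(Y)$ be a normal completely positive map and let $(E,V: Y \to X \otimes E)$ be a minimal representation of $f$. Then $f$ is a unital $*$-homomorphism if and only if the 2-morphism $V$ is unitary.
   Context: The 2-category (bicategory) $W^*\text{-}\mathrm{Alg}$ is defined as follows. Objects: von Neumann algebras. A 1-morphism $X: r\to s$ is an $r,s$-bimodule, i.e. a Hilbert space $X$ with commuting normal unital $*$-homomorphisms $r\to B(X)$ and $s^{\mathrm{op}}\to B(X)$. 2-morphisms: bounded linear maps commuting with both actions; vertical composition $\circ$ is composition of maps and the dagger $\dagger$ is the Hilbert space adjoint. Horizontal composition, written left to right as $\otimes$, is Connes fusion: for $X:r\to s$ and $Y:s\to t$, $X\otimes Y: r\to t$ is the Hilbert space obtained from the algebraic tensor product $\mathrm{Hom}(L^2(s)_s,X)\odot_s Y$ by quotienting by null vectors and completing with respect to $\langle f\otimes y,f'\otimes y'\rangle=\langle y,(f^\dagger\circ f')\cdot y'\rangle$; here $L^2(s)$ is Haagerup's standard form of $s$ with its left and right $s$-actions, $L^2(s)_s$ is $L^2(s)$ as a right $s$-module, $\mathrm{Hom}(L^2(s)_s,X)$ is the space of bounded right $s$-linear maps, and $f^\dagger\circ f'\in \mathrm{End}(L^2(s)_s)\cong s$. The left $r$-action is by postcomposition on $\mathrm{Hom}(L^2(s)_s,X)$ and the right $t$-action is that of $Y$. On 2-morphisms,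 $(T\otimes S)(f\otimes y)=(T\circ f)\otimes S(y)$. The identity 1-morphism on $r$ is $L^2(r)$ with both actions; the usual unitary associators and unitors are suppressed. The object $\mathbb{C}$ is denoted $r_0$; thus a 1-morphism $X: r_0\to r$ is a right $r$-module, and $\mathrm{End}(X)$, the algebra of 2-morphisms $X\to X$, is a von Neumann algebra. A 1-morphism $X:r_0\to r$ is generating if for every 1-morphism $Z:r_0\to r$ there is an isometric 2-morphism from $Z$ into a (possibly infinite) direct sum of copies of $X$. A representation of a normal completely positive map $f:\mathrm{End}(X)\to\mathrm{End}(Y)$ is a pair $(E,V)$ of a 1-morphism $E:r\to s$ and a 2-morphism $V:Y\to X\otimes E$ with $f(a)=V^\dagger\circ(a\otimes\mathrm{id}_E)\circ V$ for all $a\in\mathrm{End}(X)$. A minimal representation is an initial object of the dagger category $\mathrm{Rep}(f)$ whose objects are representations of $f$ and whose morphisms $(E,V)\to(E',V')$ are 2-morphisms $\sigma:E\to E'$ satisfying $V'=(\mathrm{id}_X\otimes\sigma)\circ V$ and $V=(\mathrm{id}_X\otimes\sigma^\dagger)\circ V'$. A 2-morphism is unitary if it is invertible with inverse its dagger. Normal means weak $*$-continuous. *)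

theory Defs
  imports "HOL-Analysis.Analysis" "HOL-Library.Poly_Mapping"
begin

section \<open>Hilbert spaces and bounded operators\<close>

text \<open>
  Hilbert spaces are records with an explicit carrier, so that one can quantify over all Hilbert
  spaces (on a given type) inside a formula. Inner products are linear in the second argument.
  The same record also holds spaces with a degenerate form, which occur in the construction of
  Connes fusion.
\<close>

record 'x hilb =
  carr :: "'x set"
  hzero :: 'x
  hadd :: "'x \<Rightarrow> 'x \<Rightarrow> 'x"
  hscale :: "complex \<Rightarrow> 'x \<Rightarrow> 'x"
  hinner :: "'x \<Rightarrow> 'x \<Rightarrow> complex"

definition hnorm :: "('x, 'm) hilb_scheme \<Rightarrow> 'x \<Rightarrow> real" where
  "hnorm H x = sqrt (Re (hinner H x x))"

definition hdiff :: "('x, 'm) hilb_scheme \<Rightarrow> 'x \<Rightarrow> 'x \<Rightarrow> 'x" where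
  "hdiff H x y = hadd H x (hscale H (-1) y)"

definition cauchy_seq :: "('x, 'm) hilb_scheme \<Rightarrow> (nat \<Rightarrow> 'x) \<Rightarrow> bool" where
  "cauchy_seq H u \<longleftrightarrow> (\<forall>n. u n \<in> carr H) \<and>
     (\<forall>\<epsilon>>0. \<exists>N. \<forall>m\<ge>N. \<forall>n\<ge>N. hnorm H (hdiff H (u m) (u n)) < \<epsilon>)"

locale hilbert_space =
  fixes H :: "('x, 'm) hilb_scheme"
  assumes zero_closed: "hzero H \<in> carr H"
    and add_closed: "\<lbrakk>x \<in> carr H; y \<in> carr H\<rbrakk> \<Longrightarrow> hadd H x y \<in> carr H"
    and scale_closed: "x \<in> carr H \<Longrightarrow> hscale H c x \<in> carr H"
    and add_assoc: "\<lbrakk>x \<in> carr H; y \<in> carr H; z \<in> carr H\<rbrakk> \<Longrightarrow>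
        hadd H (hadd H x y) z = hadd H x (hadd H y z)"
    and add_commute: "\<lbrakk>x \<in> carr H; y \<in> carr H\<rbrakk> \<Longrightarrow> hadd H x y = hadd H y x"
    and add_zero: "x \<in> carr H \<Longrightarrow> hadd H x (hzero H) = x"
    and add_inverse: "x \<in> carr H \<Longrightarrow> hadd H x (hscale H (-1) x) = hzero H"
    and scale_one: "x \<in> carr H \<Longrightarrow> hscale H 1 x = x"
    and scale_scale: "x \<in> carr H \<Longrightarrow> hscale H c (hscale H d x) = hscale H (c * d) x"
    and scale_add_left: "x \<in> carr H \<Longrightarrow>
        hscale H (c + d) x = hadd H (hscale H c x) (hscale H d x)"
    and scale_add_right: "\<lbrakk>x \<in> carr H; y \<in> carr H\<rbrakk> \<Longrightarrow>
        hscale H c (hadd H x y) = hadd H (hscale H c x) (hscale H c y)"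
    and inner_commute: "\<lbrakk>x \<in> carr H; y \<in> carr H\<rbrakk> \<Longrightarrow> hinner H x y = cnj (hinner H y x)"
    and inner_add: "\<lbrakk>x \<in> carr H; y \<in> carr H; z \<in> carr H\<rbrakk> \<Longrightarrow>
        hinner H x (hadd H y z) = hinner H x y + hinner H x z"
    and inner_scale: "\<lbrakk>x \<in> carr H; y \<in> carr H\<rbrakk> \<Longrightarrow>
        hinner H x (hscale H c y) = c * hinner H x y"
    and inner_nonneg: "x \<in> carr H \<Longrightarrow> hinner H x x \<in> \<real>\<^sub>\<ge>\<^sub>0"
    and inner_definite: "\<lbrakk>x \<in> carr H; hinner H x x = 0\<rbrakk> \<Longrightarrow> x = hzero H"
    and complete: "cauchy_seq H u \<Longrightarrow>
        \<exists>x\<in>carr H. (\<lambda>n. hnorm H (hdiff H (u n) x)) \<longlonglongrightarrow> 0"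

text \<open>
  Operators are extensional functions (undefined outside the carrier), so that equality of
  operators is equality of functions; composition is \<^const>\<open>compose\<close>.
\<close>

definition bounded_ops ::
  "('x, 'm) hilb_scheme \<Rightarrow> ('y, 'n) hilb_scheme \<Rightarrow> ('x \<Rightarrow> 'y) set" where
  "bounded_ops H K = {T \<in> carr H \<rightarrow>\<^sub>E carr K.
     (\<forall>x\<in>carr H. \<forall>y\<in>carr H. T (hadd H x y) = hadd K (T x) (T y)) \<and>
     (\<forall>c. \<forall>x\<in>carr H. T (hscale H c x) = hscale K c (T x)) \<and>
     (\<exists>C. \<forall>x\<in>carr H. hnorm K (T x) \<le> C * hnorm H x)}"

definition op_id :: "('x, 'm) hilb_scheme \<Rightarrow> 'x \<Rightarrow> 'x" where
  "op_id H = (\<lambda>x\<in>carr H. x)"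

definition op_add ::
  "('x, 'm) hilb_scheme \<Rightarrow> ('y, 'n) hilb_scheme \<Rightarrow> ('x \<Rightarrow> 'y) \<Rightarrow> ('x \<Rightarrow> 'y) \<Rightarrow> 'x \<Rightarrow> 'y" where
  "op_add H K S T = (\<lambda>x\<in>carr H. hadd K (S x) (T x))"

definition op_scale ::
  "('x, 'm) hilb_scheme \<Rightarrow> ('y, 'n) hilb_scheme \<Rightarrow> complex \<Rightarrow> ('x \<Rightarrow> 'y) \<Rightarrow> 'x \<Rightarrow> 'y" where
  "op_scale H K c T = (\<lambda>x\<in>carr H. hscale K c (T x))"

definition adj ::
  "('x, 'm) hilb_scheme \<Rightarrow> ('y, 'n) hilb_scheme \<Rightarrow> ('x \<Rightarrow> 'y) \<Rightarrow> 'y \<Rightarrow> 'x" where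
  "adj H K T = (\<lambda>y\<in>carr K. THE x. x \<in> carr H \<and>
     (\<forall>z\<in>carr H. hinner H x z = hinner K y (T z)))"

definition unitary_op ::
  "('x, 'm) hilb_scheme \<Rightarrow> ('y, 'n) hilb_scheme \<Rightarrow> ('x \<Rightarrow> 'y) \<Rightarrow> bool" where
  "unitary_op H K T \<longleftrightarrow> compose (carr H) (adj H K T) T = op_id H \<and>
     compose (carr K) T (adj H K T) = op_id K"

section \<open>Von Neumann algebras and normal maps\<close>

record 'a vn_algebra =
  hspace :: "'a hilb"
  ops :: "('a \<Rightarrow> 'a) set"

definition commutant ::
  "('x, 'm) hilb_scheme \<Rightarrow> ('x \<Rightarrow> 'x) set \<Rightarrow> ('x \<Rightarrow> 'x) set" where
  "commutant H M = {T \<in> bounded_ops H H. \<forall>S\<in>M. compose (carr H) T S = compose (carr H) S T}"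

definition von_neumann_algebra :: "'a vn_algebra \<Rightarrow> bool" where
  "von_neumann_algebra r \<longleftrightarrow> hilbert_space (hspace r) \<and>
     ops r \<subseteq> bounded_ops (hspace r) (hspace r) \<and>
     (\<forall>a\<in>ops r. adj (hspace r) (hspace r) a \<in> ops r) \<and>
     commutant (hspace r) (commutant (hspace r) (ops r)) = ops r"

text \<open>
  The weak* topology of a von Neumann algebra \<open>A\<close> acting on \<open>H\<close> is its ultraweak topology: the
  elements of the predual are the functionals sending \<open>T\<close> to the sum of the
  \<open>\<langle>\<xi>\<^sub>n, T \<eta>\<^sub>n\<rangle>\<close>, for square-summable sequences of vectors.
\<close>

definition square_summable :: "('x, 'm) hilb_scheme \<Rightarrow> (nat \<Rightarrow> 'x) \<Rightarrow> bool" where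
  "square_summable H \<xi> \<longleftrightarrow> (\<forall>n. \<xi> n \<in> carr H) \<and> summable (\<lambda>n. (hnorm H (\<xi> n))\<^sup>2)"

definition predual :: "('x, 'm) hilb_scheme \<Rightarrow> (('x \<Rightarrow> 'x) \<Rightarrow> complex) set" where
  "predual H = {\<lambda>T. suminf (\<lambda>n. hinner H (\<xi> n) (T (\<eta> n))) | \<xi> \<eta>.
     square_summable H \<xi> \<and> square_summable H \<eta>}"

definition weak_star :: "('x, 'm) hilb_scheme \<Rightarrow> ('x \<Rightarrow> 'x) set \<Rightarrow> ('x \<Rightarrow> 'x) topology" where
  "weak_star H A = topology_generated_by
     {{T \<in> A. \<phi> T \<in> U} | \<phi> U. \<phi> \<in> predual H \<and> open U}"

definition normal_map ::
  "('x, 'm) hilb_scheme \<Rightarrow> ('x \<Rightarrow> 'x) set \<Rightarrow> ('y, 'n) hilb_scheme \<Rightarrow> ('y \<Rightarrow> 'y) set \<Rightarrow>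
   (('x \<Rightarrow> 'x) \<Rightarrow> ('y \<Rightarrow> 'y)) \<Rightarrow> bool" where
  "normal_map H A K B f \<longleftrightarrow> continuous_map (weak_star H A) (weak_star K B) f"

definition linear_map ::
  "('x, 'm) hilb_scheme \<Rightarrow> ('x \<Rightarrow> 'x) set \<Rightarrow> ('y, 'n) hilb_scheme \<Rightarrow> ('y \<Rightarrow> 'y) set \<Rightarrow>
   (('x \<Rightarrow> 'x) \<Rightarrow> ('y \<Rightarrow> 'y)) \<Rightarrow> bool" where
  "linear_map H A K B f \<longleftrightarrow> f \<in> A \<rightarrow> B \<and>
     (\<forall>a\<in>A. \<forall>b\<in>A. f (op_add H H a b) = op_add K K (f a) (f b)) \<and>
     (\<forall>c. \<forall>a\<in>A. f (op_scale H H c a) = op_scale K K c (f a))"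

text \<open>
  The argument \<open>mul\<close> is the multiplication used on the source algebra \<open>A\<close>, so that homomorphisms
  out of the opposite algebra are covered as well: the opposite algebra differs from \<open>A\<close> only in
  its multiplication.
\<close>

definition unital_star_hom ::
  "(('x \<Rightarrow> 'x) \<Rightarrow> ('x \<Rightarrow> 'x) \<Rightarrow> ('x \<Rightarrow> 'x)) \<Rightarrow>
   ('x, 'm) hilb_scheme \<Rightarrow> ('x \<Rightarrow> 'x) set \<Rightarrow> ('y, 'n) hilb_scheme \<Rightarrow> ('y \<Rightarrow> 'y) set \<Rightarrow>
   (('x \<Rightarrow> 'x) \<Rightarrow> ('y \<Rightarrow> 'y)) \<Rightarrow> bool" where
  "unital_star_hom mul H A K B f \<longleftrightarrow> linear_map H A K B f \<and>
     f (op_id H) = op_id K \<and>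
     (\<forall>a\<in>A. \<forall>b\<in>A. f (mul a b) = compose (carr K) (f a) (f b)) \<and>
     (\<forall>a\<in>A. f (adj H H a) = adj K K (f a))"

abbreviation op_mult :: "('x, 'm) hilb_scheme \<Rightarrow> ('x \<Rightarrow> 'x) \<Rightarrow> ('x \<Rightarrow> 'x) \<Rightarrow> ('x \<Rightarrow> 'x)" where
  "op_mult H \<equiv> (\<lambda>a b. compose (carr H) a b)"

abbreviation op_mult_rev :: "('x, 'm) hilb_scheme \<Rightarrow> ('x \<Rightarrow> 'x) \<Rightarrow> ('x \<Rightarrow> 'x) \<Rightarrow> ('x \<Rightarrow> 'x)" where
  "op_mult_rev H \<equiv> (\<lambda>a b. compose (carr H) b a)"

text \<open>
  An \<open>n\<close> by \<open>n\<close> matrix over \<open>A\<close> is positive if it is positive as an operator on the \<open>n\<close>-fold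
  direct sum of \<open>H\<close>.
\<close>

definition positive_matrix ::
  "('x, 'm) hilb_scheme \<Rightarrow> nat \<Rightarrow> (nat \<Rightarrow> nat \<Rightarrow> 'x \<Rightarrow> 'x) \<Rightarrow> bool" where
  "positive_matrix H n a \<longleftrightarrow> (\<forall>x. (\<forall>i<n. x i \<in> carr H) \<longrightarrow>
     (\<Sum>i<n. \<Sum>j<n. hinner H (x i) (a i j (x j))) \<in> \<real>\<^sub>\<ge>\<^sub>0)"

definition completely_positive ::
  "('x, 'm) hilb_scheme \<Rightarrow> ('x \<Rightarrow> 'x) set \<Rightarrow> ('y, 'n) hilb_scheme \<Rightarrow> ('y \<Rightarrow> 'y) set \<Rightarrow>
   (('x \<Rightarrow> 'x) \<Rightarrow> ('y \<Rightarrow> 'y)) \<Rightarrow> bool" where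
  "completely_positive H A K B f \<longleftrightarrow> linear_map H A K B f \<and>
     (\<forall>n a. (\<forall>i<n. \<forall>j<n. a i j \<in> A) \<and> positive_matrix H n a \<longrightarrow>
        positive_matrix K n (\<lambda>i j. f (a i j)))"

section \<open>Modules, bimodules and 2-morphisms\<close>

text \<open>
  Algebra elements are operators on the Hilbert space of the algebra, which has points of type
  \<open>'s\<close> (or \<open>'r\<close>). A left action of the complex numbers by a unital linear map can only be scalar
  multiplication, so a 1-morphism from the complex numbers to \<open>s\<close> is a right \<open>s\<close>-module.
\<close>

record ('s, 'x) rmod = "'x hilb" +
  ract :: "('s \<Rightarrow> 's) \<Rightarrow> 'x \<Rightarrow> 'x"

record ('r, 's, 'x) bimod = "('s, 'x) rmod" +
  lact :: "('r \<Rightarrow> 'r) \<Rightarrow> 'x \<Rightarrow> 'x"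

definition right_module :: "'s vn_algebra \<Rightarrow> ('s, 'x, 'm) rmod_scheme \<Rightarrow> bool" where
  "right_module s X \<longleftrightarrow> hilbert_space X \<and>
     unital_star_hom (op_mult_rev (hspace s)) (hspace s) (ops s) X (bounded_ops X X) (ract X) \<and>
     normal_map (hspace s) (ops s) X (bounded_ops X X) (ract X)"

definition bimodule ::
  "'r vn_algebra \<Rightarrow> 's vn_algebra \<Rightarrow> ('r, 's, 'x, 'm) bimod_scheme \<Rightarrow> bool" where
  "bimodule r s X \<longleftrightarrow> right_module s X \<and>
     unital_star_hom (op_mult (hspace r)) (hspace r) (ops r) X (bounded_ops X X) (lact X) \<and>
     normal_map (hspace r) (ops r) X (bounded_ops X X) (lact X) \<and>
     (\<forall>a\<in>ops r. \<forall>b\<in>ops s.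
        compose (carr X) (lact X a) (ract X b) = compose (carr X) (ract X b) (lact X a))"

definition rhom ::
  "'s vn_algebra \<Rightarrow> ('s, 'x, 'm) rmod_scheme \<Rightarrow> ('s, 'y, 'n) rmod_scheme \<Rightarrow> ('x \<Rightarrow> 'y) set" where
  "rhom s X Y = {T \<in> bounded_ops X Y. \<forall>b\<in>ops s. \<forall>x\<in>carr X. T (ract X b x) = ract Y b (T x)}"

definition bihom ::
  "'r vn_algebra \<Rightarrow> 's vn_algebra \<Rightarrow> ('r, 's, 'x, 'm) bimod_scheme \<Rightarrow>
   ('r, 's, 'y, 'n) bimod_scheme \<Rightarrow> ('x \<Rightarrow> 'y) set" where
  "bihom r s X Y = {T \<in> rhom s X Y. \<forall>a\<in>ops r. \<forall>x\<in>carr X. T (lact X a x) = lact Y a (T x)}"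

abbreviation end_alg :: "'s vn_algebra \<Rightarrow> ('s, 'x, 'm) rmod_scheme \<Rightarrow> ('x \<Rightarrow> 'x) set" where
  "end_alg s X \<equiv> rhom s X X"

definition dsum_carr :: "'i set \<Rightarrow> ('s, 'x, 'm) rmod_scheme \<Rightarrow> ('i \<Rightarrow> 'x) set" where
  "dsum_carr I X = {u \<in> I \<rightarrow>\<^sub>E carr X. (\<lambda>i. (hnorm X (u i))\<^sup>2) summable_on I}"

definition dsum :: "'i set \<Rightarrow> ('s, 'x, 'm) rmod_scheme \<Rightarrow> ('s, 'i \<Rightarrow> 'x) rmod" where
  "dsum I X = \<lparr>carr = dsum_carr I X,
     hzero = (\<lambda>i\<in>I. hzero X),
     hadd = (\<lambda>u v. \<lambda>i\<in>I. hadd X (u i) (v i)),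
     hscale = (\<lambda>c u. \<lambda>i\<in>I. hscale X c (u i)),
     hinner = (\<lambda>u v. infsum (\<lambda>i. hinner X (u i) (v i)) I),
     ract = (\<lambda>b. \<lambda>u\<in>dsum_carr I X. \<lambda>i\<in>I. ract X b (u i))\<rparr>"

text \<open>
  The type \<open>'u\<close> serves as the universe of all Hilbert spaces underlying 1-morphisms, and it also
  supplies the index sets. This does not bound the direct sums in an essential way: if any direct
  sum of copies of \<open>X\<close> receives an isometry from \<open>Z\<close>, then one indexed by a subset of \<open>'u\<close> does.
\<close>

definition generating :: "'s vn_algebra \<Rightarrow> ('s, 'u) rmod \<Rightarrow> bool" where
  "generating s X \<longleftrightarrow> right_module s X \<and>
     (\<forall>Z :: ('s, 'u) rmod. right_module s Z \<longrightarrow>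
        (\<exists>I :: 'u set. \<exists>W \<in> rhom s Z (dsum I X).
           \<forall>z\<in>carr Z. hnorm (dsum I X) (W z) = hnorm Z z))"

section \<open>Haagerup's standard form\<close>

text \<open>
  Haagerup's axioms for a standard form \<open>(M, L, J, P)\<close>, where \<open>M\<close> is the image of \<open>r\<close> under a
  faithful left action on \<open>L\<close>: \<open>J\<close> is a conjugation, \<open>P\<close> is a self-dual cone, \<open>J M J = M'\<close>,
  \<open>J c J = c*\<close> for central \<open>c\<close>, \<open>J\<close> fixes \<open>P\<close> pointwise, and \<open>x J x J\<close> preserves \<open>P\<close> for \<open>x\<close>
  in \<open>M\<close>. The right action of \<open>a\<close> is \<open>J a* J\<close>. A standard form is unique up to a unique unitary
  compatible with these data.
\<close>

definition standard_form :: "'r vn_algebra \<Rightarrow> ('r, 'r, 'x) bimod \<Rightarrow> bool" where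
  "standard_form r L \<longleftrightarrow> bimodule r r L \<and> inj_on (lact L) (ops r) \<and>
     (\<exists>J P. let M = lact L ` ops r; conj = (\<lambda>a. compose (carr L) J (compose (carr L) a J)) in
        J \<in> carr L \<rightarrow>\<^sub>E carr L \<and>
        (\<forall>x\<in>carr L. \<forall>y\<in>carr L. J (hadd L x y) = hadd L (J x) (J y)) \<and>
        (\<forall>c. \<forall>x\<in>carr L. J (hscale L c x) = hscale L (cnj c) (J x)) \<and>
        (\<forall>x\<in>carr L. \<forall>y\<in>carr L. hinner L (J x) (J y) = hinner L y x) \<and>
        (\<forall>x\<in>carr L. J (J x) = x) \<and>
        P = {x \<in> carr L. \<forall>y\<in>P. hinner L x y \<in> \<real>\<^sub>\<ge>\<^sub>0} \<and>
        conj ` M = commutant L M \<and>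
        (\<forall>c \<in> M \<inter> commutant L M. conj c = adj L L c) \<and>
        (\<forall>x\<in>P. J x = x) \<and>
        (\<forall>a\<in>M. \<forall>x\<in>P. a (conj a x) \<in> P) \<and>
        (\<forall>a\<in>ops r. ract L a = conj (adj L L (lact L a))))"

section \<open>Connes fusion\<close>

text \<open>
  The quotient of a space by an equivalence relation. The inner product is computed on arbitrary
  representatives; it is used only where it does not depend on them.
\<close>

definition quotient_space :: "'x hilb \<Rightarrow> ('x \<times> 'x) set \<Rightarrow> 'x set hilb" where
  "quotient_space S R = \<lparr>carr = carr S // R,
     hzero = R `` {hzero S},
     hadd = (\<lambda>A B. \<Union>a\<in>A. \<Union>b\<in>B. R `` {hadd S a b}),
     hscale = (\<lambda>c A. \<Union>a\<in>A. R `` {hscale S c a}),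
     hinner = (\<lambda>A B. hinner S (SOME a. a \<in> A) (SOME b. b \<in> B))\<rparr>"

definition cauchy_space :: "'x hilb \<Rightarrow> (nat \<Rightarrow> 'x) hilb" where
  "cauchy_space S = \<lparr>carr = {u. cauchy_seq S u},
     hzero = (\<lambda>_. hzero S),
     hadd = (\<lambda>u v n. hadd S (u n) (v n)),
     hscale = (\<lambda>c u n. hscale S c (u n)),
     hinner = (\<lambda>u v. lim (\<lambda>n. hinner S (u n) (v n)))\<rparr>"

definition null_rel :: "'x hilb \<Rightarrow> ((nat \<Rightarrow> 'x) \<times> (nat \<Rightarrow> 'x)) set" where
  "null_rel S = {(u, v). cauchy_seq S u \<and> cauchy_seq S v \<and>
     (\<lambda>n. hnorm S (hdiff S (u n) (v n))) \<longlonglongrightarrow> 0}"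

text \<open>
  Cauchy sequences modulo null sequences. For a positive semidefinite form this at once divides
  out the null vectors and completes.
\<close>

definition completion :: "'x hilb \<Rightarrow> (nat \<Rightarrow> 'x) set hilb" where
  "completion S = quotient_space (cauchy_space S) (null_rel S)"

text \<open>
  In the following, \<open>L\<close> is a standard form of \<open>r\<close>, \<open>X\<close> a right \<open>r\<close>-module and \<open>E\<close> a Hilbert space
  with a left action of \<open>r\<close>. The space \<open>X \<otimes> E\<close> is built from the free complex vector space on
  pairs \<open>(f, y)\<close> with \<open>f\<close> in \<open>Hom(L, X)\<close> and \<open>y\<close> in \<open>E\<close>. In the form, \<open>the_inv_into\<close> is the
  isomorphism from the right \<open>r\<close>-linear endomorphisms of \<open>L\<close> to \<open>r\<close>.
\<close>

definition fusion_form ::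
  "'r vn_algebra \<Rightarrow> ('r, 'r, 'l) bimod \<Rightarrow> ('r, 'x, 'm) rmod_scheme \<Rightarrow>
   ('r, 's, 'e, 'n) bimod_scheme \<Rightarrow> ('l \<Rightarrow> 'x) \<times> 'e \<Rightarrow> ('l \<Rightarrow> 'x) \<times> 'e \<Rightarrow> complex" where
  "fusion_form r L X E = (\<lambda>(f, y) (f', y').
     hinner E y (lact E (the_inv_into (ops r) (lact L) (compose (carr L) (adj L X f) f')) y'))"

definition free_space ::
  "'r vn_algebra \<Rightarrow> ('r, 'r, 'l) bimod \<Rightarrow> ('r, 'x, 'm) rmod_scheme \<Rightarrow>
   ('r, 's, 'e, 'n) bimod_scheme \<Rightarrow> ((('l \<Rightarrow> 'x) \<times> 'e) \<Rightarrow>\<^sub>0 complex) hilb" where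
  "free_space r L X E = \<lparr>carr = {p. Poly_Mapping.keys p \<subseteq> rhom r L X \<times> carr E},
     hzero = 0,
     hadd = (+),
     hscale = (\<lambda>c. Poly_Mapping.map ((*) c)),
     hinner = (\<lambda>p q. \<Sum>\<alpha>\<in>Poly_Mapping.keys p. \<Sum>\<beta>\<in>Poly_Mapping.keys q.
        cnj (Poly_Mapping.lookup p \<alpha>) * Poly_Mapping.lookup q \<beta> * fusion_form r L X E \<alpha> \<beta>)\<rparr>"

abbreviation free_tens :: "'f \<Rightarrow> 'e \<Rightarrow> ('f \<times> 'e) \<Rightarrow>\<^sub>0 complex" where
  "free_tens f y \<equiv> Poly_Mapping.single (f, y) 1"

text \<open>
  The right action of \<open>b\<close> in \<open>r\<close> on \<open>Hom(L, X)\<close> is precomposition with its left action on \<open>L\<close>.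
\<close>

definition tensor_relations ::
  "'r vn_algebra \<Rightarrow> ('r, 'r, 'l) bimod \<Rightarrow> ('r, 'x, 'm) rmod_scheme \<Rightarrow>
   ('r, 's, 'e, 'n) bimod_scheme \<Rightarrow> ((('l \<Rightarrow> 'x) \<times> 'e) \<Rightarrow>\<^sub>0 complex) set" where
  "tensor_relations r L X E =
     {free_tens (op_add L X f f') y - free_tens f y - free_tens f' y | f f' y.
        f \<in> rhom r L X \<and> f' \<in> rhom r L X \<and> y \<in> carr E} \<union>
     {free_tens f (hadd E y y') - free_tens f y - free_tens f y' | f y y'.
        f \<in> rhom r L X \<and> y \<in> carr E \<and> y' \<in> carr E} \<union>
     {free_tens (op_scale L X c f) y - Poly_Mapping.single (f, y) c | c f y.
        f \<in> rhom r L X \<and> y \<in> carr E} \<union>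
     {free_tens f (hscale E c y) - Poly_Mapping.single (f, y) c | c f y.
        f \<in> rhom r L X \<and> y \<in> carr E} \<union>
     {free_tens (compose (carr L) f (lact L b)) y - free_tens f (lact E b y) | f b y.
        f \<in> rhom r L X \<and> b \<in> ops r \<and> y \<in> carr E}"

definition tensor_rel ::
  "'r vn_algebra \<Rightarrow> ('r, 'r, 'l) bimod \<Rightarrow> ('r, 'x, 'm) rmod_scheme \<Rightarrow>
   ('r, 's, 'e, 'n) bimod_scheme \<Rightarrow>
   (((('l \<Rightarrow> 'x) \<times> 'e) \<Rightarrow>\<^sub>0 complex) \<times> ((('l \<Rightarrow> 'x) \<times> 'e) \<Rightarrow>\<^sub>0 complex)) set" where
  "tensor_rel r L X E = {(p, q). p \<in> carr (free_space r L X E) \<and> q \<in> carr (free_space r L X E) \<and>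
     p - q \<in> module.span (\<lambda>c. Poly_Mapping.map ((*) c)) (tensor_relations r L X E)}"

definition alg_tensor ::
  "'r vn_algebra \<Rightarrow> ('r, 'r, 'l) bimod \<Rightarrow> ('r, 'x, 'm) rmod_scheme \<Rightarrow>
   ('r, 's, 'e, 'n) bimod_scheme \<Rightarrow> ((('l \<Rightarrow> 'x) \<times> 'e) \<Rightarrow>\<^sub>0 complex) set hilb" where
  "alg_tensor r L X E = quotient_space (free_space r L X E) (tensor_rel r L X E)"

type_synonym ('l, 'x, 'e) fusion_pt = "(nat \<Rightarrow> ((('l \<Rightarrow> 'x) \<times> 'e) \<Rightarrow>\<^sub>0 complex) set) set"

definition fusion_space ::
  "'r vn_algebra \<Rightarrow> ('r, 'r, 'l) bimod \<Rightarrow> ('r, 'x, 'm) rmod_scheme \<Rightarrow>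
   ('r, 's, 'e, 'n) bimod_scheme \<Rightarrow> ('l, 'x, 'e) fusion_pt hilb" where
  "fusion_space r L X E = completion (alg_tensor r L X E)"

definition tens ::
  "'r vn_algebra \<Rightarrow> ('r, 'r, 'l) bimod \<Rightarrow> ('r, 'x, 'm) rmod_scheme \<Rightarrow>
   ('r, 's, 'e, 'n) bimod_scheme \<Rightarrow> ('l \<Rightarrow> 'x) \<Rightarrow> 'e \<Rightarrow> ('l, 'x, 'e) fusion_pt" where
  "tens r L X E f y =
     null_rel (alg_tensor r L X E) `` {\<lambda>_. tensor_rel r L X E `` {free_tens f y}}"

text \<open>
  \<open>T \<otimes> S\<close>, for \<open>T\<close> from \<open>X\<close> to \<open>X'\<close> right \<open>r\<close>-linear and \<open>S\<close> from \<open>E\<close> to \<open>E'\<close> left \<open>r\<close>-linear,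
  is the unique bounded operator with the given values on the total set of the \<open>f \<otimes> y\<close>.
\<close>

definition fuse_map ::
  "'r vn_algebra \<Rightarrow> ('r, 'r, 'l) bimod \<Rightarrow>
   ('r, 'x, 'm) rmod_scheme \<Rightarrow> ('r, 's, 'e, 'n) bimod_scheme \<Rightarrow>
   ('r, 'x1, 'm1) rmod_scheme \<Rightarrow> ('r, 's, 'e1, 'n1) bimod_scheme \<Rightarrow>
   ('x \<Rightarrow> 'x1) \<Rightarrow> ('e \<Rightarrow> 'e1) \<Rightarrow> ('l, 'x, 'e) fusion_pt \<Rightarrow> ('l, 'x1, 'e1) fusion_pt" where
  "fuse_map r L X E X' E' T S =
     (THE W. W \<in> bounded_ops (fusion_space r L X E) (fusion_space r L X' E') \<and>
        (\<forall>f\<in>rhom r L X. \<forall>y\<in>carr E.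
           W (tens r L X E f y) = tens r L X' E' (compose (carr L) T f) (S y)))"

definition fusion ::
  "'r vn_algebra \<Rightarrow> ('r, 'r, 'l) bimod \<Rightarrow> ('r, 'x, 'm) rmod_scheme \<Rightarrow>
   ('r, 's, 'e, 'n) bimod_scheme \<Rightarrow> ('s, ('l, 'x, 'e) fusion_pt) rmod" where
  "fusion r L X E = hilb.extend (fusion_space r L X E)
     (rmod.fields (\<lambda>b. fuse_map r L X E X E (op_id X) (ract E b)))"

section \<open>Representations of normal completely positive maps\<close>

text \<open>
  Here \<open>r\<close> and \<open>s\<close> are von Neumann algebras, \<open>L\<close> is a standard form of \<open>r\<close>, and \<open>f\<close> is a map from
  \<open>End(X)\<close> to \<open>End(Y)\<close> for a right \<open>r\<close>-module \<open>X\<close> and a right \<open>s\<close>-module \<open>Y\<close>.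
\<close>

definition representation ::
  "'r vn_algebra \<Rightarrow> 's vn_algebra \<Rightarrow> ('r, 'r, 'u) bimod \<Rightarrow> ('r, 'u) rmod \<Rightarrow> ('s, 'u) rmod \<Rightarrow>
   (('u \<Rightarrow> 'u) \<Rightarrow> ('u \<Rightarrow> 'u)) \<Rightarrow> ('r, 's, 'u) bimod \<Rightarrow> ('u \<Rightarrow> ('u, 'u, 'u) fusion_pt) \<Rightarrow> bool" where
  "representation r s L X Y f E V \<longleftrightarrow> bimodule r s E \<and> V \<in> rhom s Y (fusion r L X E) \<and>
     (\<forall>a\<in>end_alg r X. f a = compose (carr Y) (adj Y (fusion r L X E) V)
        (compose (carr Y) (fuse_map r L X E X E a (op_id E)) V))"

definition rep_morphism ::
  "'r vn_algebra \<Rightarrow> 's vn_algebra \<Rightarrow> ('r, 'r, 'u) bimod \<Rightarrow> ('r, 'u) rmod \<Rightarrow> ('s, 'u) rmod \<Rightarrow>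
   ('r, 's, 'u) bimod \<Rightarrow> ('u \<Rightarrow> ('u, 'u, 'u) fusion_pt) \<Rightarrow>
   ('r, 's, 'u) bimod \<Rightarrow> ('u \<Rightarrow> ('u, 'u, 'u) fusion_pt) \<Rightarrow> ('u \<Rightarrow> 'u) \<Rightarrow> bool" where
  "rep_morphism r s L X Y E V E' V' \<sigma> \<longleftrightarrow> \<sigma> \<in> bihom r s E E' \<and>
     V' = compose (carr Y) (fuse_map r L X E X E' (op_id X) \<sigma>) V \<and>
     V = compose (carr Y) (fuse_map r L X E' X E (op_id X) (adj E E' \<sigma>)) V'"

definition minimal_representation ::
  "'r vn_algebra \<Rightarrow> 's vn_algebra \<Rightarrow> ('r, 'r, 'u) bimod \<Rightarrow> ('r, 'u) rmod \<Rightarrow> ('s, 'u) rmod \<Rightarrow>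
   (('u \<Rightarrow> 'u) \<Rightarrow> ('u \<Rightarrow> 'u)) \<Rightarrow> ('r, 's, 'u) bimod \<Rightarrow> ('u \<Rightarrow> ('u, 'u, 'u) fusion_pt) \<Rightarrow> bool" where
  "minimal_representation r s L X Y f E V \<longleftrightarrow> representation r s L X Y f E V \<and>
     (\<forall>E' V'. representation r s L X Y f E' V' \<longrightarrow>
        (\<exists>!\<sigma>. rep_morphism r s L X Y E V E' V' \<sigma>))"

end

theory Submission
  imports Defs
begin

text \<open>
  If \<open>V\<close> is unitary, then \<open>f a = V\<^sup>* (a \<otimes> 1) V\<close> is visibly multiplicative, unital and *-preserving.
  Conversely, if \<open>f\<close> is a unital *-homomorphism, then \<open>V\<close> is an isometry and expanding
  \<open>\<parallel>(a \<otimes> 1) V y - V (f a y)\<parallel>\<^sup>2\<close> shows \<open>(a \<otimes> 1) V = V (f a)\<close>. Hence the range of \<open>V\<close> is a closed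
  subspace of \<open>X \<otimes> E\<close> invariant under \<open>End(X) \<otimes> 1\<close> and \<open>s\<close>, and therefore contained in
  \<open>(1 \<otimes> p) (X \<otimes> E)\<close> for the projection \<open>p\<close> onto the sub-bimodule \<open>{y. \<forall>g. g \<otimes> y \<in> ran V}\<close> of \<open>E\<close>. So \<open>p\<close>
  is an endomorphism of the representation, minimality gives \<open>p = 1\<close>, and \<open>V\<close> is onto.

  Everything rests on the positivity of the fusion form: it is reduced to cyclic representations,
  where it says that a unital *-homomorphism out of an inverse-closed algebra preserves positivity.
\<close>

section \<open>Semi-inner product spaces\<close>

text \<open>Connes fusion is given by a form and its operators by definite descriptions, so both
  need existence proofs before any bimodule argument can start. Positivity of the form concerns
  whole matrices f_i^* f_j, whereas the left action of \<open>r\<close> is a *-homomorphism on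
  single elements only; a common cyclic vector absorbs the matrix into one element g^* g, where g is
  the sum of the f_i b_i. Square roots and functional calculus are replaced by two devices:
  positivity is transported by resolvents, which stay inside a bicommutant, and boundedness of T
  tensor S is read off from the growth of the moments of T^* T tensor S^* S. Beyond being a faithful
  bimodule, the standard form enters through its commutants: the image of \<open>r\<close> is its
  own bicommutant and contains every right \<open>r\<close>-linear operator. To recover a subspace
  of \<open>E\<close> from a subspace of the fusion space, vectors are sliced by the adjoints of the
  maps y to g tensor y; the operators h g^* of End(X) realise slicing followed by insertion.\<close>

lemma nonneg_quadratic_bound:
  fixes a b d :: real
  assumes "\<And>t. 0 \<le> a + 2 * t * b + t\<^sup>2 * d"
  shows "b\<^sup>2 \<le> a * d"
proof (cases "d = 0")
  case True
  have "b = 0"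
  proof (rule ccontr)
    assume "b \<noteq> 0"
    \<comment> \<open>With \<open>d = 0\<close> this parameter gives the quadratic the value
      -1.\<close>
    then show False using assms[of "- (a + 1) / (2 * b)"] True by (simp add: field_simps)
  qed
  then show ?thesis using True by simp
next
  case False
  have "d > 0"
  proof (rule ccontr)
    assume "\<not> d > 0"
    then have d: "d < 0" using False by simp
    \<comment> \<open>The final summand forces \<open>1 \<le> t\<close>; the quotient lets
      \<open>t * (- d)\<close> exceed the constant and linear contributions, so the quadratic is
      negative at \<open>t\<close>.\<close>
    define t where "t = (\<bar>a\<bar> + 2 * \<bar>b\<bar> + 1) / (- d) + 1"
    have t1: "t \<ge> 1" unfolding t_def using d by (simp add: divide_nonneg_neg)
    have "t * (- d) > \<bar>a\<bar> + 2 * \<bar>b\<bar>" unfolding t_def using d by (simp add: field_simps)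
    then have "t * (t * (- d)) > t * (\<bar>a\<bar> + 2 * \<bar>b\<bar>)" using t1 by (intro mult_strict_left_mono) auto
    moreover have "t * \<bar>a\<bar> \<ge> \<bar>a\<bar>" using t1 mult_right_mono[of 1 t "\<bar>a\<bar>"] by simp
    moreover have "t * b \<le> t * \<bar>b\<bar>" using t1 by (intro mult_left_mono) auto
    ultimately have "a + 2 * t * b + t\<^sup>2 * d < 0" by (simp add: power2_eq_square algebra_simps)
    then show False using assms[of t] by simp
  qed
  have "0 \<le> a + 2 * (- b / d) * b + (- b / d)\<^sup>2 * d" by (rule assms)
  also have "\<dots> = a - b\<^sup>2 / d" using False by (simp add: power2_eq_square field_simps)
  finally show ?thesis using \<open>d > 0\<close> by (simp add: field_simps)
qed

text \<open>Definiteness and completeness are left out because free spaces, algebraic tensor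
  products and spaces of Cauchy sequences carry degenerate forms; the elementary estimates then
  serve all of them and Hilbert spaces alike.\<close>

locale semi_inner_space =
  fixes H :: "('x, 'm) hilb_scheme"
  assumes zero_in: "hzero H \<in> carr H"
    and add_in: "\<lbrakk>x \<in> carr H; y \<in> carr H\<rbrakk> \<Longrightarrow> hadd H x y \<in> carr H"
    and scale_in: "x \<in> carr H \<Longrightarrow> hscale H c x \<in> carr H"
    and hadd_assoc: "\<lbrakk>x \<in> carr H; y \<in> carr H; z \<in> carr H\<rbrakk> \<Longrightarrow>
        hadd H (hadd H x y) z = hadd H x (hadd H y z)"
    and hadd_commute: "\<lbrakk>x \<in> carr H; y \<in> carr H\<rbrakk> \<Longrightarrow> hadd H x y = hadd H y x"
    and hadd_zero: "x \<in> carr H \<Longrightarrow> hadd H x (hzero H) = x"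
    and hadd_inverse: "x \<in> carr H \<Longrightarrow> hadd H x (hscale H (-1) x) = hzero H"
    and hscale_one: "x \<in> carr H \<Longrightarrow> hscale H 1 x = x"
    and hscale_scale: "x \<in> carr H \<Longrightarrow> hscale H c (hscale H d x) = hscale H (c * d) x"
    and hscale_add_left: "x \<in> carr H \<Longrightarrow>
        hscale H (c + d) x = hadd H (hscale H c x) (hscale H d x)"
    and hscale_add_right: "\<lbrakk>x \<in> carr H; y \<in> carr H\<rbrakk> \<Longrightarrow>
        hscale H c (hadd H x y) = hadd H (hscale H c x) (hscale H c y)"
    and hinner_commute: "\<lbrakk>x \<in> carr H; y \<in> carr H\<rbrakk> \<Longrightarrow> hinner H x y = cnj (hinner H y x)"
    and hinner_add_right: "\<lbrakk>x \<in> carr H; y \<in> carr H; z \<in> carr H\<rbrakk> \<Longrightarrow>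
        hinner H x (hadd H y z) = hinner H x y + hinner H x z"
    and hinner_scale_right: "\<lbrakk>x \<in> carr H; y \<in> carr H\<rbrakk> \<Longrightarrow>
        hinner H x (hscale H c y) = c * hinner H x y"
    and hinner_nonneg: "x \<in> carr H \<Longrightarrow> hinner H x x \<in> \<real>\<^sub>\<ge>\<^sub>0"
begin

lemma diff_in: "\<lbrakk>x \<in> carr H; y \<in> carr H\<rbrakk> \<Longrightarrow> hdiff H x y \<in> carr H"
  by (simp add: hdiff_def add_in scale_in)

lemma hinner_add_left:
  assumes "x \<in> carr H" "y \<in> carr H" "z \<in> carr H"
  shows "hinner H (hadd H x y) z = hinner H x z + hinner H y z"
  using assms by (simp add: add_in hinner_commute[of _ z] hinner_add_right)

lemma hinner_scale_left:
  assumes "x \<in> carr H" "y \<in> carr H"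
  shows "hinner H (hscale H c x) y = cnj c * hinner H x y"
  using assms by (simp add: scale_in hinner_commute[of _ y] hinner_scale_right)

lemma hzero_eq: "hzero H = hscale H 0 (hzero H)"
proof -
  have "hscale H (1 + (-1)) (hzero H) = hzero H"
    by (simp only: hscale_add_left zero_in hscale_one hadd_inverse)
  then show ?thesis by simp
qed

lemma hinner_zero_right: "x \<in> carr H \<Longrightarrow> hinner H x (hzero H) = 0"
  by (subst hzero_eq) (simp add: hinner_scale_right zero_in)

lemma hinner_zero_left: "x \<in> carr H \<Longrightarrow> hinner H (hzero H) x = 0"
  by (subst hzero_eq) (simp add: hinner_scale_left zero_in)

lemma hinner_diff_right: "\<lbrakk>x \<in> carr H; y \<in> carr H; z \<in> carr H\<rbrakk> \<Longrightarrow>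
    hinner H x (hdiff H y z) = hinner H x y - hinner H x z"
  by (simp add: hdiff_def hinner_add_right hinner_scale_right scale_in)

lemma hinner_diff_left: "\<lbrakk>x \<in> carr H; y \<in> carr H; z \<in> carr H\<rbrakk> \<Longrightarrow>
    hinner H (hdiff H x y) z = hinner H x z - hinner H y z"
  by (simp add: hdiff_def hinner_add_left hinner_scale_left scale_in)

lemmas closed = zero_in add_in scale_in diff_in

lemmas inner_simps = hinner_add_left hinner_add_right hinner_scale_left hinner_scale_right
  hinner_zero_left hinner_zero_right hinner_diff_left hinner_diff_right

lemma hnorm_nonneg: "0 \<le> hnorm H x" if "x \<in> carr H"
  using hinner_nonneg[OF that] by (simp add: hnorm_def complex_nonneg_Reals_iff)

lemma hinner_self: "x \<in> carr H \<Longrightarrow> hinner H x x = complex_of_real ((hnorm H x)\<^sup>2)"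
  using hinner_nonneg[of x] by (simp add: hnorm_def complex_nonneg_Reals_iff complex_eq_iff)

lemma hnorm_sq: "x \<in> carr H \<Longrightarrow> (hnorm H x)\<^sup>2 = Re (hinner H x x)"
  by (simp add: hinner_self)

lemma Re_hinner_nonneg: "x \<in> carr H \<Longrightarrow> 0 \<le> Re (hinner H x x)"
  by (metis hnorm_sq zero_le_power2)

lemma hnorm_zero: "hnorm H (hzero H) = 0"
  by (simp add: hnorm_def hinner_zero_left zero_in)

lemma Cauchy_Schwarz:
  assumes x: "x \<in> carr H" and y: "y \<in> carr H"
  shows "cmod (hinner H x y) \<le> hnorm H x * hnorm H y"
proof -
  define b where "b = hinner H x y"
  \<comment> \<open>The phase \<open>w\<close> makes \<open>w * b\<close> real and nonnegative, so a
    quadratic in a real parameter controls the modulus of the inner product and not only its real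
    part.\<close>
  have "\<exists>w. cmod w = 1 \<and> w * b = complex_of_real (cmod b)"
  proof (cases "b = 0")
    case True then show ?thesis by (intro exI[of _ 1]) simp
  next
    case False
    then show ?thesis
      by (intro exI[of _ "cnj b / complex_of_real (cmod b)"])
        (simp add: norm_divide divide_simps complex_norm_square[symmetric] power2_eq_square mult.commute)
  qed
  then obtain w where w: "cmod w = 1" "w * b = complex_of_real (cmod b)" by blast
  have cw: "cnj w * w = 1"
    using w(1) complex_norm_square[of w] by (simp add: mult.commute)
  have "(cmod b)\<^sup>2 \<le> (hnorm H x)\<^sup>2 * (hnorm H y)\<^sup>2"
  proof (rule nonneg_quadratic_bound)
    fix t :: real
    define z where "z = hadd H x (hscale H (complex_of_real t * w) y)"
    have "hinner H z z = hinner H x x + complex_of_real t * (w * b)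
        + complex_of_real t * cnj (w * b) + (complex_of_real t)\<^sup>2 * (cnj w * w) * hinner H y y"
      unfolding z_def b_def using x y hinner_commute[of y x]
      by (simp add: inner_simps closed algebra_simps power2_eq_square)
    then have "Re (hinner H z z) = (hnorm H x)\<^sup>2 + 2 * t * cmod b + t\<^sup>2 * (hnorm H y)\<^sup>2"
      using x y by (simp add: w cw hinner_self power2_eq_square)
    moreover have "z \<in> carr H" unfolding z_def using x y by (simp add: closed)
    ultimately show "0 \<le> (hnorm H x)\<^sup>2 + 2 * t * cmod b + t\<^sup>2 * (hnorm H y)\<^sup>2"
      by (metis Re_hinner_nonneg)
  qed
  then have "(cmod b)\<^sup>2 \<le> (hnorm H x * hnorm H y)\<^sup>2" by (simp add: power_mult_distrib)
  then show ?thesis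
    unfolding b_def using x y by (meson hnorm_nonneg mult_nonneg_nonneg power2_le_imp_le)
qed

text \<open>Vectors are compared through their norms: expanding both forms with
  \<open>inner_simps\<close> replaces regrouping of sums built from \<open>hadd\<close> and
  \<open>hscale\<close>.\<close>

lemma hnorm_cong: "hinner H x x = hinner H y y \<Longrightarrow> hnorm H x = hnorm H y"
  by (simp add: hnorm_def)

lemma hnorm_scale: "x \<in> carr H \<Longrightarrow> hnorm H (hscale H c x) = cmod c * hnorm H x"
proof -
  assume x: "x \<in> carr H"
  have "(hnorm H (hscale H c x))\<^sup>2 = (cmod c * hnorm H x)\<^sup>2"
  proof -
    have "hinner H (hscale H c x) (hscale H c x) = complex_of_real ((cmod c)\<^sup>2 * (hnorm H x)\<^sup>2)"
      using x complex_norm_square[of c]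
      by (simp add: closed hinner_scale_left hinner_scale_right mult.assoc hinner_self[OF x])
    then show ?thesis using x by (simp add: hnorm_sq[of "hscale H c x"] closed power_mult_distrib)
  qed
  then show ?thesis using x by (simp add: hnorm_nonneg closed power2_eq_iff_nonneg)
qed

lemma hnorm_add:
  assumes x: "x \<in> carr H" and y: "y \<in> carr H"
  shows "hnorm H (hadd H x y) \<le> hnorm H x + hnorm H y"
proof (rule power2_le_imp_le)
  have "(hnorm H (hadd H x y))\<^sup>2 = (hnorm H x)\<^sup>2 + 2 * Re (hinner H x y) + (hnorm H y)\<^sup>2"
    using x y hinner_commute[of y x] by (simp add: hnorm_sq closed inner_simps)
  also have "Re (hinner H x y) \<le> hnorm H x * hnorm H y"
    using Cauchy_Schwarz[OF x y] complex_Re_le_cmod order_trans by blast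
  finally show "(hnorm H (hadd H x y))\<^sup>2 \<le> (hnorm H x + hnorm H y)\<^sup>2"
    by (simp add: power2_eq_square algebra_simps)
qed (use x y in \<open>simp add: hnorm_nonneg\<close>)

lemma hnorm_diff_commute:
  assumes "x \<in> carr H" "y \<in> carr H"
  shows "hnorm H (hdiff H x y) = hnorm H (hdiff H y x)"
  using assms by (intro hnorm_cong) (simp add: inner_simps closed algebra_simps)

lemma hnorm_diff_triangle:
  assumes "x \<in> carr H" "y \<in> carr H" "z \<in> carr H"
  shows "hnorm H (hdiff H x z) \<le> hnorm H (hdiff H x y) + hnorm H (hdiff H y z)"
proof -
  have "hnorm H (hdiff H x z) = hnorm H (hadd H (hdiff H x y) (hdiff H y z))"
    using assms by (intro hnorm_cong) (simp add: inner_simps closed algebra_simps)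
  then show ?thesis using assms by (simp add: hnorm_add closed)
qed

lemma hnorm_le_diff:
  assumes "x \<in> carr H" "y \<in> carr H"
  shows "hnorm H x \<le> hnorm H (hdiff H x y) + hnorm H y"
proof -
  have "hnorm H x = hnorm H (hadd H (hdiff H x y) y)"
    using assms by (intro hnorm_cong) (simp add: inner_simps closed algebra_simps)
  then show ?thesis using assms by (simp add: hnorm_add closed)
qed

lemma hnorm_diff_add:
  assumes "x \<in> carr H" "y \<in> carr H" "u \<in> carr H" "v \<in> carr H"
  shows "hnorm H (hdiff H (hadd H x y) (hadd H u v)) \<le> hnorm H (hdiff H x u) + hnorm H (hdiff H y v)"
proof -
  have "hnorm H (hdiff H (hadd H x y) (hadd H u v)) = hnorm H (hadd H (hdiff H x u) (hdiff H y v))"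
    using assms by (intro hnorm_cong) (simp add: inner_simps closed algebra_simps)
  then show ?thesis using assms by (simp add: hnorm_add closed)
qed

lemma hnorm_diff_scale:
  assumes "x \<in> carr H" "y \<in> carr H"
  shows "hnorm H (hdiff H (hscale H c x) (hscale H c y)) = cmod c * hnorm H (hdiff H x y)"
proof -
  have "hnorm H (hdiff H (hscale H c x) (hscale H c y)) = hnorm H (hscale H c (hdiff H x y))"
    using assms by (intro hnorm_cong) (simp add: inner_simps closed algebra_simps)
  then show ?thesis using assms by (simp add: hnorm_scale closed)
qed

lemma hnorm_diff_self: "x \<in> carr H \<Longrightarrow> hnorm H (hdiff H x x) = 0"
  by (simp add: hdiff_def hadd_inverse hnorm_zero)

section \<open>Norm convergence of sequences\<close>

definition conv :: "(nat \<Rightarrow> 'x) \<Rightarrow> 'x \<Rightarrow> bool" where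
  "conv u x \<longleftrightarrow> (\<forall>n. u n \<in> carr H) \<and> x \<in> carr H \<and> (\<lambda>n. hnorm H (hdiff H (u n) x)) \<longlonglongrightarrow> 0"

lemma cauchy_seqD:
  assumes "cauchy_seq H u" "0 < e"
  obtains N where "\<And>m n. \<lbrakk>N \<le> m; N \<le> n\<rbrakk> \<Longrightarrow> hnorm H (hdiff H (u m) (u n)) < e"
  using assms unfolding cauchy_seq_def by blast

lemma conv_cauchy:
  assumes "conv u x"
  shows "cauchy_seq H u"
  unfolding cauchy_seq_def
proof (intro conjI allI impI)
  have u: "\<And>n. u n \<in> carr H" and x: "x \<in> carr H" using assms by (auto simp: conv_def)
  show "u n \<in> carr H" for n by (rule u)
  fix e :: real assume "0 < e"
  then have "\<forall>\<^sub>F n in sequentially. hnorm H (hdiff H (u n) x) < e / 2"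
    using assms unfolding conv_def by (intro order_tendstoD(2)[where y = 0]) auto
  then obtain N where N: "\<And>n. N \<le> n \<Longrightarrow> hnorm H (hdiff H (u n) x) < e / 2"
    by (auto simp: eventually_sequentially)
  have "hnorm H (hdiff H (u m) (u n)) < e" if "N \<le> m" "N \<le> n" for m n
    using hnorm_diff_triangle[OF u x u, of m n] N[OF that(1)] N[OF that(2)]
      hnorm_diff_commute[OF x u, of n] by simp
  then show "\<exists>N. \<forall>m\<ge>N. \<forall>n\<ge>N. hnorm H (hdiff H (u m) (u n)) < e" by blast
qed

lemma cauchy_bounded:
  assumes "cauchy_seq H u"
  obtains B where "0 < B" "\<And>n. hnorm H (u n) \<le> B"
proof -
  have u: "\<And>n. u n \<in> carr H" using assms by (auto simp: cauchy_seq_def)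
  obtain N where N: "\<And>m n. \<lbrakk>N \<le> m; N \<le> n\<rbrakk> \<Longrightarrow> hnorm H (hdiff H (u m) (u n)) < 1"
    using cauchy_seqD[OF assms, of 1] by auto
  define B where "B = (\<Sum>n\<le>N. hnorm H (u n)) + 1"
  have le: "hnorm H (u n) \<le> (\<Sum>n\<le>N. hnorm H (u n))" if "n \<le> N" for n
    using that by (intro member_le_sum) (auto simp: u hnorm_nonneg)
  have "hnorm H (u n) \<le> B" for n
  proof (cases "n \<le> N")
    case True then show ?thesis using le[of n] by (simp add: B_def)
  next
    case False
    then show ?thesis
      using hnorm_le_diff[OF u[of n] u[of N]] N[of n N] le[of N] by (simp add: B_def)
  qed
  moreover have "0 < B" unfolding B_def using u by (simp add: add_nonneg_pos hnorm_nonneg sum_nonneg)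
  ultimately show ?thesis using that by blast
qed

lemma hinner_diff_bound:
  assumes "x \<in> carr H" "y \<in> carr H" "u \<in> carr H" "v \<in> carr H"
  shows "cmod (hinner H x y - hinner H u v) \<le>
    hnorm H x * hnorm H (hdiff H y v) + hnorm H (hdiff H x u) * hnorm H v"
proof -
  have "hinner H x y - hinner H u v = hinner H x (hdiff H y v) + hinner H (hdiff H x u) v"
    using assms by (simp add: inner_simps closed)
  then have "cmod (hinner H x y - hinner H u v) \<le>
      cmod (hinner H x (hdiff H y v)) + cmod (hinner H (hdiff H x u) v)"
    by (simp add: norm_triangle_ineq)
  then show ?thesis
    using assms Cauchy_Schwarz[of x "hdiff H y v"] Cauchy_Schwarz[of "hdiff H x u" v]
    by (simp add: closed)
qed

lemma conv_hinner:
  assumes u: "conv u x" and v: "conv v y"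
  shows "(\<lambda>n. hinner H (u n) (v n)) \<longlonglongrightarrow> hinner H x y"
proof -
  have c: "\<And>n. u n \<in> carr H" "x \<in> carr H" "\<And>n. v n \<in> carr H" "y \<in> carr H"
    using assms by (auto simp: conv_def)
  obtain B where B: "0 < B" "\<And>n. hnorm H (u n) \<le> B" using cauchy_bounded[OF conv_cauchy[OF u]] by auto
  have "(\<lambda>n. hinner H (u n) (v n) - hinner H x y) \<longlonglongrightarrow> 0"
  proof (rule tendsto_0_le[where K = 1])
    show "(\<lambda>n. B * hnorm H (hdiff H (v n) y) + hnorm H (hdiff H (u n) x) * hnorm H y) \<longlonglongrightarrow> 0"
      using assms unfolding conv_def by (auto intro!: tendsto_eq_intros)
    show "\<forall>\<^sub>F n in sequentially. norm (hinner H (u n) (v n) - hinner H x y) \<le>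
      norm (B * hnorm H (hdiff H (v n) y) + hnorm H (hdiff H (u n) x) * hnorm H y) * 1"
    proof (rule always_eventually, rule allI)
      fix n
      have "cmod (hinner H (u n) (v n) - hinner H x y) \<le>
          hnorm H (u n) * hnorm H (hdiff H (v n) y) + hnorm H (hdiff H (u n) x) * hnorm H y"
        using c by (intro hinner_diff_bound) auto
      also have "hnorm H (u n) * hnorm H (hdiff H (v n) y) \<le> B * hnorm H (hdiff H (v n) y)"
        using B c by (intro mult_right_mono) (auto simp: hnorm_nonneg closed)
      finally show "norm (hinner H (u n) (v n) - hinner H x y) \<le>
          norm (B * hnorm H (hdiff H (v n) y) + hnorm H (hdiff H (u n) x) * hnorm H y) * 1"
        by simp
    qed
  qed
  then show ?thesis by (simp add: LIM_zero_iff)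
qed

lemma conv_const: "x \<in> carr H \<Longrightarrow> conv (\<lambda>_. x) x"
  by (simp add: conv_def hnorm_diff_self)

lemma conv_hnorm: "conv u x \<Longrightarrow> (\<lambda>n. hnorm H (u n)) \<longlonglongrightarrow> hnorm H x"
  unfolding hnorm_def by (intro tendsto_real_sqrt tendsto_Re conv_hinner)

lemma conv_add:
  assumes u: "conv u x" and v: "conv v y"
  shows "conv (\<lambda>n. hadd H (u n) (v n)) (hadd H x y)"
proof -
  have c: "\<And>n. u n \<in> carr H" "x \<in> carr H" "\<And>n. v n \<in> carr H" "y \<in> carr H"
    using assms by (auto simp: conv_def)
  have "(\<lambda>n. hnorm H (hdiff H (hadd H (u n) (v n)) (hadd H x y))) \<longlonglongrightarrow> 0"
  proof (rule tendsto_sandwich[where f = "\<lambda>_. 0"])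
    show "(\<lambda>n. hnorm H (hdiff H (u n) x) + hnorm H (hdiff H (v n) y)) \<longlonglongrightarrow> 0"
      using assms unfolding conv_def by (auto intro!: tendsto_eq_intros)
  qed (use c in \<open>auto simp: hnorm_nonneg closed hnorm_diff_add\<close>)
  then show ?thesis using c by (simp add: conv_def closed)
qed

lemma conv_scale:
  assumes u: "conv u x"
  shows "conv (\<lambda>n. hscale H c (u n)) (hscale H c x)"
  using assms unfolding conv_def
  by (auto simp: closed hnorm_diff_scale intro!: tendsto_eq_intros)

end

sublocale hilbert_space \<subseteq> semi_inner_space H
  by unfold_locales (fact zero_closed add_closed scale_closed add_assoc add_commute add_zero
      add_inverse scale_one scale_scale scale_add_left scale_add_right inner_commute inner_add
      inner_scale inner_nonneg)+

context hilbert_space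
begin

lemma hnorm_eq_0: "\<lbrakk>x \<in> carr H; hnorm H x = 0\<rbrakk> \<Longrightarrow> x = hzero H"
  using hinner_self inner_definite by simp

lemma hdiff_eq_0:
  assumes "x \<in> carr H" "y \<in> carr H" "hnorm H (hdiff H x y) = 0"
  shows "x = y"
proof -
  have e: "hadd H x (hscale H (-1) y) = hzero H"
    using assms hnorm_eq_0[of "hdiff H x y"] by (simp add: closed flip: hdiff_def)
  have "x = hadd H x (hadd H y (hscale H (-1) y))" using assms by (simp add: hadd_inverse hadd_zero)
  also have "\<dots> = hadd H x (hadd H (hscale H (-1) y) y)" using assms by (simp add: hadd_commute closed)
  also have "\<dots> = hadd H (hadd H x (hscale H (-1) y)) y" using assms by (simp add: hadd_assoc closed)
  also have "\<dots> = hadd H (hzero H) y" by (simp only: e)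
  also have "\<dots> = y" using assms by (simp add: hadd_commute[of "hzero H" y] hadd_zero closed)
  finally show ?thesis .
qed

lemma vec_eqI:
  assumes "x \<in> carr H" "y \<in> carr H" "\<And>z. z \<in> carr H \<Longrightarrow> hinner H z x = hinner H z y"
  shows "x = y"
proof (rule hdiff_eq_0)
  have "hinner H (hdiff H x y) (hdiff H x y) = 0"
    using assms by (simp add: hinner_diff_right closed)
  then show "hnorm H (hdiff H x y) = 0" by (simp add: hnorm_def)
qed (use assms in auto)

lemma conv_complete:
  assumes "cauchy_seq H u"
  obtains x where "conv u x"
  using complete[OF assms] assms by (auto simp: conv_def cauchy_seq_def)

lemma conv_unique: "\<lbrakk>conv u x; conv u y\<rbrakk> \<Longrightarrow> x = y"
proof (rule vec_eqI)
  fix z assume "conv u x" "conv u y" "z \<in> carr H"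
  then show "hinner H z x = hinner H z y"
    using conv_hinner[OF conv_const[of z]] LIMSEQ_unique by blast
qed (auto simp: conv_def)

text \<open>The representing vector minimises \<^term>\<open>(hnorm H x)\<^sup>2 - 2 * Re (phi x)\<close>.\<close>

lemma Riesz:
  assumes add: "\<And>x y. \<lbrakk>x \<in> carr H; y \<in> carr H\<rbrakk> \<Longrightarrow> phi (hadd H x y) = phi x + phi y"
    and scale: "\<And>c x. x \<in> carr H \<Longrightarrow> phi (hscale H c x) = c * phi x"
    and bound: "\<And>x. x \<in> carr H \<Longrightarrow> cmod (phi x) \<le> C * hnorm H x"
  obtains x where "x \<in> carr H" "\<And>z. z \<in> carr H \<Longrightarrow> hinner H x z = phi z"
proof -
  define J where "J x = (hnorm H x)\<^sup>2 - 2 * Re (phi x)" for x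
  have J_ge: "J x \<ge> - C\<^sup>2" if "x \<in> carr H" for x
  proof -
    have "Re (phi x) \<le> C * hnorm H x" using bound[OF that] complex_Re_le_cmod order_trans by blast
    moreover have "0 \<le> (hnorm H x - C)\<^sup>2" by simp
    ultimately show ?thesis unfolding J_def by (simp add: power2_eq_square algebra_simps)
  qed
  define m where "m = Inf (J ` carr H)"
  have bdd: "bdd_below (J ` carr H)" using J_ge by (auto intro!: bdd_belowI)
  have m_le: "m \<le> J x" if "x \<in> carr H" for x
    unfolding m_def using bdd that by (intro cInf_lower) auto
  have "\<exists>x\<in>carr H. J x < m + 1 / real (Suc n)" for n
  proof -
    have "\<exists>y\<in>J ` carr H. y < m + 1 / real (Suc n)"
      unfolding m_def using zero_in bdd by (subst cInf_less_iff[symmetric]) auto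
    then show ?thesis by auto
  qed
  then obtain u where u: "\<And>n. u n \<in> carr H" and Ju: "\<And>n. J (u n) < m + 1 / real (Suc n)" by metis
  \<comment> \<open>Parallelogram law with the midpoint \<open>w\<close>: the linear terms of
    \<open>J\<close> cancel and \<open>J w\<close> is at least the infimum \<open>m\<close>, so
    almost minimisers are close to each other.\<close>
  have par: "(hnorm H (hdiff H x y))\<^sup>2 \<le> 2 * (J x - m) + 2 * (J y - m)"
    if x: "x \<in> carr H" and y: "y \<in> carr H" for x y
  proof -
    define w where "w = hscale H (1/2) (hadd H x y)"
    have w: "w \<in> carr H" unfolding w_def using x y by (simp add: closed)
    have "(hnorm H (hdiff H x y))\<^sup>2 = 2 * J x + 2 * J y - 4 * J w"
      unfolding J_def w_def using x y
      by (simp add: hnorm_sq inner_simps closed add scale algebra_simps)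
    then show ?thesis using m_le[OF w] by simp
  qed
  have "cauchy_seq H u"
    unfolding cauchy_seq_def
  proof (intro conjI allI impI u)
    fix e :: real assume e: "0 < e"
    then obtain N where N: "1 / real (Suc N) < e\<^sup>2 / 4"
      using nat_approx_posE[of "e\<^sup>2 / 4"] by auto
    have Nn: "J (u n) - m < e\<^sup>2 / 4" if "N \<le> n" for n
    proof -
      have "1 / real (Suc n) \<le> 1 / real (Suc N)" using that by (simp add: frac_le)
      then show ?thesis using Ju[of n] N by linarith
    qed
    have "hnorm H (hdiff H (u i) (u j)) < e" if "N \<le> i" "N \<le> j" for i j
    proof -
      have "(hnorm H (hdiff H (u i) (u j)))\<^sup>2 < e\<^sup>2"
        using par[OF u u, of i j] Nn[OF that(1)] Nn[OF that(2)] by argo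
      then show ?thesis using e power2_less_imp_less by fastforce
    qed
    then show "\<exists>N. \<forall>i\<ge>N. \<forall>j\<ge>N. hnorm H (hdiff H (u i) (u j)) < e" by blast
  qed
  then obtain x where ux: "conv u x" using conv_complete by blast
  then have x: "x \<in> carr H" by (simp add: conv_def)
  have phi_lim: "(\<lambda>n. phi (u n)) \<longlonglongrightarrow> phi x"
  proof -
    have "(\<lambda>n. phi (u n) - phi x) \<longlonglongrightarrow> 0"
    proof (rule tendsto_0_le[where K = "\<bar>C\<bar>"])
      show "(\<lambda>n. hnorm H (hdiff H (u n) x)) \<longlonglongrightarrow> 0" using ux by (simp add: conv_def)
      have "cmod (phi (u n) - phi x) \<le> \<bar>C\<bar> * hnorm H (hdiff H (u n) x)" for n
      proof -
        have "phi (u n) - phi x = phi (hdiff H (u n) x)"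
          using u x by (simp add: hdiff_def add scale closed)
        also have "cmod \<dots> \<le> C * hnorm H (hdiff H (u n) x)" using u x by (intro bound) (simp add: closed)
        also have "\<dots> \<le> \<bar>C\<bar> * hnorm H (hdiff H (u n) x)"
          using u x by (intro mult_right_mono) (auto simp: hnorm_nonneg closed)
        finally show ?thesis .
      qed
      then show "\<forall>\<^sub>F n in sequentially. norm (phi (u n) - phi x) \<le> norm (hnorm H (hdiff H (u n) x)) * \<bar>C\<bar>"
        using u x by (simp add: hnorm_nonneg closed mult.commute)
    qed
    then show ?thesis by (simp add: LIM_zero_iff)
  qed
  have "(\<lambda>n. J (u n)) \<longlonglongrightarrow> J x"
    unfolding J_def by (intro tendsto_intros conv_hnorm[OF ux] phi_lim)
  moreover have "(\<lambda>n. m + 1 / real (Suc n)) \<longlonglongrightarrow> m + 0"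
    by (intro tendsto_intros LIMSEQ_Suc lim_1_over_n)
  ultimately have "J x \<le> m + 0"
    by (rule LIMSEQ_le) (use Ju less_imp_le in blast)
  then have Jx: "J x \<le> J z" if "z \<in> carr H" for z using m_le[OF that] by simp
  \<comment> \<open>Minimality of \<open>x\<close> along the real line in direction \<open>z\<close>
    gives a nonnegative quadratic in \<open>t\<close> without constant term, whose linear
    coefficient must vanish.\<close>
  have re: "Re (hinner H x z) = Re (phi z)" if z: "z \<in> carr H" for z
  proof -
    have "(Re (hinner H x z) - Re (phi z))\<^sup>2 \<le> 0 * (hnorm H z)\<^sup>2"
    proof (rule nonneg_quadratic_bound)
      fix t :: real
      have "J (hadd H x (hscale H (complex_of_real t) z)) =
          J x + 2 * t * (Re (hinner H x z) - Re (phi z)) + t\<^sup>2 * (hnorm H z)\<^sup>2"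
        unfolding J_def using x z hinner_commute[of z x]
        by (simp add: hnorm_sq inner_simps closed add scale algebra_simps)
          (simp add: power2_eq_square)
      moreover have "J x \<le> J (hadd H x (hscale H (complex_of_real t) z))"
        using x z by (intro Jx) (simp add: closed)
      ultimately show "0 \<le> 0 + 2 * t * (Re (hinner H x z) - Re (phi z)) + t\<^sup>2 * (hnorm H z)\<^sup>2"
        by simp
    qed
    then show ?thesis by simp
  qed
  \<comment> \<open>Real variations see real parts only; testing with
    \<open>hscale H (- \<i>) z\<close> supplies the imaginary part.\<close>
  have "hinner H x z = phi z" if z: "z \<in> carr H" for z
  proof (rule complex_eqI)
    show "Re (hinner H x z) = Re (phi z)" by (rule re[OF z])
    have "Re (hinner H x (hscale H (- \<i>) z)) = Re (phi (hscale H (- \<i>) z))"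
      using z by (intro re) (simp add: closed)
    then show "Im (hinner H x z) = Im (phi z)" using x z by (simp add: inner_simps scale)
  qed
  then show ?thesis using that x by blast
qed

end

section \<open>Bounded operators and adjoints\<close>

lemma hilbert_semi_inner [simp]: "hilbert_space H \<Longrightarrow> semi_inner_space H"
  proof -
  assume "hilbert_space H"
  then interpret hilbert_space H .
  show ?thesis by (rule semi_inner_space_axioms)
qed

declare semi_inner_space.closed [simp] semi_inner_space.inner_simps [simp]

lemma bounded_opsI:
  assumes "T \<in> extensional (carr H)" "\<And>x. x \<in> carr H \<Longrightarrow> T x \<in> carr K"
    and "\<And>x y. \<lbrakk>x \<in> carr H; y \<in> carr H\<rbrakk> \<Longrightarrow> T (hadd H x y) = hadd K (T x) (T y)"
    and "\<And>c x. x \<in> carr H \<Longrightarrow> T (hscale H c x) = hscale K c (T x)"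
    and "\<And>x. x \<in> carr H \<Longrightarrow> hnorm K (T x) \<le> C * hnorm H x"
  shows "T \<in> bounded_ops H K"
  using assms unfolding bounded_ops_def by (simp add: PiE_def Pi_def) blast

lemma restrict_bounded_opsI:
  assumes "semi_inner_space H" "\<And>x. x \<in> carr H \<Longrightarrow> T x \<in> carr K"
    and "\<And>x y. \<lbrakk>x \<in> carr H; y \<in> carr H\<rbrakk> \<Longrightarrow> T (hadd H x y) = hadd K (T x) (T y)"
    and "\<And>c x. x \<in> carr H \<Longrightarrow> T (hscale H c x) = hscale K c (T x)"
    and "\<And>x. x \<in> carr H \<Longrightarrow> hnorm K (T x) \<le> C * hnorm H x"
  shows "(\<lambda>x\<in>carr H. T x) \<in> bounded_ops H K"
  using assms by (intro bounded_opsI[where C = C]) auto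

lemma op_in: "\<lbrakk>T \<in> bounded_ops H K; x \<in> carr H\<rbrakk> \<Longrightarrow> T x \<in> carr K"
  by (auto simp: bounded_ops_def)

lemma op_hadd: "\<lbrakk>T \<in> bounded_ops H K; x \<in> carr H; y \<in> carr H\<rbrakk> \<Longrightarrow>
    T (hadd H x y) = hadd K (T x) (T y)"
  by (auto simp: bounded_ops_def)

lemma op_hscale: "\<lbrakk>T \<in> bounded_ops H K; x \<in> carr H\<rbrakk> \<Longrightarrow> T (hscale H c x) = hscale K c (T x)"
  by (auto simp: bounded_ops_def)

lemma op_hdiff: "\<lbrakk>T \<in> bounded_ops H K; semi_inner_space H; x \<in> carr H; y \<in> carr H\<rbrakk> \<Longrightarrow>
    T (hdiff H x y) = hdiff K (T x) (T y)"
  by (simp add: hdiff_def op_hadd op_hscale)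

lemma op_hzero:
  assumes T: "T \<in> bounded_ops H K" and H: "semi_inner_space H" and K: "hilbert_space K"
  shows "T (hzero H) = hzero K"
proof -
  have "T (hzero H) = T (hscale H 0 (hzero H))"
    using semi_inner_space.hzero_eq[OF H] by simp
  also have "\<dots> = hscale K 0 (T (hzero H))"
    by (rule op_hscale[OF T]) (simp add: H)
  finally have e: "T (hzero H) = hscale K 0 (T (hzero H))" .
  show ?thesis
    by (rule hilbert_space.vec_eqI[OF K]; (subst e)?) (simp_all add: op_in[OF T] H K)
qed

lemma op_extensional: "T \<in> bounded_ops H K \<Longrightarrow> T \<in> extensional (carr H)"
  by (auto simp: bounded_ops_def PiE_def)

lemma op_bound:
  assumes "T \<in> bounded_ops H K" "semi_inner_space H"
  obtains C where "0 < C" "\<And>x. x \<in> carr H \<Longrightarrow> hnorm K (T x) \<le> C * hnorm H x"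
proof -
  obtain C where C: "\<And>x. x \<in> carr H \<Longrightarrow> hnorm K (T x) \<le> C * hnorm H x"
    using assms(1) unfolding bounded_ops_def by blast
  have "hnorm K (T x) \<le> (\<bar>C\<bar> + 1) * hnorm H x" if "x \<in> carr H" for x
  proof -
    have "C * hnorm H x \<le> (\<bar>C\<bar> + 1) * hnorm H x"
      using assms(2) that by (intro mult_right_mono) (auto simp: semi_inner_space.hnorm_nonneg)
    then show ?thesis using C[OF that] by simp
  qed
  then show ?thesis using that[of "\<bar>C\<bar> + 1"] by simp
qed

lemma op_eqI:
  assumes "S \<in> bounded_ops H K" "T \<in> bounded_ops H K" "\<And>x. x \<in> carr H \<Longrightarrow> S x = T x"
  shows "S = T"
  using assms by (meson extensionalityI op_extensional)

lemma compose_in: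
  assumes S: "S \<in> bounded_ops K G" and T: "T \<in> bounded_ops H K"
    and H: "semi_inner_space H" and K: "semi_inner_space K"
  shows "compose (carr H) S T \<in> bounded_ops H G"
proof -
  obtain C where C: "0 < C" "\<And>x. x \<in> carr K \<Longrightarrow> hnorm G (S x) \<le> C * hnorm K x"
    using op_bound[OF S K] by blast
  obtain D where D: "0 < D" "\<And>x. x \<in> carr H \<Longrightarrow> hnorm K (T x) \<le> D * hnorm H x"
    using op_bound[OF T H] by blast
  show ?thesis
  proof (rule bounded_opsI)
    fix x assume x: "x \<in> carr H"
    then have "hnorm G (S (T x)) \<le> C * hnorm K (T x)" using C op_in[OF T] by simp
    also have "\<dots> \<le> C * (D * hnorm H x)" using C D x by (intro mult_left_mono) auto
    finally show "hnorm G (compose (carr H) S T x) \<le> (C * D) * hnorm H x"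
      using x by (simp add: compose_eq mult.assoc)
  qed (simp_all add: H K compose_eq op_in[OF S] op_in[OF T] op_hadd[OF S] op_hadd[OF T] op_hscale[OF S] op_hscale[OF T])
qed

lemma op_id_in [simp]: "semi_inner_space H \<Longrightarrow> op_id H \<in> bounded_ops H H"
  unfolding op_id_def by (rule restrict_bounded_opsI[where C = 1]) auto

lemma op_id_apply [simp]: "x \<in> carr H \<Longrightarrow> op_id H x = x"
  by (simp add: op_id_def)

lemma compose_id_left: "T \<in> bounded_ops H K \<Longrightarrow> compose (carr H) (op_id K) T = T"
  by (rule extensionalityI[of _ "carr H"]) (auto simp: compose_eq op_extensional op_in[of T H K])

lemma op_scale_in [simp]:
  assumes H: "semi_inner_space H" and K: "hilbert_space K" and T: "T \<in> bounded_ops H K"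
  shows "op_scale H K c T \<in> bounded_ops H K"
proof -
  interpret K: hilbert_space K by (rule K)
  obtain C where C: "0 < C" "\<And>x. x \<in> carr H \<Longrightarrow> hnorm K (T x) \<le> C * hnorm H x"
    using op_bound[OF T H] by blast
  show ?thesis
    unfolding op_scale_def
  proof (rule restrict_bounded_opsI)
    fix x assume x: "x \<in> carr H"
    then show "hnorm K (hscale K c (T x)) \<le> (cmod c * C) * hnorm H x"
      using mult_left_mono[OF C(2)[OF x], of "cmod c"]
      by (simp add: K.hnorm_scale op_in[OF T] mult.assoc)
  qed (simp_all add: H K op_in[OF T] op_hadd[OF T] op_hscale[OF T] K.hscale_scale K.hscale_add_right mult.commute)
qed

lemma op_add_in [simp]:
  assumes H: "semi_inner_space H" and K: "hilbert_space K"
    and S: "S \<in> bounded_ops H K" and T: "T \<in> bounded_ops H K"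
  shows "op_add H K S T \<in> bounded_ops H K"
proof -
  interpret K: hilbert_space K by (rule K)
  obtain C where C: "0 < C" "\<And>x. x \<in> carr H \<Longrightarrow> hnorm K (S x) \<le> C * hnorm H x"
    using op_bound[OF S H] by blast
  obtain D where D: "0 < D" "\<And>x. x \<in> carr H \<Longrightarrow> hnorm K (T x) \<le> D * hnorm H x"
    using op_bound[OF T H] by blast
  show ?thesis
    unfolding op_add_def
  proof (rule restrict_bounded_opsI)
    fix x assume x: "x \<in> carr H"
    then show "hnorm K (hadd K (S x) (T x)) \<le> (C + D) * hnorm H x"
      using K.hnorm_add[OF op_in[OF S x] op_in[OF T x]] C(2)[OF x] D(2)[OF x]
      by (simp add: algebra_simps)
  next
    fix x y assume "x \<in> carr H" "y \<in> carr H"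
    then show "hadd K (S (hadd H x y)) (T (hadd H x y)) =
        hadd K (hadd K (S x) (T x)) (hadd K (S y) (T y))"
      by (intro K.vec_eqI) (simp_all add: H K op_in[OF S] op_in[OF T] op_hadd[OF S] op_hadd[OF T])
  qed (simp_all add: H K op_in[OF S] op_in[OF T] op_hscale[OF S] op_hscale[OF T] K.hscale_add_right)
qed

lemma op_add_apply [simp]: "x \<in> carr H \<Longrightarrow> op_add H K S T x = hadd K (S x) (T x)"
  by (simp add: op_add_def)

lemma op_scale_apply [simp]: "x \<in> carr H \<Longrightarrow> op_scale H K c T x = hscale K c (T x)"
  by (simp add: op_scale_def)

lemma op_conv:
  assumes T: "T \<in> bounded_ops H K" and H: "semi_inner_space H" and K: "semi_inner_space K"
    and u: "semi_inner_space.conv H u x"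
  shows "semi_inner_space.conv K (\<lambda>n. T (u n)) (T x)"
proof -
  interpret H: semi_inner_space H by (rule H)
  interpret K: semi_inner_space K by (rule K)
  have ux: "\<And>n. u n \<in> carr H" "x \<in> carr H" and lim: "(\<lambda>n. hnorm H (hdiff H (u n) x)) \<longlonglongrightarrow> 0"
    using u by (auto simp: H.conv_def)
  obtain C where C: "0 < C" "\<And>x. x \<in> carr H \<Longrightarrow> hnorm K (T x) \<le> C * hnorm H x"
    using op_bound[OF T H] by blast
  have "(\<lambda>n. hnorm K (hdiff K (T (u n)) (T x))) \<longlonglongrightarrow> 0"
  proof (rule tendsto_sandwich[where f = "\<lambda>_. 0"])
    show "(\<lambda>n. C * hnorm H (hdiff H (u n) x)) \<longlonglongrightarrow> 0"
      using lim by (auto intro!: tendsto_eq_intros)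
    have "hnorm K (hdiff K (T (u n)) (T x)) \<le> C * hnorm H (hdiff H (u n) x)" for n
      using C(2)[of "hdiff H (u n) x"] ux by (simp add: op_hdiff[OF T H] H)
    then show "\<forall>\<^sub>F n in sequentially. hnorm K (hdiff K (T (u n)) (T x)) \<le> C * hnorm H (hdiff H (u n) x)"
      by simp
  qed (use ux in \<open>auto simp: K.hnorm_nonneg op_in[OF T] K\<close>)
  then show ?thesis using ux by (auto simp: K.conv_def op_in[OF T])
qed

text \<open>\<open>adj\<close> is a definite description: Riesz supplies the vector, nondegeneracy
  its uniqueness. Afterwards adjoints are handled through \<open>adj_left\<close> and
  \<open>adj_right\<close>.\<close>

lemma adj_spec:
  assumes H: "hilbert_space H" and K: "hilbert_space K" and T: "T \<in> bounded_ops H K"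
    and y: "y \<in> carr K"
  shows "adj H K T y \<in> carr H \<and> (\<forall>z\<in>carr H. hinner H (adj H K T y) z = hinner K y (T z))"
proof -
  interpret H: hilbert_space H by (rule H)
  interpret K: hilbert_space K by (rule K)
  obtain C where C: "0 < C" "\<And>x. x \<in> carr H \<Longrightarrow> hnorm K (T x) \<le> C * hnorm H x"
    using op_bound[OF T] H.semi_inner_space_axioms by blast
  have bd: "cmod (hinner K y (T x)) \<le> (hnorm K y * C) * hnorm H x" if "x \<in> carr H" for x
  proof -
    have "cmod (hinner K y (T x)) \<le> hnorm K y * hnorm K (T x)"
      using y that by (intro K.Cauchy_Schwarz) (auto simp: op_in[OF T])
    also have "\<dots> \<le> hnorm K y * (C * hnorm H x)"
      using C that y by (intro mult_left_mono) (auto simp: K.hnorm_nonneg)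
    finally show ?thesis by (simp add: mult.assoc)
  qed
  obtain x where x: "x \<in> carr H" "\<And>z. z \<in> carr H \<Longrightarrow> hinner H x z = hinner K y (T z)"
    using H.Riesz[of "\<lambda>x. hinner K y (T x)", OF _ _ bd] y K
    by (auto simp: op_hadd[OF T] op_hscale[OF T] op_in[OF T])
  have "(THE x. x \<in> carr H \<and> (\<forall>z\<in>carr H. hinner H x z = hinner K y (T z))) = x"
  proof (rule the_equality)
    fix w assume w: "w \<in> carr H \<and> (\<forall>z\<in>carr H. hinner H w z = hinner K y (T z))"
    show "w = x"
    proof (rule H.vec_eqI)
      fix z assume z: "z \<in> carr H"
      have "hinner H w z = hinner H x z" using w x z by simp
      then show "hinner H z w = hinner H z x"
        using H.hinner_commute[of z w] H.hinner_commute[of z x] w x z by simp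
    qed (use w x in auto)
  qed (use x in auto)
  then show ?thesis using x y by (simp add: adj_def)
qed

lemma adj_apply_in [simp]:
  "\<lbrakk>hilbert_space H; hilbert_space K; T \<in> bounded_ops H K; y \<in> carr K\<rbrakk> \<Longrightarrow> adj H K T y \<in> carr H"
  by (simp add: adj_spec)

lemma adj_left:
  "\<lbrakk>hilbert_space H; hilbert_space K; T \<in> bounded_ops H K; y \<in> carr K; z \<in> carr H\<rbrakk> \<Longrightarrow>
    hinner H (adj H K T y) z = hinner K y (T z)"
  by (simp add: adj_spec)

lemma adj_right:
  "\<lbrakk>hilbert_space H; hilbert_space K; T \<in> bounded_ops H K; y \<in> carr K; z \<in> carr H\<rbrakk> \<Longrightarrow>
    hinner H z (adj H K T y) = hinner K (T z) y"
  using adj_left[of H K T y z] hilbert_space.inner_commute[of H z "adj H K T y"]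
    hilbert_space.inner_commute[of K "T z" y] op_in[of T H K z] by simp

lemma adj_in [simp]:
  assumes H: "hilbert_space H" and K: "hilbert_space K" and T: "T \<in> bounded_ops H K"
  shows "adj H K T \<in> bounded_ops K H"
proof -
  interpret H: hilbert_space H by (rule H)
  interpret K: hilbert_space K by (rule K)
  note [simp] = H K T
  obtain C where C: "0 < C" "\<And>x. x \<in> carr H \<Longrightarrow> hnorm K (T x) \<le> C * hnorm H x"
    using op_bound[OF T] H.semi_inner_space_axioms by blast
  show ?thesis
  proof (rule bounded_opsI)
    show "adj H K T \<in> extensional (carr K)" by (simp add: adj_def)
    fix y assume y: "y \<in> carr K"
    define w where "w = adj H K T y"
    have w: "w \<in> carr H" using y by (simp add: w_def)
    have "(hnorm H w)\<^sup>2 = Re (hinner K y (T w))"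
      using y w by (simp add: H.hnorm_sq) (simp add: w_def adj_left)
    also have "\<dots> \<le> hnorm K y * hnorm K (T w)"
      using order_trans[OF complex_Re_le_cmod K.Cauchy_Schwarz[of y "T w"]] y w
      by (simp add: op_in[OF T])
    also have "\<dots> \<le> hnorm K y * (C * hnorm H w)"
      using C w y by (intro mult_left_mono) (auto simp: K.hnorm_nonneg)
    finally have "hnorm H w * hnorm H w \<le> (C * hnorm K y) * hnorm H w"
      by (simp add: power2_eq_square mult_ac)
    moreover have "0 \<le> C * hnorm K y" using C y by (simp add: K.hnorm_nonneg)
    \<comment> \<open>One factor \<open>hnorm H w\<close> is cancelled from the square; if it is
      zero, the bound is immediate.\<close>
    ultimately show "hnorm H (adj H K T y) \<le> C * hnorm K y"
      using w H.hnorm_nonneg[OF w] unfolding w_def[symmetric]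
      by (cases "hnorm H w = 0") (auto dest!: mult_right_le_imp_le)
  qed (auto intro!: H.vec_eqI simp: adj_right op_in[OF T])
qed

lemma adjI:
  assumes "hilbert_space H" "hilbert_space K" "T \<in> bounded_ops H K" "S \<in> bounded_ops K H"
    and "\<And>y z. \<lbrakk>y \<in> carr K; z \<in> carr H\<rbrakk> \<Longrightarrow> hinner H z (S y) = hinner K (T z) y"
  shows "adj H K T = S"
  using assms
  by (intro op_eqI[of _ K H]) (auto intro!: hilbert_space.vec_eqI[of H] simp: adj_right op_in[of S K H])

lemma adj_adj: "\<lbrakk>hilbert_space H; hilbert_space K; T \<in> bounded_ops H K\<rbrakk> \<Longrightarrow>
    adj K H (adj H K T) = T"
  by (rule adjI) (auto simp: adj_left)

lemma adj_op_id: "hilbert_space H \<Longrightarrow> adj H H (op_id H) = op_id H"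
  by (rule adjI) auto

lemma adj_compose:
  "\<lbrakk>hilbert_space H; hilbert_space K; hilbert_space G; T \<in> bounded_ops H K; S \<in> bounded_ops K G\<rbrakk> \<Longrightarrow>
    adj H G (compose (carr H) S T) = compose (carr G) (adj H K T) (adj K G S)"
  by (rule adjI) (auto simp: compose_eq adj_right op_in[of T H K] intro: compose_in[where K = K])

section \<open>Closed subspaces and projections\<close>

definition closed_subspace :: "('x, 'm) hilb_scheme \<Rightarrow> 'x set \<Rightarrow> bool" where
  "closed_subspace H N \<longleftrightarrow> N \<subseteq> carr H \<and> hzero H \<in> N \<and> (\<forall>x\<in>N. \<forall>y\<in>N. hadd H x y \<in> N) \<and>
     (\<forall>c. \<forall>x\<in>N. hscale H c x \<in> N) \<and>
     (\<forall>u x. (\<forall>n. u n \<in> N) \<and> semi_inner_space.conv H u x \<longrightarrow> x \<in> N)"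

lemma closed_subspaceD:
  assumes "closed_subspace H N"
  shows "x \<in> N \<Longrightarrow> x \<in> carr H" and "hzero H \<in> N"
    and "\<lbrakk>x \<in> N; y \<in> N\<rbrakk> \<Longrightarrow> hadd H x y \<in> N" and "x \<in> N \<Longrightarrow> hscale H c x \<in> N"
  using assms by (auto simp: closed_subspace_def)

lemma closed_subspace_limit:
  assumes "closed_subspace H N" "\<And>n. u n \<in> N" "semi_inner_space.conv H u x"
  shows "x \<in> N"
proof -
  have "\<forall>u x. (\<forall>n. u n \<in> N) \<and> semi_inner_space.conv H u x \<longrightarrow> x \<in> N"
    using assms(1) unfolding closed_subspace_def by (elim conjE)
  from this[rule_format, of u x] show ?thesis using assms(2,3) by simp
qed

text \<open>Changing the carrier keeps all operations, so \<open>Riesz\<close> can be applied inside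
  \<open>N\<close>; this is what produces orthogonal projections.\<close>

lemma closed_subspace_hilbert:
  assumes H: "hilbert_space H" and N: "closed_subspace H N"
  shows "hilbert_space (H\<lparr>carr := N\<rparr>)"
proof -
  interpret H: hilbert_space H by (rule H)
  have sub: "x \<in> carr H" if "x \<in> N" for x using N that by (auto simp: closed_subspace_def)
  have [simp]: "hnorm (H\<lparr>carr := N\<rparr>) = hnorm H" "hdiff (H\<lparr>carr := N\<rparr>) = hdiff H"
    by (simp_all add: fun_eq_iff hnorm_def hdiff_def)
  show ?thesis
  proof
    fix u assume "cauchy_seq (H\<lparr>carr := N\<rparr>) u"
    then have u: "\<And>n. u n \<in> N" and "cauchy_seq H u"
      by (auto simp: cauchy_seq_def sub)
    then obtain x where x: "H.conv u x" using H.conv_complete by blast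
    then have "x \<in> N" using closed_subspace_limit[OF N, of u x] u by simp
    with x show "\<exists>x\<in>carr (H\<lparr>carr := N\<rparr>). (\<lambda>n. hnorm (H\<lparr>carr := N\<rparr>) (hdiff (H\<lparr>carr := N\<rparr>) (u n) x)) \<longlonglongrightarrow> 0"
      by (auto simp: H.conv_def intro!: bexI[of _ x])
  next
    fix x y assume "x \<in> carr (H\<lparr>carr := N\<rparr>)" "y \<in> carr (H\<lparr>carr := N\<rparr>)"
    then show "hinner (H\<lparr>carr := N\<rparr>) x y = cnj (hinner (H\<lparr>carr := N\<rparr>) y x)"
      using H.hinner_commute[of x y] by (simp add: sub)
    from \<open>x \<in> carr (H\<lparr>carr := N\<rparr>)\<close> \<open>y \<in> carr (H\<lparr>carr := N\<rparr>)\<close>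
    show "hadd (H\<lparr>carr := N\<rparr>) x y = hadd (H\<lparr>carr := N\<rparr>) y x"
      by (simp add: sub H.hadd_commute)
  qed (simp_all add: closed_subspaceD[OF N] sub H.hadd_assoc H.hadd_zero H.hadd_inverse
      H.hscale_one H.hscale_scale H.hscale_add_left H.hscale_add_right H.hinner_nonneg
      H.hinner_add_right H.hinner_scale_right H.inner_definite)
qed

text \<open>The orthogonal projection, encoded as the Riesz vector in \<open>N\<close> of the
  functional \<open>hinner H x\<close>. The choice is unambiguous by
  \<open>proj_eqI\<close>.\<close>

definition proj :: "('x, 'm) hilb_scheme \<Rightarrow> 'x set \<Rightarrow> 'x \<Rightarrow> 'x" where
  "proj H N = (\<lambda>x\<in>carr H. SOME k. k \<in> N \<and> (\<forall>z\<in>N. hinner H k z = hinner H x z))"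

locale subspace_projection = hilbert_space H for H :: "('x, 'm) hilb_scheme" +
  fixes N
  assumes N: "closed_subspace H N"
begin

lemma sub: "x \<in> N \<Longrightarrow> x \<in> carr H"
  using N by (auto simp: closed_subspace_def)

lemma proj_spec:
  assumes x: "x \<in> carr H"
  shows "proj H N x \<in> N \<and> (\<forall>z\<in>N. hinner H (proj H N x) z = hinner H x z)"
proof -
  interpret S: hilbert_space "H\<lparr>carr := N\<rparr>"
    by (rule closed_subspace_hilbert) (rule hilbert_space_axioms N)+
  have [simp]: "hnorm (H\<lparr>carr := N\<rparr>) = hnorm H" by (simp add: fun_eq_iff hnorm_def)
  obtain k where "k \<in> N" "\<And>z. z \<in> N \<Longrightarrow> hinner H k z = hinner H x z"
    using S.Riesz[of "hinner H x" "hnorm H x"] x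
    by (auto simp: sub semi_inner_space_axioms Cauchy_Schwarz)
  then have "\<exists>k. k \<in> N \<and> (\<forall>z\<in>N. hinner H k z = hinner H x z)" by blast
  from someI_ex[OF this] show ?thesis using x by (simp add: proj_def)
qed

lemma proj_in_subspace: "x \<in> carr H \<Longrightarrow> proj H N x \<in> N"
  by (simp add: proj_spec)

lemma proj_in_carr [simp]: "x \<in> carr H \<Longrightarrow> proj H N x \<in> carr H"
  by (simp add: proj_spec sub)

lemma proj_eqI:
  assumes x: "x \<in> carr H" and k: "k \<in> N" "\<And>z. z \<in> N \<Longrightarrow> hinner H k z = hinner H x z"
  shows "proj H N x = k"
proof -
  interpret S: hilbert_space "H\<lparr>carr := N\<rparr>"
    by (rule closed_subspace_hilbert) (rule hilbert_space_axioms N)+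
  have "hinner H (proj H N x) z = hinner H k z" if "z \<in> N" for z
    using proj_spec[OF x] k that by simp
  then have "hinner H z (proj H N x) = hinner H z k" if "z \<in> N" for z
    using hinner_commute[of z k] hinner_commute[of z "proj H N x"] that x k by (simp add: sub)
  then show ?thesis using S.vec_eqI[of "proj H N x" k] k x by (simp add: proj_in_subspace)
qed

lemma proj_fix: "x \<in> N \<Longrightarrow> proj H N x = x"
  by (rule proj_eqI) (auto simp: sub)

lemma proj_selfadjoint:
  assumes "x \<in> carr H" "y \<in> carr H"
  shows "hinner H x (proj H N y) = hinner H (proj H N x) y"
proof -
  have "hinner H x (proj H N y) = hinner H (proj H N x) (proj H N y)"
    using assms proj_spec[of x] proj_in_subspace[of y] by simp
  also have "\<dots> = cnj (hinner H (proj H N y) (proj H N x))" using assms by (simp add: hinner_commute[symmetric])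
  also have "\<dots> = cnj (hinner H y (proj H N x))"
    using assms proj_spec[of y] proj_in_subspace[of x] by simp
  also have "\<dots> = hinner H (proj H N x) y" using assms by (simp add: hinner_commute[symmetric])
  finally show ?thesis .
qed

lemma proj_bounded [simp]: "proj H N \<in> bounded_ops H H"
proof (rule bounded_opsI)
  note [simp] = semi_inner_space_axioms
  show "proj H N \<in> extensional (carr H)" by (simp add: proj_def)
  fix x assume x: "x \<in> carr H"
  have "(hnorm H (proj H N x))\<^sup>2 = Re (hinner H x (proj H N x))"
    using x proj_spec[of x] by (simp add: hnorm_sq)
  also have "\<dots> \<le> hnorm H x * hnorm H (proj H N x)"
    using order_trans[OF complex_Re_le_cmod Cauchy_Schwarz[of x "proj H N x"]] x by simp
  finally show "hnorm H (proj H N x) \<le> 1 * hnorm H x"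
    using x hnorm_nonneg[of "proj H N x"] hnorm_nonneg[of x]
    by (cases "hnorm H (proj H N x) = 0") (auto simp: power2_eq_square)
qed (auto intro!: vec_eqI simp: proj_selfadjoint semi_inner_space_axioms)

text \<open>\<open>N\<close> reduces \<open>T\<close>: for \<open>z\<close> in \<open>N\<close> the
  vector \<open>adj H H T z\<close> is again in \<open>N\<close>, where \<open>x\<close> and its
  projection have the same inner products. Hence \<open>T (proj H N x)\<close> represents
  \<open>T x\<close> on \<open>N\<close>.\<close>

lemma proj_commute:
  assumes T: "T \<in> bounded_ops H H"
    and "\<And>x. x \<in> N \<Longrightarrow> T x \<in> N" and "\<And>x. x \<in> N \<Longrightarrow> adj H H T x \<in> N" and x: "x \<in> carr H"
  shows "proj H N (T x) = T (proj H N x)"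
proof (rule proj_eqI)
  note [simp] = semi_inner_space_axioms hilbert_space_axioms T
  show "T x \<in> carr H" using x by (simp add: op_in[OF T])
  show "T (proj H N x) \<in> N" using assms proj_in_subspace by simp
  fix z assume z: "z \<in> N"
  have "hinner H (T (proj H N x)) z = hinner H (proj H N x) (adj H H T z)"
    using x z by (simp add: adj_right sub)
  also have "\<dots> = hinner H x (adj H H T z)" using assms z proj_spec[OF x] by simp
  also have "\<dots> = hinner H (T x) z" using x z by (simp add: adj_right sub)
  finally show "hinner H (T (proj H N x)) z = hinner H (T x) z" .
qed

end

section \<open>Closures of linear subspaces\<close>

context hilbert_space
begin

definition closure_of_set :: "'x set \<Rightarrow> 'x set" where
  "closure_of_set S = {x \<in> carr H. \<exists>u. (\<forall>n. u n \<in> S) \<and> conv u x}"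

lemma closure_of_setI: "\<lbrakk>\<And>n. u n \<in> S; conv u x\<rbrakk> \<Longrightarrow> x \<in> closure_of_set S"
  unfolding closure_of_set_def by (rule CollectI) (metis conv_def)

lemma closure_of_setE:
  assumes "x \<in> closure_of_set S"
  obtains u where "\<And>n. u n \<in> S" "conv u x" "x \<in> carr H"
  using assms unfolding closure_of_set_def by blast

lemma closure_closed_subspace:
  assumes S: "S \<subseteq> carr H" "hzero H \<in> S" "\<And>x y. \<lbrakk>x \<in> S; y \<in> S\<rbrakk> \<Longrightarrow> hadd H x y \<in> S"
    "\<And>c x. x \<in> S \<Longrightarrow> hscale H c x \<in> S"
  shows "closed_subspace H (closure_of_set S)"
  unfolding closed_subspace_def
proof (intro conjI ballI allI impI)
  show "closure_of_set S \<subseteq> carr H" by (auto simp: closure_of_set_def)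
  show "hzero H \<in> closure_of_set S"
    by (rule closure_of_setI[rotated, OF conv_const[OF zero_in]]) (rule S(2))
next
  fix x y assume "x \<in> closure_of_set S" "y \<in> closure_of_set S"
  then obtain u v where uv: "\<And>n. u n \<in> S" "conv u x" "\<And>n. v n \<in> S" "conv v y"
    by (metis closure_of_setE)
  have "conv (\<lambda>n. hadd H (u n) (v n)) (hadd H x y)" by (intro conv_add uv)
  then show "hadd H x y \<in> closure_of_set S"
    by (rule closure_of_setI[rotated]) (rule S(3)[OF uv(1) uv(3)])
next
  fix c x assume "x \<in> closure_of_set S"
  then obtain u where u: "\<And>n. u n \<in> S" "conv u x"
    by (metis closure_of_setE)
  have "conv (\<lambda>n. hscale H c (u n)) (hscale H c x)" by (intro conv_scale u)
  then show "hscale H c x \<in> closure_of_set S"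
    by (rule closure_of_setI[rotated]) (rule S(4)[OF u(1)])
next
  fix u x assume ux: "(\<forall>n. u n \<in> closure_of_set S) \<and> conv u x"
  \<comment> \<open>Each \<open>u n\<close> is itself a limit, so it is replaced by an element of
    \<open>S\<close> at distance below 1/(n+1); the chosen elements still converge to
    \<open>x\<close>.\<close>
  have "\<exists>s\<in>S. hnorm H (hdiff H (u n) s) < 1 / real (Suc n)" for n
  proof -
    obtain v where v: "\<forall>k. v k \<in> S" "conv v (u n)" using ux by (auto simp: closure_of_set_def)
    then have "\<forall>\<^sub>F k in sequentially. hnorm H (hdiff H (v k) (u n)) < 1 / real (Suc n)"
      unfolding conv_def by (intro order_tendstoD(2)[where y = 0]) auto
    then obtain k where "hnorm H (hdiff H (v k) (u n)) < 1 / real (Suc n)"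
      by (auto simp: eventually_sequentially)
    then show ?thesis using v by (metis conv_def hnorm_diff_commute)
  qed
  then obtain s where s: "\<And>n. s n \<in> S" "\<And>n. hnorm H (hdiff H (u n) (s n)) < 1 / real (Suc n)"
    by metis
  have c: "\<And>n. u n \<in> carr H" "x \<in> carr H" "\<And>n. s n \<in> carr H" using ux s S by (auto simp: conv_def)
  have "(\<lambda>n. hnorm H (hdiff H (s n) x)) \<longlonglongrightarrow> 0"
  proof (rule tendsto_sandwich[where f = "\<lambda>_. 0"])
    have "(\<lambda>n. 1 / real (Suc n) + hnorm H (hdiff H (u n) x)) \<longlonglongrightarrow> 0 + 0"
      using ux by (intro tendsto_add LIMSEQ_Suc lim_1_over_n) (auto simp: conv_def)
    then show "(\<lambda>n. 1 / real (Suc n) + hnorm H (hdiff H (u n) x)) \<longlonglongrightarrow> 0" by simp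
    have "hnorm H (hdiff H (s n) x) \<le> 1 / real (Suc n) + hnorm H (hdiff H (u n) x)" for n
      using hnorm_diff_triangle[of "s n" "u n" x] hnorm_diff_commute[of "s n" "u n"] c s(2)[of n]
      by simp
    then show "\<forall>\<^sub>F n in sequentially. hnorm H (hdiff H (s n) x) \<le> 1 / real (Suc n) + hnorm H (hdiff H (u n) x)"
      by simp
  qed (use c in \<open>auto simp: hnorm_nonneg closed\<close>)
  then have "conv s x" using c by (simp add: conv_def)
  then show "x \<in> closure_of_set S" by (rule closure_of_setI[rotated]) (rule s(1))
qed

lemma closure_invariant:
  assumes T: "T \<in> bounded_ops H H" and "\<And>x. x \<in> S \<Longrightarrow> T x \<in> S" and x: "x \<in> closure_of_set S"
  shows "T x \<in> closure_of_set S"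
proof -
  obtain u where u: "\<And>n. u n \<in> S" "conv u x" using x by (metis closure_of_setE)
  show ?thesis
    by (rule closure_of_setI[OF _ op_conv[OF T semi_inner_space_axioms semi_inner_space_axioms u(2)]])
      (rule assms(2)[OF u(1)])
qed

lemma closure_superset: "\<lbrakk>S \<subseteq> carr H; x \<in> S\<rbrakk> \<Longrightarrow> x \<in> closure_of_set S"
  using closure_of_setI[of "\<lambda>_. x" S x] conv_const[of x] by blast

end

section \<open>Inverses and positivity\<close>

context hilbert_space
begin

text \<open>Lax-Milgram for a symmetric operator: coercivity makes \<open>hinner H x (B y)\<close>
  an inner product equivalent to the given one, and solving \<open>B x = y\<close> becomes Riesz for
  the new product.\<close>

lemma coercive_inverse:
  assumes B: "B \<in> bounded_ops H H"
    and sym: "\<And>x y. \<lbrakk>x \<in> carr H; y \<in> carr H\<rbrakk> \<Longrightarrow> hinner H x (B y) = hinner H (B x) y"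
    and e: "0 < e" and coercive: "\<And>x. x \<in> carr H \<Longrightarrow> e * (hnorm H x)\<^sup>2 \<le> Re (hinner H x (B x))"
  obtains R where "R \<in> bounded_ops H H" "\<And>x. x \<in> carr H \<Longrightarrow> R (B x) = x"
    "\<And>x. x \<in> carr H \<Longrightarrow> B (R x) = x"
proof -
  note [simp] = semi_inner_space_axioms hilbert_space_axioms
  note [simp] = op_in[OF B] op_hadd[OF B] op_hscale[OF B] op_hdiff[OF B]
  define G where "G = H\<lparr>hinner := \<lambda>x y. hinner H x (B y)\<rparr>"
  have G [simp]: "carr G = carr H" "hzero G = hzero H" "hadd G = hadd H" "hscale G = hscale H"
    "hinner G = (\<lambda>x y. hinner H x (B y))" "hdiff G = hdiff H"
    by (simp_all add: G_def hdiff_def fun_eq_iff)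
  have Im0: "Im (hinner H x (B x)) = 0" if "x \<in> carr H" for x
    using that hinner_commute[of x "B x"] by (simp add: sym[symmetric] complex_eq_iff)
  have lower: "sqrt e * hnorm H x \<le> hnorm G x" if "x \<in> carr H" for x
  proof -
    have "sqrt (e * (hnorm H x)\<^sup>2) \<le> sqrt (Re (hinner H x (B x)))"
      using coercive[OF that] by (rule real_sqrt_le_mono)
    then show ?thesis using that e by (simp add: real_sqrt_mult hnorm_nonneg hnorm_def[of G])
  qed
  obtain C where C: "0 < C" "\<And>x. x \<in> carr H \<Longrightarrow> hnorm H (B x) \<le> C * hnorm H x"
    using op_bound[OF B] by auto
  have upper: "hnorm G x \<le> sqrt C * hnorm H x" if "x \<in> carr H" for x
  proof -
    have "Re (hinner H x (B x)) \<le> hnorm H x * hnorm H (B x)"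
      using order_trans[OF complex_Re_le_cmod Cauchy_Schwarz[of x "B x"]] that by simp
    also have "\<dots> \<le> hnorm H x * (C * hnorm H x)"
      using C that by (intro mult_left_mono) (auto simp: hnorm_nonneg)
    finally have "sqrt (Re (hinner H x (B x))) \<le> sqrt (C * (hnorm H x)\<^sup>2)"
      by (simp add: power2_eq_square mult_ac)
    then show ?thesis using that C by (simp add: real_sqrt_mult hnorm_nonneg hnorm_def[of G])
  qed
  \<comment> \<open>Completeness is inherited because \<open>lower\<close> and \<open>upper\<close>
    make the norms of \<open>G\<close> and \<open>H\<close> equivalent.\<close>
  interpret G: hilbert_space G
  proof
    fix u assume u: "cauchy_seq G u"
    have "cauchy_seq H u"
      unfolding cauchy_seq_def
    proof (intro conjI allI impI)
      show uc: "u n \<in> carr H" for n using u by (simp add: cauchy_seq_def)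
      fix d :: real assume d: "0 < d"
      have "\<forall>d>0. \<exists>N. \<forall>m\<ge>N. \<forall>n\<ge>N. hnorm G (hdiff H (u m) (u n)) < d"
        using u by (simp add: cauchy_seq_def)
      then obtain N where N: "\<forall>m\<ge>N. \<forall>n\<ge>N. hnorm G (hdiff H (u m) (u n)) < sqrt e * d"
        using d e mult_pos_pos[of "sqrt e" d] by (meson real_sqrt_gt_0_iff)
      have "hnorm H (hdiff H (u m) (u n)) < d" if "N \<le> m" "N \<le> n" for m n
      proof -
        have "sqrt e * hnorm H (hdiff H (u m) (u n)) < sqrt e * d"
          using N that lower[of "hdiff H (u m) (u n)"] uc by fastforce
        then show ?thesis using e by simp
      qed
      then show "\<exists>N. \<forall>m\<ge>N. \<forall>n\<ge>N. hnorm H (hdiff H (u m) (u n)) < d" by blast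
    qed
    then obtain x where x: "conv u x" using conv_complete by blast
    have "(\<lambda>n. hnorm G (hdiff H (u n) x)) \<longlonglongrightarrow> 0"
    proof (rule tendsto_sandwich[where f = "\<lambda>_. 0"])
      show "(\<lambda>n. sqrt C * hnorm H (hdiff H (u n) x)) \<longlonglongrightarrow> 0"
        using x by (auto simp: conv_def intro!: tendsto_eq_intros)
      show "\<forall>\<^sub>F n in sequentially. hnorm G (hdiff H (u n) x) \<le> sqrt C * hnorm H (hdiff H (u n) x)"
        using x by (auto simp: conv_def intro!: always_eventually upper)
      have "0 \<le> sqrt e * hnorm H (hdiff H (u n) x)" for n
        using x e by (simp add: conv_def hnorm_nonneg)
      then show "\<forall>\<^sub>F n in sequentially. 0 \<le> hnorm G (hdiff H (u n) x)"
        using x lower[of "hdiff H (u n) x" for n] by (auto simp: conv_def intro!: always_eventually intro: order_trans)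
    qed simp
    then show "\<exists>x\<in>carr G. (\<lambda>n. hnorm G (hdiff G (u n) x)) \<longlonglongrightarrow> 0"
      using x by (auto simp: conv_def)
  next
    fix x y assume "x \<in> carr G" "y \<in> carr G"
    then show "hinner G x y = cnj (hinner G y x)"
      using hinner_commute[of x "B y"] by (simp add: sym)
    from \<open>x \<in> carr G\<close> \<open>y \<in> carr G\<close> show "hadd G x y = hadd G y x"
      by (simp add: hadd_commute)
  next
    fix x assume x: "x \<in> carr G"
    have "0 \<le> e * (hnorm H x)\<^sup>2" using e by simp
    then show "hinner G x x \<in> \<real>\<^sub>\<ge>\<^sub>0"
      using coercive[of x] x Im0[of x] by (simp add: complex_nonneg_Reals_iff)
    assume "hinner G x x = 0"
    then have "(hnorm H x)\<^sup>2 \<le> 0" using coercive[of x] x e by (simp add: mult_le_0_iff)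
    then show "x = hzero G" using hnorm_eq_0[of x] x by simp
  qed (simp_all add: hadd_assoc hadd_zero hadd_inverse hscale_one hscale_scale
      hscale_add_left hscale_add_right)
  have surj: "\<exists>x\<in>carr H. B x = y" if y: "y \<in> carr H" for y
  proof -
    have bd: "cmod (hinner H y x) \<le> (hnorm H y / sqrt e) * hnorm G x" if "x \<in> carr G" for x
    proof -
      have "cmod (hinner H y x) \<le> hnorm H y * hnorm H x" using y that by (simp add: Cauchy_Schwarz)
      also have "hnorm H x \<le> hnorm G x / sqrt e"
        using lower[of x] that e by (simp add: field_simps)
      finally show ?thesis using y by (simp add: mult_left_mono hnorm_nonneg)
    qed
    \<comment> \<open>The vector representing \<open>hinner H y\<close> in \<open>G\<close>;
      symmetry of \<open>B\<close> turns the representing equation into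
      \<open>B x = y\<close>.\<close>
    obtain x where x: "x \<in> carr H" "\<And>z. z \<in> carr H \<Longrightarrow> hinner H x (B z) = hinner H y z"
      using G.Riesz[of "hinner H y", OF _ _ bd] y by auto
    have "B x = y"
    proof (rule vec_eqI)
      fix z assume z: "z \<in> carr H"
      then show "hinner H z (B x) = hinner H z y"
        using x(2)[OF z] hinner_commute[of z "B x"] hinner_commute[of z y] x(1) y
        by (simp add: sym)
    qed (use x y in auto)
    then show ?thesis using x by blast
  qed
  have below: "e * hnorm H x \<le> hnorm H (B x)" if x: "x \<in> carr H" for x
  proof -
    have "e * (hnorm H x)\<^sup>2 \<le> hnorm H x * hnorm H (B x)"
      using order_trans[OF coercive[OF x] order_trans[OF complex_Re_le_cmod Cauchy_Schwarz[of x "B x"]]] x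
      by simp
    then have "hnorm H x * (e * hnorm H x) \<le> hnorm H x * hnorm H (B x)"
      by (simp add: power2_eq_square mult_ac)
    then show ?thesis using hnorm_nonneg[OF x] hnorm_nonneg[of "B x"] x
      by (cases "hnorm H x = 0") auto
  qed
  have inj: "x = y" if "x \<in> carr H" "y \<in> carr H" "B x = B y" for x y
  proof (rule hdiff_eq_0)
    have "B (hdiff H x y) = hdiff H (B y) (B y)" using that by simp
    then have "hnorm H (B (hdiff H x y)) = 0" using that by (simp add: hnorm_diff_self)
    then show "hnorm H (hdiff H x y) = 0"
      using below[of "hdiff H x y"] that e hnorm_nonneg[of "hdiff H x y"]
      by (simp add: mult_le_0_iff)
  qed (use that in auto)
  define R where "R = (\<lambda>y\<in>carr H. SOME x. x \<in> carr H \<and> B x = y)"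
  have R: "R y \<in> carr H" "B (R y) = y" if y: "y \<in> carr H" for y
  proof -
    have "\<exists>x. x \<in> carr H \<and> B x = y" using surj[OF y] by blast
    from someI_ex[OF this] show "R y \<in> carr H" "B (R y) = y" using y by (simp_all add: R_def)
  qed
  have "R \<in> bounded_ops H H"
  proof (rule bounded_opsI)
    show "R \<in> extensional (carr H)" by (simp add: R_def)
    fix y assume "y \<in> carr H"
    then show "hnorm H (R y) \<le> (1 / e) * hnorm H y"
      using below[of "R y"] R[of y] e by (simp add: field_simps)
  qed (simp_all add: R, (rule inj; simp add: R)+)
  then show ?thesis using R inj that by auto
qed

text \<open>The infimum of the numerical range of a self-adjoint operator belongs to its spectrum.\<close>

lemma nonneg_of_resolvent:
  assumes A: "A \<in> bounded_ops H H"
    and sym: "\<And>x y. \<lbrakk>x \<in> carr H; y \<in> carr H\<rbrakk> \<Longrightarrow> hinner H x (A y) = hinner H (A x) y"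
    and resolvent: "\<And>e. 0 < e \<Longrightarrow> \<exists>R\<in>bounded_ops H H. \<forall>x\<in>carr H.
        R (hadd H (A x) (hscale H (complex_of_real e) x)) = x"
    and x: "x \<in> carr H"
  shows "0 \<le> Re (hinner H x (A x))"
proof -
  note [simp] = semi_inner_space_axioms hilbert_space_axioms
  note [simp] = op_in[OF A] op_hadd[OF A] op_hscale[OF A] op_hdiff[OF A]
  \<comment> \<open>The shifts that make the quadratic form of \<open>A\<close> nonnegative. Because
    of the floor at 0, it remains to show that the infimum \<open>m\<close> is 0.\<close>
  define S where "S = {t. 0 \<le> t \<and> (\<forall>x\<in>carr H. 0 \<le> Re (hinner H x (A x)) + t * (hnorm H x)\<^sup>2)}"
  obtain C where C: "0 < C" "\<And>x. x \<in> carr H \<Longrightarrow> hnorm H (A x) \<le> C * hnorm H x"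
    using op_bound[OF A] by auto
  have "- (C * (hnorm H x)\<^sup>2) \<le> Re (hinner H x (A x))" if "x \<in> carr H" for x
  proof -
    have "\<bar>Re (hinner H x (A x))\<bar> \<le> hnorm H x * hnorm H (A x)"
      using order_trans[OF abs_Re_le_cmod Cauchy_Schwarz[of x "A x"]] that by simp
    also have "\<dots> \<le> hnorm H x * (C * hnorm H x)"
      using C that by (intro mult_left_mono) (auto simp: hnorm_nonneg)
    finally show ?thesis by (simp add: power2_eq_square mult_ac)
  qed
  then have CS: "C \<in> S" using C by (force simp: S_def)
  define m where "m = Inf S"
  have bdd: "bdd_below S" by (auto simp: S_def intro!: bdd_belowI[of _ 0])
  have m0: "0 \<le> m" unfolding m_def using CS by (intro cInf_greatest) (auto simp: S_def)
  have m_form: "0 \<le> Re (hinner H x (A x)) + m * (hnorm H x)\<^sup>2" if x: "x \<in> carr H" for x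
  proof (rule ccontr)
    assume neg: "\<not> 0 \<le> Re (hinner H x (A x)) + m * (hnorm H x)\<^sup>2"
    have Cx: "0 \<le> Re (hinner H x (A x)) + t * (hnorm H x)\<^sup>2" if "t \<in> S" for t
      using that x by (auto simp: S_def)
    have nx: "0 < (hnorm H x)\<^sup>2"
      using Cx[OF CS] neg by (cases "hnorm H x = 0") auto
    have "- Re (hinner H x (A x)) / (hnorm H x)\<^sup>2 \<le> m"
      unfolding m_def
    proof (rule cInf_greatest)
      show "S \<noteq> {}" using CS by blast
      fix t assume "t \<in> S"
      then show "- Re (hinner H x (A x)) / (hnorm H x)\<^sup>2 \<le> t"
        using Cx[of t] nx by (simp add: field_simps)
    qed
    then show False using neg nx by (simp add: field_simps)
  qed
  have "m = 0"
  proof (rule ccontr)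
    assume "m \<noteq> 0"
    then have m: "0 < m" using m0 by simp
    define B where "B = op_add H H A (op_scale H H (complex_of_real m) (op_id H))"
    have B: "B \<in> bounded_ops H H" unfolding B_def by (simp add: A)
    have Bx [simp]: "B x = hadd H (A x) (hscale H (complex_of_real m) x)" if "x \<in> carr H" for x
      using that by (simp add: B_def)
    have Bform: "Re (hinner H x (B x)) = Re (hinner H x (A x)) + m * (hnorm H x)\<^sup>2" if "x \<in> carr H" for x
      using that by (simp add: hnorm_sq)
    have Bsym: "hinner H x (B y) = hinner H (B x) y" if "x \<in> carr H" "y \<in> carr H" for x y
      using that by (simp add: sym)
    obtain D where D: "0 < D" "\<And>x. x \<in> carr H \<Longrightarrow> hnorm H (B x) \<le> D * hnorm H x"
      using op_bound[OF B] by auto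
    obtain R where R: "R \<in> bounded_ops H H" "\<And>x. x \<in> carr H \<Longrightarrow> R (B x) = x"
      using resolvent[OF m] by auto
    obtain c where c: "0 < c" "\<And>x. x \<in> carr H \<Longrightarrow> hnorm H (R x) \<le> c * hnorm H x"
      using op_bound[OF R(1)] by auto
    \<comment> \<open>At the critical shift \<open>m\<close> the form of \<open>B\<close> is
      nonnegative but possibly degenerate, which is enough for Cauchy-Schwarz.\<close>
    define G where "G = H\<lparr>hinner := \<lambda>x y. hinner H x (B y)\<rparr>"
    have G [simp]: "carr G = carr H" "hzero G = hzero H" "hadd G = hadd H" "hscale G = hscale H"
      "hinner G = (\<lambda>x y. hinner H x (B y))"
      by (simp_all add: G_def)
    have Bin [simp]: "B x \<in> carr H" if "x \<in> carr H" for x using op_in[OF B that] .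
    interpret G: semi_inner_space G
    proof
      fix x y assume "x \<in> carr G" "y \<in> carr G"
      then show "hinner G x y = cnj (hinner G y x)"
        using hinner_commute[of x "B y"] Bsym[of y x] by (simp del: Bx)
      from \<open>x \<in> carr G\<close> \<open>y \<in> carr G\<close> show "hadd G x y = hadd G y x"
        by (simp add: hadd_commute)
    next
      fix x assume x: "x \<in> carr G"
      have "Im (hinner H x (B x)) = 0"
        using x hinner_commute[of x "B x"] Bsym[of x x] by (simp add: complex_eq_iff del: Bx)
      then show "hinner G x x \<in> \<real>\<^sub>\<ge>\<^sub>0"
        using m_form[of x] Bform[of x] x by (simp add: complex_nonneg_Reals_iff del: Bx)
    qed (simp_all add: hadd_assoc hadd_zero hadd_inverse hscale_one hscale_scale
        hscale_add_left hscale_add_right op_hadd[OF B] op_hscale[OF B] del: Bx)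
    \<comment> \<open>Invertibility makes the form of \<open>B\<close> coercive: \<open>R\<close>
      bounds \<open>hnorm H x\<close> by \<open>hnorm H (B x)\<close>, and \<open>bb\<close> bounds
      the square of the latter by a multiple of the form at \<open>x\<close>.\<close>
    have key: "(hnorm H x)\<^sup>2 \<le> c\<^sup>2 * D * Re (hinner H x (B x))" if x: "x \<in> carr H" for x
    proof -
      define b where "b = B x"
      have b: "b \<in> carr H" using x by (simp add: b_def del: Bx)
      have bb: "(hnorm H b)\<^sup>2 \<le> D * Re (hinner H x b)"
      proof (cases "hnorm H b = 0")
        case True
        then show ?thesis
          using m_form[OF x] Bform[OF x] D unfolding b_def[symmetric] by simp
      next
        case False
        \<comment> \<open>With \<open>b = B x\<close>, Cauchy-Schwarz in \<open>G\<close> bounds the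
          fourth power of the norm of \<open>b\<close> by the product of the forms of
          \<open>B\<close> at \<open>x\<close> and at \<open>b\<close>; the second form is at most
          \<open>D\<close> times the squared norm of \<open>b\<close>, which then cancels.\<close>
        have "hinner G x b = hinner H b b"
          using x b Bsym[of x b] by (simp add: b_def del: Bx)
        then have "cmod (hinner G x b) = (hnorm H b)\<^sup>2"
          using b by (simp add: hinner_self del: G norm_of_real) (simp add: norm_power)
        then have "((hnorm H b)\<^sup>2)\<^sup>2 \<le> (hnorm G x * hnorm G b)\<^sup>2"
          using G.Cauchy_Schwarz[of x b] x b by (intro power_mono) (simp_all del: G(5))
        also have "\<dots> = Re (hinner H x b) * Re (hinner H b (B b))"
          using G.hnorm_sq[of x] G.hnorm_sq[of b] x b
          by (simp add: power_mult_distrib b_def[symmetric] del: Bx)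
        also have "\<dots> \<le> Re (hinner H x b) * (hnorm H b * (D * hnorm H b))"
        proof (rule mult_left_mono)
          have "Re (hinner H b (B b)) \<le> hnorm H b * hnorm H (B b)"
            using order_trans[OF complex_Re_le_cmod Cauchy_Schwarz[of b "B b"]] b by (simp del: Bx)
          also have "\<dots> \<le> hnorm H b * (D * hnorm H b)"
            using D b by (intro mult_left_mono) (auto simp: hnorm_nonneg simp del: Bx)
          finally show "Re (hinner H b (B b)) \<le> hnorm H b * (D * hnorm H b)" .
          show "0 \<le> Re (hinner H x b)" using m_form[OF x] Bform[OF x] by (simp add: b_def del: Bx)
        qed
        finally have "(hnorm H b)\<^sup>2 * (hnorm H b)\<^sup>2 \<le> (D * Re (hinner H x b)) * (hnorm H b)\<^sup>2"
          by (simp add: power2_eq_square mult_ac)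
        then show ?thesis by (rule mult_right_le_imp_le) (use False in simp)
      qed
      have "hnorm H x \<le> c * hnorm H b" using c(2)[OF b] R(2)[OF x] by (simp add: b_def del: Bx)
      then have "(hnorm H x)\<^sup>2 \<le> (c * hnorm H b)\<^sup>2"
        using x by (intro power_mono) (simp_all add: hnorm_nonneg)
      also have "\<dots> = c\<^sup>2 * (hnorm H b)\<^sup>2" by (simp add: power_mult_distrib)
      also have "\<dots> \<le> c\<^sup>2 * (D * Re (hinner H x b))" using bb by (intro mult_left_mono) auto
      finally show ?thesis by (simp add: b_def mult.assoc del: Bx)
    qed
    \<comment> \<open>\<open>m\<close> in the minimum keeps \<open>m - d\<close> nonnegative, and
      the other entry is the coercivity constant from \<open>key\<close>. The admissible shift
      \<open>m - d\<close> contradicts the infimum.\<close>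
    define d where "d = min m (1 / (c\<^sup>2 * D))"
    have cD: "0 < c\<^sup>2 * D" using c D by simp
    have d: "0 < d" "d \<le> m" "d \<le> 1 / (c\<^sup>2 * D)" unfolding d_def using m cD by auto
    have "m - d \<in> S"
      unfolding S_def
    proof (intro CollectI conjI ballI)
      fix x assume x: "x \<in> carr H"
      have "d * (hnorm H x)\<^sup>2 \<le> 1 / (c\<^sup>2 * D) * (hnorm H x)\<^sup>2"
        using d by (intro mult_right_mono) auto
      also have "\<dots> \<le> Re (hinner H x (B x))"
        using key[OF x] cD by (simp add: field_simps del: Bx)
      finally show "0 \<le> Re (hinner H x (A x)) + (m - d) * (hnorm H x)\<^sup>2"
        using Bform[OF x] by (simp add: algebra_simps del: Bx)
    qed (use d in auto)
    then have "m \<le> m - d" unfolding m_def using bdd by (intro cInf_lower)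
    then show False using d by simp
  qed
  then show ?thesis using m_form[OF x] by simp
qed

end

section \<open>Unital *-homomorphisms out of a von Neumann algebra\<close>

text \<open>Instantiated twice: with the identity map for \<open>ops r\<close>, and with the left
  action on \<open>E\<close> read on the image of \<open>r\<close> in the standard form. The
  bicommutant condition yields unit, sums, products and, in \<open>sigma_pos\<close>,
  inverses.\<close>

locale star_rep = L: hilbert_space L + E: hilbert_space E
  for L :: "('l, 'm) hilb_scheme" and E :: "('e, 'n) hilb_scheme" +
  fixes M :: "('l \<Rightarrow> 'l) set" and sigma :: "('l \<Rightarrow> 'l) \<Rightarrow> 'e \<Rightarrow> 'e"
  assumes M_bounded: "a \<in> M \<Longrightarrow> a \<in> bounded_ops L L"
    and M_bicommutant: "commutant L (commutant L M) = M"
    and M_adj: "a \<in> M \<Longrightarrow> adj L L a \<in> M"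
    and sigma_in: "a \<in> M \<Longrightarrow> sigma a \<in> bounded_ops E E"
    and sigma_add: "\<lbrakk>a \<in> M; b \<in> M\<rbrakk> \<Longrightarrow> sigma (op_add L L a b) = op_add E E (sigma a) (sigma b)"
    and sigma_scale: "a \<in> M \<Longrightarrow> sigma (op_scale L L c a) = op_scale E E c (sigma a)"
    and sigma_mult: "\<lbrakk>a \<in> M; b \<in> M\<rbrakk> \<Longrightarrow>
        sigma (compose (carr L) a b) = compose (carr E) (sigma a) (sigma b)"
    and sigma_id: "sigma (op_id L) = op_id E"
    and sigma_adj: "a \<in> M \<Longrightarrow> sigma (adj L L a) = adj E E (sigma a)"
begin

lemma hilbert [simp]: "hilbert_space L" "hilbert_space E"
  by (rule L.hilbert_space_axioms E.hilbert_space_axioms)+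

text \<open>A pointwise form of the bicommutant condition, from which each closure property of
  \<open>M\<close> is a direct computation.\<close>

lemma M_iff: "a \<in> M \<longleftrightarrow> a \<in> bounded_ops L L \<and>
    (\<forall>S\<in>commutant L M. \<forall>x\<in>carr L. a (S x) = S (a x))"
proof
  assume "a \<in> M"
  then have a: "a \<in> bounded_ops L L" "\<And>S. S \<in> commutant L M \<Longrightarrow> compose (carr L) a S = compose (carr L) S a"
    using M_bicommutant by (auto simp: commutant_def)
  have "a (S x) = S (a x)" if "S \<in> commutant L M" "x \<in> carr L" for S x
    using fun_cong[OF a(2)[OF that(1)], of x] that(2) by (simp add: compose_eq)
  then show "a \<in> bounded_ops L L \<and> (\<forall>S\<in>commutant L M. \<forall>x\<in>carr L. a (S x) = S (a x))"
    using a by blast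
next
  assume a: "a \<in> bounded_ops L L \<and> (\<forall>S\<in>commutant L M. \<forall>x\<in>carr L. a (S x) = S (a x))"
  then have "a \<in> commutant L (commutant L M)"
    unfolding commutant_def[of L "commutant L M"] by (auto simp: compose_def restrict_def)
  then show "a \<in> M" by (simp add: M_bicommutant)
qed

lemma commutant_bounded: "S \<in> commutant L M \<Longrightarrow> S \<in> bounded_ops L L"
  by (simp add: commutant_def)

lemma M_comm: "\<lbrakk>a \<in> M; S \<in> commutant L M; x \<in> carr L\<rbrakk> \<Longrightarrow> a (S x) = S (a x)"
  by (simp add: M_iff)

lemma M_apply [simp]: "\<lbrakk>a \<in> M; x \<in> carr L\<rbrakk> \<Longrightarrow> a x \<in> carr L"
  by (meson M_bounded op_in)

lemma sigma_apply [simp]: "\<lbrakk>a \<in> M; x \<in> carr E\<rbrakk> \<Longrightarrow> sigma a x \<in> carr E"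
  by (meson sigma_in op_in)

lemma M_id: "op_id L \<in> M"
  unfolding M_iff using commutant_bounded op_in by fastforce

lemma M_add: "\<lbrakk>a \<in> M; b \<in> M\<rbrakk> \<Longrightarrow> op_add L L a b \<in> M"
  unfolding M_iff[of "op_add L L a b"]
proof (intro conjI ballI)
  fix S x assume ab: "a \<in> M" "b \<in> M" and S: "S \<in> commutant L M" and x: "x \<in> carr L"
  note Sb = commutant_bounded[OF S]
  show "op_add L L a b (S x) = S (op_add L L a b x)"
    using ab S x by (simp add: op_in[OF Sb] op_hadd[OF Sb] M_comm)
qed (simp add: M_bounded)

lemma M_scale: "a \<in> M \<Longrightarrow> op_scale L L c a \<in> M"
  unfolding M_iff[of "op_scale L L c a"]
proof (intro conjI ballI)
  fix S x assume a: "a \<in> M" and S: "S \<in> commutant L M" and x: "x \<in> carr L"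
  note Sb = commutant_bounded[OF S]
  show "op_scale L L c a (S x) = S (op_scale L L c a x)"
    using a S x by (simp add: op_in[OF Sb] op_hscale[OF Sb] M_comm)
qed (simp add: M_bounded)

lemma M_mult: "\<lbrakk>a \<in> M; b \<in> M\<rbrakk> \<Longrightarrow> compose (carr L) a b \<in> M"
  unfolding M_iff[of "compose (carr L) a b"]
proof (intro conjI ballI)
  fix S x assume ab: "a \<in> M" "b \<in> M" and S: "S \<in> commutant L M" and x: "x \<in> carr L"
  note Sb = commutant_bounded[OF S]
  show "compose (carr L) a b (S x) = S (compose (carr L) a b x)"
    using ab S x by (simp add: op_in[OF Sb] compose_eq M_comm)
qed (rule compose_in[OF M_bounded M_bounded], simp_all)

lemma sigma_adj_right:
  "\<lbrakk>a \<in> M; x \<in> carr E; y \<in> carr E\<rbrakk> \<Longrightarrow> hinner E x (sigma a y) = hinner E (sigma (adj L L a) x) y"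
  by (simp add: sigma_adj adj_left sigma_in)

text \<open>For \<open>e\<close> positive, \<open>h\<close> shifted by \<open>e\<close> is coercive
  and has a bounded inverse, which commutes with the commutant of \<open>M\<close> and so lies in
  \<open>M\<close>. Its image under \<open>sigma\<close> is a left inverse of \<open>sigma h\<close>
  shifted by \<open>e\<close>, as \<open>nonneg_of_resolvent\<close> requires.\<close>

lemma sigma_pos:
  assumes h: "h \<in> M"
    and sym: "\<And>x y. \<lbrakk>x \<in> carr L; y \<in> carr L\<rbrakk> \<Longrightarrow> hinner L x (h y) = hinner L (h x) y"
    and pos: "\<And>x. x \<in> carr L \<Longrightarrow> 0 \<le> Re (hinner L x (h x))"
    and y: "y \<in> carr E"
  shows "0 \<le> Re (hinner E y (sigma h y))"
proof (rule E.nonneg_of_resolvent[OF sigma_in[OF h] _ _ y])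
  have "adj L L h = h"
    by (rule adjI) (simp_all add: M_bounded h sym)
  then show "hinner E x (sigma h y) = hinner E (sigma h x) y" if "x \<in> carr E" "y \<in> carr E" for x y
    using sigma_adj_right[OF h that] by simp
next
  fix e :: real assume e: "0 < e"
  define B where "B = op_add L L h (op_scale L L (complex_of_real e) (op_id L))"
  have BM: "B \<in> M" unfolding B_def by (intro M_add M_scale M_id h)
  have Bx: "B x = hadd L (h x) (hscale L (complex_of_real e) x)" if "x \<in> carr L" for x
    using that by (simp add: B_def)
  obtain R where R: "R \<in> bounded_ops L L" "\<And>x. x \<in> carr L \<Longrightarrow> R (B x) = x"
    "\<And>x. x \<in> carr L \<Longrightarrow> B (R x) = x"
  proof (rule L.coercive_inverse[OF M_bounded[OF BM] _ e])
    show "hinner L x (B y) = hinner L (B x) y" if "x \<in> carr L" "y \<in> carr L" for x y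
      using that by (simp add: Bx sym h)
    show "e * (hnorm L x)\<^sup>2 \<le> Re (hinner L x (B x))" if "x \<in> carr L" for x
      using that pos[OF that] by (simp add: Bx h L.hnorm_sq)
  qed blast
  have RM: "R \<in> M"
    unfolding M_iff[of R]
  proof (intro conjI ballI R)
    fix S x assume S: "S \<in> commutant L M" and x: "x \<in> carr L"
    have Rx: "R x \<in> carr L" by (rule op_in[OF R(1) x])
    \<comment> \<open>An inverse inherits commutation relations: write \<open>x\<close> as
      \<open>B (R x)\<close>, move \<open>B\<close> past \<open>S\<close>, and cancel it against
      \<open>R\<close>.\<close>
    have "R (S x) = R (S (B (R x)))" using R(3)[OF x] by simp
    also have "\<dots> = R (B (S (R x)))" using M_comm[OF BM S Rx] by simp
    also have "\<dots> = S (R x)" by (rule R(2)) (rule op_in[OF commutant_bounded[OF S] Rx])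
    finally show "R (S x) = S (R x)" .
  qed
  have RB: "compose (carr L) R B = op_id L"
    by (rule op_eqI[of _ L L]) (simp_all add: M_bounded[OF M_mult[OF RM BM]] compose_eq R)
  have "sigma R (hadd E (sigma h x) (hscale E (complex_of_real e) x)) = x" if x: "x \<in> carr E" for x
  proof -
    have "sigma B x = hadd E (sigma h x) (hscale E (complex_of_real e) x)"
      unfolding B_def using x by (simp add: sigma_add h M_scale M_id sigma_scale sigma_id)
    then have "sigma R (hadd E (sigma h x) (hscale E (complex_of_real e) x)) = compose (carr E) (sigma R) (sigma B) x"
      using x by (simp add: compose_eq)
    also have "\<dots> = sigma (compose (carr L) R B) x" by (simp add: sigma_mult RM BM)
    also have "\<dots> = x" using x by (simp add: RB sigma_id)
    finally show ?thesis .
  qed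
  then show "\<exists>R\<in>bounded_ops E E. \<forall>x\<in>carr E. R (hadd E (sigma h x) (hscale E (complex_of_real e) x)) = x"
    using sigma_in[OF RM] by blast
qed

text \<open>Positivity of \<open>C\<^sup>2\<close> minus b^* b is transported by
  \<open>sigma_pos\<close>. That the constant is preserved lets \<open>fusion_form_growth\<close>
  control a whole sequence of operators at a known rate.\<close>

lemma sigma_contractive:
  assumes b: "b \<in> M" and bound: "\<And>x. x \<in> carr L \<Longrightarrow> hnorm L (b x) \<le> C * hnorm L x"
    and C: "0 \<le> C" and y: "y \<in> carr E"
  shows "hnorm E (sigma b y) \<le> C * hnorm E y"
proof -
  define bb where "bb = compose (carr L) (adj L L b) b"
  have bb: "bb \<in> M" unfolding bb_def by (intro M_mult M_adj b)
  have bbx: "bb x = adj L L b (b x)" if "x \<in> carr L" for x using that by (simp add: bb_def compose_eq)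
  define h where "h = op_add L L (op_scale L L (complex_of_real (C\<^sup>2)) (op_id L)) (op_scale L L (-1) bb)"
  have h: "h \<in> M" unfolding h_def by (intro M_add M_scale M_id bb)
  have hx: "h x = hadd L (hscale L (complex_of_real (C\<^sup>2)) x) (hscale L (-1) (bb x))" if "x \<in> carr L" for x
    using that by (simp add: h_def)
  note [simp] = M_bounded[OF b]
  have "0 \<le> Re (hinner E y (sigma h y))"
  proof (rule sigma_pos[OF h _ _ y])
    show "hinner L x (h y) = hinner L (h x) y" if "x \<in> carr L" "y \<in> carr L" for x y
      using that b by (simp add: hx bbx bb adj_right adj_left)
    show "0 \<le> Re (hinner L x (h x))" if x: "x \<in> carr L" for x
    proof -
      have "(hnorm L (b x))\<^sup>2 \<le> (C * hnorm L x)\<^sup>2"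
        using bound[OF x] x b by (intro power_mono) (simp_all add: L.hnorm_nonneg)
      moreover have "Re (hinner L x (h x)) = (C * hnorm L x)\<^sup>2 - (hnorm L (b x))\<^sup>2"
        using x b by (simp add: hx bbx bb adj_right L.hinner_self power_mult_distrib del: of_real_power)
      ultimately show ?thesis by simp
    qed
  qed
  also have "sigma h y = hadd E (hscale E (complex_of_real (C\<^sup>2)) y) (hscale E (-1) (sigma bb y))"
    unfolding h_def using y by (simp add: sigma_add sigma_scale M_scale M_id bb sigma_id del: of_real_power)
  also have "sigma bb y = adj E E (sigma b) (sigma b y)"
    unfolding bb_def using y by (simp add: sigma_mult b M_adj compose_eq sigma_adj)
  also have "Re (hinner E y (hadd E (hscale E (complex_of_real (C\<^sup>2)) y) (hscale E (-1) (adj E E (sigma b) (sigma b y))))) =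
      (C * hnorm E y)\<^sup>2 - (hnorm E (sigma b y))\<^sup>2"
    using y b by (simp add: adj_right sigma_in E.hinner_self power_mult_distrib del: of_real_power)
  finally have "(hnorm E (sigma b y))\<^sup>2 \<le> (C * hnorm E y)\<^sup>2" by simp
  then show ?thesis using C y by (meson E.hnorm_nonneg mult_nonneg_nonneg power2_le_imp_le)
qed

end

section \<open>Positivity of the fusion form\<close>

text \<open>\<open>F\<close> stands for Hom(L, X), a right module over \<open>M\<close> with the
  \<open>M\<close>-valued inner product \<open>compose (carr L) (adj L X f) g\<close>.\<close>

locale module_rep = star_rep L E M sigma + X: hilbert_space X
  for L :: "('l, 'm) hilb_scheme" and E :: "('e, 'n) hilb_scheme"
    and M :: "('l \<Rightarrow> 'l) set" and sigma :: "('l \<Rightarrow> 'l) \<Rightarrow> 'e \<Rightarrow> 'e"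
    and X :: "('x, 'k) hilb_scheme" +
  fixes F :: "('l \<Rightarrow> 'x) set"
  assumes F_bounded: "f \<in> F \<Longrightarrow> f \<in> bounded_ops L X"
    and F_inner: "\<lbrakk>f \<in> F; g \<in> F\<rbrakk> \<Longrightarrow> compose (carr L) (adj L X f) g \<in> M"
    and F_add: "\<lbrakk>f \<in> F; g \<in> F\<rbrakk> \<Longrightarrow> op_add L X f g \<in> F"
    and F_scale: "f \<in> F \<Longrightarrow> op_scale L X c f \<in> F"
    and F_mult: "\<lbrakk>f \<in> F; b \<in> M\<rbrakk> \<Longrightarrow> compose (carr L) f b \<in> F"
begin

lemma hilbert_X [simp]: "hilbert_space X"
  by (rule X.hilbert_space_axioms)

text \<open>The \<open>M\<close>-valued inner product of \<open>f\<close> and \<open>g\<close>,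
  acting on \<open>E\<close>; the fusion form of (f, y) and (g, z) is the inner product of
  \<open>y\<close> with \<open>ip f g z\<close>.\<close>

definition ip :: "('l \<Rightarrow> 'x) \<Rightarrow> ('l \<Rightarrow> 'x) \<Rightarrow> 'e \<Rightarrow> 'e" where
  "ip f g = sigma (compose (carr L) (adj L X f) g)"

lemma F_apply [simp]: "\<lbrakk>f \<in> F; x \<in> carr L\<rbrakk> \<Longrightarrow> f x \<in> carr X"
  by (meson F_bounded op_in)

lemma ip_in: "\<lbrakk>f \<in> F; g \<in> F\<rbrakk> \<Longrightarrow> ip f g \<in> bounded_ops E E"
  by (simp add: ip_def sigma_in F_inner)

lemma ip_apply [simp]: "\<lbrakk>f \<in> F; g \<in> F; y \<in> carr E\<rbrakk> \<Longrightarrow> ip f g y \<in> carr E"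
  by (simp add: ip_def F_inner)

lemma ip_add_right:
  assumes "f \<in> F" "g \<in> F" "h \<in> F" "y \<in> carr E"
  shows "ip f (op_add L X g h) y = hadd E (ip f g y) (ip f h y)"
proof -
  note fa = adj_in[OF hilbert(1) hilbert_X F_bounded[OF assms(1)]]
  have "compose (carr L) (adj L X f) (op_add L X g h) =
      op_add L L (compose (carr L) (adj L X f) g) (compose (carr L) (adj L X f) h)"
    using assms by (auto simp: fun_eq_iff compose_def op_add_def op_hadd[OF fa])
  then show ?thesis using assms by (simp add: ip_def sigma_add F_inner)
qed

lemma ip_scale_right:
  assumes "f \<in> F" "g \<in> F" "y \<in> carr E"
  shows "ip f (op_scale L X c g) y = hscale E c (ip f g y)"
proof -
  note fa = adj_in[OF hilbert(1) hilbert_X F_bounded[OF assms(1)]]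
  have "compose (carr L) (adj L X f) (op_scale L X c g) =
      op_scale L L c (compose (carr L) (adj L X f) g)"
    using assms by (auto simp: fun_eq_iff compose_def op_scale_def op_hscale[OF fa])
  then show ?thesis using assms by (simp add: ip_def sigma_scale F_inner)
qed

lemma ip_mult_right:
  assumes "f \<in> F" "g \<in> F" "b \<in> M" "y \<in> carr E"
  shows "ip f (compose (carr L) g b) y = ip f g (sigma b y)"
proof -
  have "compose (carr L) (adj L X f) (compose (carr L) g b) =
      compose (carr L) (compose (carr L) (adj L X f) g) b"
    using assms by (auto simp: fun_eq_iff compose_def)
  then show ?thesis using assms by (simp add: ip_def sigma_mult F_inner compose_eq)
qed

lemma ip_adj:
  assumes f: "f \<in> F" and g: "g \<in> F" and "x \<in> carr E" "y \<in> carr E"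
  shows "hinner E x (ip f g y) = hinner E (ip g f x) y"
proof -
  have "adj L L (compose (carr L) (adj L X f) g) = compose (carr L) (adj L X g) f"
    by (simp add: adj_compose[OF _ hilbert_X] adj_adj F_bounded f g)
  then show ?thesis using assms by (simp add: ip_def sigma_adj_right F_inner)
qed

lemma ip_mult_left:
  assumes "f \<in> F" "g \<in> F" "b \<in> M" "x \<in> carr E" "y \<in> carr E"
  shows "hinner E x (ip (compose (carr L) g b) f y) = hinner E (sigma b x) (ip g f y)"
  using assms by (simp add: ip_adj F_mult ip_mult_right)

lemma ip_pos:
  assumes g: "g \<in> F" and y: "y \<in> carr E"
  shows "0 \<le> Re (hinner E y (ip g g y))"
  unfolding ip_def
proof (rule sigma_pos[OF F_inner[OF g g] _ _ y])
  note [simp] = F_bounded[OF g]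
  show "hinner L x (compose (carr L) (adj L X g) g y) = hinner L (compose (carr L) (adj L X g) g x) y"
    if "x \<in> carr L" "y \<in> carr L" for x y
    using that g by (simp add: compose_eq adj_right adj_left)
  show "0 \<le> Re (hinner L x (compose (carr L) (adj L X g) g x))" if "x \<in> carr L" for x
    using that g by (simp add: compose_eq adj_right X.Re_hinner_nonneg)
qed

text \<open>\<open>g\<close> is the sum of the \<open>h i\<close>. The induction starts from a
  singleton to avoid an empty sum in \<open>F\<close>, and testing inside inner products turns
  operator sums into finite sums of complex numbers.\<close>

lemma ip_sum_right:
  assumes "finite I" "I \<noteq> {}" "\<And>i. i \<in> I \<Longrightarrow> h i \<in> F"
  shows "\<exists>g\<in>F. \<forall>k\<in>F. \<forall>x\<in>carr E. \<forall>y\<in>carr E. hinner E x (ip k g y) = (\<Sum>i\<in>I. hinner E x (ip k (h i) y))"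
  using assms
proof (induction I rule: finite_ne_induct)
  case (singleton i)
  then show ?case by auto
next
  case (insert i I)
  then obtain g where g: "g \<in> F"
    "\<forall>k\<in>F. \<forall>x\<in>carr E. \<forall>y\<in>carr E. hinner E x (ip k g y) = (\<Sum>i\<in>I. hinner E x (ip k (h i) y))"
    by auto
  show ?case
    using insert g by (intro bexI[of _ "op_add L X (h i) g"]) (auto simp: ip_add_right F_add)
qed

text \<open>When all vectors have the form \<open>sigma (b i) z\<close>, each \<open>b i\<close> can
  be moved into \<open>f i\<close>. With \<open>g\<close> the sum of the products of
  \<open>f i\<close> and \<open>b i\<close>, the double sum has the same real part as
  \<open>hinner E z (ip g g z)\<close>.\<close>

lemma gram_cyclic:
  assumes I: "finite I" and f: "\<And>i. i \<in> I \<Longrightarrow> f i \<in> F" and b: "\<And>i. i \<in> I \<Longrightarrow> b i \<in> M"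
    and z: "z \<in> carr E"
  shows "0 \<le> Re (\<Sum>i\<in>I. \<Sum>j\<in>I. hinner E (sigma (b i) z) (ip (f i) (f j) (sigma (b j) z)))"
proof (cases "I = {}")
  case False
  define h where "h i = compose (carr L) (f i) (b i)" for i
  have h: "h i \<in> F" if "i \<in> I" for i using that f b by (simp add: h_def F_mult)
  obtain g where g: "g \<in> F"
    "\<forall>k\<in>F. \<forall>x\<in>carr E. \<forall>y\<in>carr E. hinner E x (ip k g y) = (\<Sum>i\<in>I. hinner E x (ip k (h i) y))"
    using ip_sum_right[of I h, OF I False h] by blast
  have "hinner E z (ip g g z) = (\<Sum>i\<in>I. hinner E z (ip g (h i) z))" using g z by blast
  \<comment> \<open>\<open>ip_sum_right\<close> expands the second argument of \<open>ip\<close>;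
    conjugation brings the first argument into that position.\<close>
  also have "\<dots> = (\<Sum>i\<in>I. cnj (hinner E z (ip (h i) g z)))"
  proof (rule sum.cong[OF refl])
    fix i assume "i \<in> I"
    then show "hinner E z (ip g (h i) z) = cnj (hinner E z (ip (h i) g z))"
      using g z h by (simp add: ip_adj[of g "h i"] E.hinner_commute[of "ip (h i) g z" z])
  qed
  also have "\<dots> = cnj (\<Sum>i\<in>I. \<Sum>j\<in>I. hinner E z (ip (h i) (h j) z))"
    using g z h by simp
  also have "(\<Sum>i\<in>I. \<Sum>j\<in>I. hinner E z (ip (h i) (h j) z)) =
      (\<Sum>i\<in>I. \<Sum>j\<in>I. hinner E (sigma (b i) z) (ip (f i) (f j) (sigma (b j) z)))"
    using f b z by (intro sum.cong refl) (simp add: h_def ip_mult_left ip_mult_right F_mult)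
  finally have "Re (hinner E z (ip g g z)) =
      Re (\<Sum>i\<in>I. \<Sum>j\<in>I. hinner E (sigma (b i) z) (ip (f i) (f j) (sigma (b j) z)))"
    by simp
  then show ?thesis using ip_pos[OF g(1) z] by simp
qed simp

text \<open>
  The induction splits off the closed cyclic subspace of one of the vectors; on a cyclic
  subspace the Gram matrix collapses to a single positive element.
\<close>

lemma gram_nonneg:
  assumes "finite I" "\<And>i. i \<in> I \<Longrightarrow> f i \<in> F" "\<And>i. i \<in> I \<Longrightarrow> y i \<in> carr E"
  shows "0 \<le> Re (\<Sum>i\<in>I. \<Sum>j\<in>I. hinner E (y i) (ip (f i) (f j) (y j)))"
  using assms
proof (induction I arbitrary: y rule: finite_induct)
  case empty
  then show ?case by simp
next
  case (insert k I)
  define J where "J = insert k I"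
  have J: "finite J" "k \<in> J" "I \<subseteq> J" using insert by (auto simp: J_def)
  have f: "f i \<in> F" and y: "y i \<in> carr E" if "i \<in> J" for i using insert that by (auto simp: J_def)
  \<comment> \<open>The orbit of \<open>y k\<close>, which is already a linear subspace because
    \<open>M\<close> is closed under sums and multiples.\<close>
  define Z where "Z = {sigma b (y k) | b. b \<in> M}"
  have ZE: "Z \<subseteq> carr E" using y J by (auto simp: Z_def)
  have Zy: "y k \<in> Z" unfolding Z_def using M_id y[OF J(2)] by (force simp: sigma_id)
  have Zinv: "sigma m z \<in> Z" if "z \<in> Z" "m \<in> M" for z m
  proof -
    from that(1) obtain b where b: "b \<in> M" "z = sigma b (y k)" by (auto simp: Z_def)
    then have "sigma m z = sigma (compose (carr L) m b) (y k)"
      using that y[OF J(2)] by (simp add: sigma_mult compose_eq)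
    then show ?thesis using b that M_mult by (auto simp: Z_def)
  qed
  define N where "N = E.closure_of_set Z"
  interpret P: subspace_projection E N
  proof
    show "closed_subspace E N"
      unfolding N_def
    proof (rule E.closure_closed_subspace[OF ZE])
      have "hzero E = hscale E 0 (y k)"
        by (rule E.vec_eqI) (use y[OF J(2)] in \<open>simp_all\<close>)
      then have "hzero E = sigma (op_scale L L 0 (op_id L)) (y k)"
        using y[OF J(2)] by (simp add: sigma_scale M_id sigma_id)
      then show "hzero E \<in> Z" using M_scale[OF M_id] by (auto simp: Z_def)
    next
      fix x z assume "x \<in> Z" "z \<in> Z"
      then obtain a b where "a \<in> M" "x = sigma a (y k)" "b \<in> M" "z = sigma b (y k)"
        by (auto simp: Z_def)
      then have "hadd E x z = sigma (op_add L L a b) (y k)" "op_add L L a b \<in> M"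
        using y[OF J(2)] by (simp_all add: sigma_add M_add)
      then show "hadd E x z \<in> Z" by (auto simp: Z_def)
    next
      fix c x assume "x \<in> Z"
      then obtain a where "a \<in> M" "x = sigma a (y k)" by (auto simp: Z_def)
      then have "hscale E c x = sigma (op_scale L L c a) (y k)" "op_scale L L c a \<in> M"
        using y[OF J(2)] by (simp_all add: sigma_scale M_scale)
      then show "hscale E c x \<in> Z" by (auto simp: Z_def)
    qed
  qed
  define p where "p = proj E N"
  have p_in [simp]: "p x \<in> carr E" if "x \<in> carr E" for x using that by (simp add: p_def)
  \<comment> \<open>\<open>M\<close> contains adjoints, so the closed orbit is invariant under
    \<open>sigma m\<close> and under its adjoint.\<close>
  have p_comm: "p (sigma m x) = sigma m (p x)" if "m \<in> M" "x \<in> carr E" for m x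
    unfolding p_def
  proof (rule P.proj_commute[OF sigma_in[OF that(1)] _ _ that(2)])
    show "sigma m x \<in> N" if "x \<in> N" for x
      using that Zinv[OF _ \<open>m \<in> M\<close>] unfolding N_def
      by (intro E.closure_invariant[OF sigma_in[OF \<open>m \<in> M\<close>]])
    have ma: "adj L L m \<in> M" using that by (simp add: M_adj)
    show "adj E E (sigma m) x \<in> N" if "x \<in> N" for x
      using that Zinv[OF _ ma] unfolding N_def sigma_adj[OF \<open>m \<in> M\<close>, symmetric]
      by (intro E.closure_invariant[OF sigma_in[OF ma]])
  qed
  \<comment> \<open>The components orthogonal to the cyclic subspace. The one with index
    \<open>k\<close> vanishes, so the induction hypothesis for \<open>I\<close> handles
    them.\<close>
  define w where "w i = hdiff E (y i) (p (y i))" for i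
  have w: "w i \<in> carr E" if "i \<in> J" for i using y[OF that] by (simp add: w_def)
  have wk: "w k = hzero E"
  proof -
    have "y k \<in> N" unfolding N_def using E.closure_superset[OF ZE Zy] .
    then have "p (y k) = y k" by (simp add: p_def P.proj_fix)
    then show ?thesis using y[OF J(2)] by (simp add: w_def hdiff_def E.hadd_inverse)
  qed
  \<comment> \<open>There are no cross terms, because \<open>p\<close> commutes with every
    \<open>ip (f i) (f j)\<close>.\<close>
  have split: "hinner E (y i) (ip (f i) (f j) (y j)) =
      hinner E (p (y i)) (ip (f i) (f j) (p (y j))) + hinner E (w i) (ip (f i) (f j) (w j))"
    if i: "i \<in> J" and j: "j \<in> J" for i j
  proof -
    define A where "A = ip (f i) (f j)"
    have A: "A \<in> bounded_ops E E" unfolding A_def using f i j by (simp add: ip_in)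
    note [simp] = op_in[OF A] op_hdiff[OF A]
    have pA: "p (A x) = A (p x)" if "x \<in> carr E" for x
      unfolding A_def ip_def using f i j that by (intro p_comm F_inner)
    have p_self: "hinner E (p u) v = hinner E u (p v)" if "u \<in> carr E" "v \<in> carr E" for u v
      using that by (simp add: p_def P.proj_selfadjoint)
    have pp: "p (p x) = p x" if "x \<in> carr E" for x
      using that unfolding p_def by (intro P.proj_fix P.proj_in_subspace)
    show ?thesis
      unfolding A_def[symmetric] w_def using y[OF i] y[OF j]
      by (simp add: p_self pA pp)
  qed
  have "(\<Sum>i\<in>J. \<Sum>j\<in>J. hinner E (w i) (ip (f i) (f j) (w j))) =
      (\<Sum>i\<in>I. \<Sum>j\<in>I. hinner E (w i) (ip (f i) (f j) (w j)))"
  proof -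
    have 0: "hinner E (w i) (ip (f i) (f j) (w j)) = 0" if "i \<in> J" "j \<in> J" "i = k \<or> j = k" for i j
      using that f w wk by (auto simp: op_hzero[OF ip_in])
    have "(\<Sum>i\<in>J. \<Sum>j\<in>J. hinner E (w i) (ip (f i) (f j) (w j))) =
        (\<Sum>i\<in>I. \<Sum>j\<in>J. hinner E (w i) (ip (f i) (f j) (w j)))"
      using J 0 insert.hyps by (intro sum.mono_neutral_right) (auto simp: J_def intro!: sum.neutral)
    also have "\<dots> = (\<Sum>i\<in>I. \<Sum>j\<in>I. hinner E (w i) (ip (f i) (f j) (w j)))"
      using J 0 insert.hyps
      by (intro sum.cong[OF refl] sum.mono_neutral_right) (auto simp: J_def)
    finally show ?thesis .
  qed
  moreover have "0 \<le> Re (\<Sum>i\<in>I. \<Sum>j\<in>I. hinner E (w i) (ip (f i) (f j) (w j)))"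
    using J f w by (intro insert.IH) auto
  moreover have "0 \<le> Re (\<Sum>i\<in>J. \<Sum>j\<in>J. hinner E (p (y i)) (ip (f i) (f j) (p (y j))))"
  proof -
    \<comment> \<open>The projected vectors are limits of orbit vectors, to which
      \<open>gram_cyclic\<close> applies with cyclic vector \<open>y k\<close>; nonnegativity passes
      to the limit.\<close>
    have "\<exists>u. (\<forall>n. u n \<in> Z) \<and> E.conv u (p (y i))" if "i \<in> J" for i
      using P.proj_in_subspace[OF y[OF that]] unfolding p_def N_def by (metis E.closure_of_setE)
    then obtain u where u: "\<And>i n. i \<in> J \<Longrightarrow> u i n \<in> Z" "\<And>i. i \<in> J \<Longrightarrow> E.conv (u i) (p (y i))"
      by metis
    then have "\<exists>b\<in>M. u i n = sigma b (y k)" if "i \<in> J" for i n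
      using u(1)[OF that, of n] by (auto simp: Z_def)
    then obtain b where b: "\<And>i n. i \<in> J \<Longrightarrow> b i n \<in> M" "\<And>i n. i \<in> J \<Longrightarrow> u i n = sigma (b i n) (y k)"
      by metis
    have "(\<lambda>n. Re (\<Sum>i\<in>J. \<Sum>j\<in>J. hinner E (u i n) (ip (f i) (f j) (u j n)))) \<longlonglongrightarrow>
        Re (\<Sum>i\<in>J. \<Sum>j\<in>J. hinner E (p (y i)) (ip (f i) (f j) (p (y j))))"
      by (intro tendsto_Re tendsto_sum E.conv_hinner op_conv[OF ip_in] u f) simp_all
    moreover have "0 \<le> Re (\<Sum>i\<in>J. \<Sum>j\<in>J. hinner E (u i n) (ip (f i) (f j) (u j n)))" for n
      using gram_cyclic[of J f "\<lambda>i. b i n" "y k", OF J(1) f _ y[OF J(2)]] b by (simp cong: sum.cong)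
    ultimately show ?thesis by (intro LIMSEQ_le_const) auto
  qed
  ultimately show ?case
    unfolding J_def[symmetric] by (simp add: split sum.distrib cong: sum.cong)
qed

end

section \<open>Quotients and completions\<close>

text \<open>\<open>quotient_space\<close> computes on representatives, and its inner product even on
  chosen ones; compatibility of \<open>R\<close> makes this well defined. It serves both the tensor
  relations and the null sequences.\<close>

locale quotient_semi_inner = S: semi_inner_space S for S :: "'x hilb" +
  fixes R :: "('x \<times> 'x) set"
  assumes R_equiv: "equiv (carr S) R"
    and R_add: "\<lbrakk>(a, a') \<in> R; (b, b') \<in> R\<rbrakk> \<Longrightarrow> (hadd S a b, hadd S a' b') \<in> R"
    and R_scale: "(a, a') \<in> R \<Longrightarrow> (hscale S c a, hscale S c a') \<in> R"
    and R_inner: "\<lbrakk>(a, a') \<in> R; (b, b') \<in> R\<rbrakk> \<Longrightarrow> hinner S a b = hinner S a' b'"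
begin

abbreviation "Q \<equiv> quotient_space S R"
abbreviation "cls a \<equiv> R `` {a}"

lemma R_refl: "a \<in> carr S \<Longrightarrow> (a, a) \<in> R"
  using R_equiv by (auto simp: equiv_def refl_on_def)

lemma cls_self: "a \<in> carr S \<Longrightarrow> a \<in> cls a"
  by (simp add: R_refl)

lemma cls_eqI: "(a, b) \<in> R \<Longrightarrow> cls a = cls b"
  using equiv_class_eq[OF R_equiv] .

lemma Q_carr: "carr Q = carr S // R"
  by (simp add: quotient_space_def)

lemma cls_in: "a \<in> carr S \<Longrightarrow> cls a \<in> carr Q"
  by (simp add: Q_carr quotientI)

lemma Q_cases:
  assumes "A \<in> carr Q"
  obtains a where "a \<in> carr S" "A = cls a"
  using assms by (auto simp: Q_carr elim: quotientE)

lemma Q_zero: "hzero Q = cls (hzero S)"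
  by (simp add: quotient_space_def)

text \<open>Compatibility turns the union in \<open>quotient_space\<close> into a union of equal
  sets over a nonempty family.\<close>

lemma Q_add:
  assumes "a \<in> carr S" "b \<in> carr S"
  shows "hadd Q (cls a) (cls b) = cls (hadd S a b)"
proof -
  have "cls (hadd S a' b') = cls (hadd S a b)" if "a' \<in> cls a" "b' \<in> cls b" for a' b'
    using that by (intro cls_eqI[symmetric] R_add) auto
  then have "(\<Union>a'\<in>cls a. \<Union>b'\<in>cls b. cls (hadd S a' b')) = (\<Union>a'\<in>cls a. \<Union>b'\<in>cls b. cls (hadd S a b))"
    by simp
  also have "\<dots> = cls (hadd S a b)" using cls_self assms by auto
  finally show ?thesis by (simp add: quotient_space_def)
qed

lemma Q_scale:
  assumes "a \<in> carr S"
  shows "hscale Q c (cls a) = cls (hscale S c a)"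
proof -
  have "cls (hscale S c a') = cls (hscale S c a)" if "a' \<in> cls a" for a'
    using that by (intro cls_eqI[symmetric] R_scale) auto
  then have "(\<Union>a'\<in>cls a. cls (hscale S c a')) = (\<Union>a'\<in>cls a. cls (hscale S c a))"
    by simp
  also have "\<dots> = cls (hscale S c a)" using cls_self assms by auto
  finally show ?thesis by (simp add: quotient_space_def)
qed

lemma Q_diff: "\<lbrakk>a \<in> carr S; b \<in> carr S\<rbrakk> \<Longrightarrow> hdiff Q (cls a) (cls b) = cls (hdiff S a b)"
  by (simp add: hdiff_def Q_scale Q_add S.closed)

lemma Q_inner:
  assumes "a \<in> carr S" "b \<in> carr S"
  shows "hinner Q (cls a) (cls b) = hinner S a b"
proof -
  have "(a, SOME a'. a' \<in> cls a) \<in> R" "(b, SOME b'. b' \<in> cls b) \<in> R"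
    using someI[of "\<lambda>a'. a' \<in> cls a", OF cls_self[OF assms(1)]]
      someI[of "\<lambda>b'. b' \<in> cls b", OF cls_self[OF assms(2)]] by auto
  then show ?thesis using R_inner by (simp add: quotient_space_def)
qed

lemma semi_inner_quotient: "semi_inner_space Q"
proof
  show "hzero Q \<in> carr Q" by (simp add: Q_zero cls_in S.closed)
  fix A assume "A \<in> carr Q"
  then obtain a where a: "a \<in> carr S" "A = cls a" by (rule Q_cases)
  show "hscale Q c A \<in> carr Q" for c using a by (simp add: Q_scale cls_in S.closed)
  show "hadd Q A (hzero Q) = A" using a by (simp add: Q_zero Q_add S.closed S.hadd_zero)
  show "hadd Q A (hscale Q (- 1) A) = hzero Q"
    using a by (simp add: Q_zero Q_add Q_scale S.closed S.hadd_inverse)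
  show "hscale Q 1 A = A" using a by (simp add: Q_scale S.hscale_one)
  show "hscale Q c (hscale Q d A) = hscale Q (c * d) A" for c d
    using a by (simp add: Q_scale S.closed S.hscale_scale)
  show "hscale Q (c + d) A = hadd Q (hscale Q c A) (hscale Q d A)" for c d
    using a by (simp add: Q_scale Q_add S.closed S.hscale_add_left)
  show "hinner Q A A \<in> \<real>\<^sub>\<ge>\<^sub>0" using a by (simp add: Q_inner S.hinner_nonneg)
  fix B assume "B \<in> carr Q"
  then obtain b where b: "b \<in> carr S" "B = cls b" by (rule Q_cases)
  show "hadd Q A B \<in> carr Q" using a b by (simp add: Q_add cls_in S.closed)
  show "hadd Q A B = hadd Q B A" using a b by (simp add: Q_add S.hadd_commute)
  show "hscale Q c (hadd Q A B) = hadd Q (hscale Q c A) (hscale Q c B)" for c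
    using a b by (simp add: Q_add Q_scale S.closed S.hscale_add_right)
  show "hinner Q A B = cnj (hinner Q B A)"
    using a b S.hinner_commute[of a b] by (simp add: Q_inner)
  show "hinner Q A (hscale Q c B) = c * hinner Q A B" for c
    using a b by (simp add: Q_inner Q_scale S.closed S.hinner_scale_right)
  fix C assume "C \<in> carr Q"
  then obtain c where c: "c \<in> carr S" "C = cls c" by (rule Q_cases)
  show "hadd Q (hadd Q A B) C = hadd Q A (hadd Q B C)"
    using a b c by (simp add: Q_add S.closed S.hadd_assoc)
  show "hinner Q A (hadd Q B C) = hinner Q A B + hinner Q A C"
    using a b c by (simp add: Q_inner Q_add S.closed S.hinner_add_right)
qed

end

section \<open>Completion by Cauchy sequences\<close>

locale completion_of = S: semi_inner_space S for S :: "'x hilb"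
begin

lemma cauchy_in: "cauchy_seq S u \<Longrightarrow> u n \<in> carr S"
  by (simp add: cauchy_seq_def)

lemma cauchy_inner_convergent:
  assumes u: "cauchy_seq S u" and v: "cauchy_seq S v"
  shows "(\<lambda>n. hinner S (u n) (v n)) \<longlonglongrightarrow> lim (\<lambda>n. hinner S (u n) (v n))"
proof -
  note c = cauchy_in[OF u] cauchy_in[OF v]
  obtain A where A: "0 < A" "\<And>n. hnorm S (u n) \<le> A" using S.cauchy_bounded[OF u] by blast
  obtain B where B: "0 < B" "\<And>n. hnorm S (v n) \<le> B" using S.cauchy_bounded[OF v] by blast
  have "Cauchy (\<lambda>n. hinner S (u n) (v n))"
    unfolding Cauchy_def
  proof (intro allI impI)
    fix e :: real assume e: "0 < e"
    obtain N1 where N1: "\<And>m n. \<lbrakk>N1 \<le> m; N1 \<le> n\<rbrakk> \<Longrightarrow> hnorm S (hdiff S (v m) (v n)) < e / (2 * A)"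
      using S.cauchy_seqD[OF v, of "e / (2 * A)"] e A by auto
    obtain N2 where N2: "\<And>m n. \<lbrakk>N2 \<le> m; N2 \<le> n\<rbrakk> \<Longrightarrow> hnorm S (hdiff S (u m) (u n)) < e / (2 * B)"
      using S.cauchy_seqD[OF u, of "e / (2 * B)"] e B by auto
    have "dist (hinner S (u m) (v m)) (hinner S (u n) (v n)) < e"
      if m: "max N1 N2 \<le> m" and n: "max N1 N2 \<le> n" for m n
    proof -
      have "dist (hinner S (u m) (v m)) (hinner S (u n) (v n)) \<le>
          hnorm S (u m) * hnorm S (hdiff S (v m) (v n)) + hnorm S (hdiff S (u m) (u n)) * hnorm S (v n)"
        unfolding dist_norm by (rule S.hinner_diff_bound) (simp_all add: c)
      also have "\<dots> \<le> A * hnorm S (hdiff S (v m) (v n)) + hnorm S (hdiff S (u m) (u n)) * B"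
        using A B by (intro add_mono mult_mono) (simp_all add: c S.hnorm_nonneg S.closed less_imp_le)
      also have "\<dots> < A * (e / (2 * A)) + e / (2 * B) * B"
        using A B N1[of m n] N2[of m n] m n
        by (intro add_strict_mono mult_strict_left_mono mult_strict_right_mono) simp_all
      also have "\<dots> = e" using A B by simp
      finally show ?thesis .
    qed
    then show "\<exists>N. \<forall>m\<ge>N. \<forall>n\<ge>N. dist (hinner S (u m) (v m)) (hinner S (u n) (v n)) < e" by blast
  qed
  then show ?thesis using Cauchy_convergent convergent_LIMSEQ_iff by blast
qed

lemma cauchy_add:
  assumes u: "cauchy_seq S u" and v: "cauchy_seq S v"
  shows "cauchy_seq S (\<lambda>n. hadd S (u n) (v n))"
  unfolding cauchy_seq_def
proof (intro conjI allI impI)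
  note c = cauchy_in[OF u] cauchy_in[OF v]
  show "hadd S (u n) (v n) \<in> carr S" for n by (simp add: c S.closed)
  fix e :: real assume e: "0 < e"
  obtain N1 where N1: "\<And>m n. \<lbrakk>N1 \<le> m; N1 \<le> n\<rbrakk> \<Longrightarrow> hnorm S (hdiff S (u m) (u n)) < e / 2"
    using S.cauchy_seqD[OF u, of "e / 2"] e by auto
  obtain N2 where N2: "\<And>m n. \<lbrakk>N2 \<le> m; N2 \<le> n\<rbrakk> \<Longrightarrow> hnorm S (hdiff S (v m) (v n)) < e / 2"
    using S.cauchy_seqD[OF v, of "e / 2"] e by auto
  have "hnorm S (hdiff S (hadd S (u m) (v m)) (hadd S (u n) (v n))) < e"
    if "max N1 N2 \<le> m" "max N1 N2 \<le> n" for m n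
    using S.hnorm_diff_add[of "u m" "v m" "u n" "v n"] N1[of m n] N2[of m n] that by (simp add: c)
  then show "\<exists>N. \<forall>m\<ge>N. \<forall>n\<ge>N. hnorm S (hdiff S (hadd S (u m) (v m)) (hadd S (u n) (v n))) < e"
    by blast
qed

lemma cauchy_scale:
  assumes u: "cauchy_seq S u"
  shows "cauchy_seq S (\<lambda>n. hscale S c (u n))"
  unfolding cauchy_seq_def
proof (intro conjI allI impI)
  note c = cauchy_in[OF u]
  show "hscale S c (u n) \<in> carr S" for n by (simp add: c S.closed)
  fix e :: real assume e: "0 < e"
  have c1: "0 < cmod c + 1" by (simp add: add_nonneg_pos)
  obtain N where N: "\<And>m n. \<lbrakk>N \<le> m; N \<le> n\<rbrakk> \<Longrightarrow> hnorm S (hdiff S (u m) (u n)) < e / (cmod c + 1)"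
    using S.cauchy_seqD[OF u, of "e / (cmod c + 1)"] e c1 by auto
  have "hnorm S (hdiff S (hscale S c (u m)) (hscale S c (u n))) < e"
    if "N \<le> m" "N \<le> n" for m n
  proof -
    have "cmod c * hnorm S (hdiff S (u m) (u n)) \<le> (cmod c + 1) * hnorm S (hdiff S (u m) (u n))"
      by (intro mult_right_mono) (simp_all add: c S.hnorm_nonneg S.closed)
    also have "\<dots> < (cmod c + 1) * (e / (cmod c + 1))"
      using N[OF that] c1 by (intro mult_strict_left_mono)
    also have "\<dots> = e" using c1 by simp
    finally show ?thesis by (simp add: c S.hnorm_diff_scale)
  qed
  then show "\<exists>N. \<forall>m\<ge>N. \<forall>n\<ge>N. hnorm S (hdiff S (hscale S c (u m)) (hscale S c (u n))) < e"
    by blast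
qed

lemma cauchy_const: "x \<in> carr S \<Longrightarrow> cauchy_seq S (\<lambda>_. x)"
  by (rule S.conv_cauchy[OF S.conv_const])

lemma cauchy_space_simps [simp]:
  "carr (cauchy_space S) = {u. cauchy_seq S u}"
  "hzero (cauchy_space S) = (\<lambda>_. hzero S)"
  "hadd (cauchy_space S) = (\<lambda>u v n. hadd S (u n) (v n))"
  "hscale (cauchy_space S) = (\<lambda>c u n. hscale S c (u n))"
  "hinner (cauchy_space S) = (\<lambda>u v. lim (\<lambda>n. hinner S (u n) (v n)))"
  by (simp_all add: cauchy_space_def)

lemma semi_inner_cauchy_space: "semi_inner_space (cauchy_space S)"
proof
  fix u assume "u \<in> carr (cauchy_space S)"
  then have u: "cauchy_seq S u" by simp
  have "(\<lambda>n. Re (hinner S (u n) (u n))) \<longlonglongrightarrow> Re (lim (\<lambda>n. hinner S (u n) (u n)))"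
    "(\<lambda>n. Im (hinner S (u n) (u n))) \<longlonglongrightarrow> Im (lim (\<lambda>n. hinner S (u n) (u n)))"
    using cauchy_inner_convergent[OF u u] by (auto intro: tendsto_Re tendsto_Im)
  moreover have "0 \<le> Re (hinner S (u n) (u n)) \<and> Im (hinner S (u n) (u n)) = 0" for n
    using S.hinner_nonneg[OF cauchy_in[OF u]] by (simp add: complex_nonneg_Reals_iff)
  ultimately have "0 \<le> Re (lim (\<lambda>n. hinner S (u n) (u n)))" "Im (lim (\<lambda>n. hinner S (u n) (u n))) = 0"
    by (auto intro: LIMSEQ_le_const LIMSEQ_unique)
  then show "hinner (cauchy_space S) u u \<in> \<real>\<^sub>\<ge>\<^sub>0" by (simp add: complex_nonneg_Reals_iff)
next
  fix u v assume "u \<in> carr (cauchy_space S)" "v \<in> carr (cauchy_space S)"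
  then have uv: "cauchy_seq S u" "cauchy_seq S v" by simp_all
  have "(\<lambda>n. cnj (hinner S (v n) (u n))) \<longlonglongrightarrow> cnj (lim (\<lambda>n. hinner S (v n) (u n)))"
    using cauchy_inner_convergent[OF uv(2,1)] by (rule tendsto_cnj)
  moreover have "cnj (hinner S (v n) (u n)) = hinner S (u n) (v n)" for n
    using S.hinner_commute[OF cauchy_in[OF uv(1)] cauchy_in[OF uv(2)], of n n] by simp
  ultimately show "hinner (cauchy_space S) u v = cnj (hinner (cauchy_space S) v u)"
    by (simp add: limI)
  from uv show "hadd (cauchy_space S) u v = hadd (cauchy_space S) v u"
    using S.hadd_commute[OF cauchy_in[OF uv(1)] cauchy_in[OF uv(2)]] by simp
  show "hinner (cauchy_space S) u (hscale (cauchy_space S) c v) = c * hinner (cauchy_space S) u v" for c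
    using tendsto_mult_left[OF cauchy_inner_convergent[OF uv], of c]
    by (simp add: S.hinner_scale_right cauchy_in[OF uv(1)] cauchy_in[OF uv(2)] limI)
next
  fix u v w assume "u \<in> carr (cauchy_space S)" "v \<in> carr (cauchy_space S)" "w \<in> carr (cauchy_space S)"
  then have uv: "cauchy_seq S u" "cauchy_seq S v" "cauchy_seq S w" by simp_all
  show "hinner (cauchy_space S) u (hadd (cauchy_space S) v w) =
      hinner (cauchy_space S) u v + hinner (cauchy_space S) u w"
    using tendsto_add[OF cauchy_inner_convergent[OF uv(1,2)] cauchy_inner_convergent[OF uv(1,3)]]
    by (simp add: S.hinner_add_right cauchy_in[OF uv(1)] cauchy_in[OF uv(2)] cauchy_in[OF uv(3)] limI)
qed (auto simp: cauchy_add cauchy_scale cauchy_const S.closed fun_eq_iff cauchy_in S.hadd_assoc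
    S.hadd_zero S.hadd_inverse S.hscale_one S.hscale_scale S.hscale_add_left S.hscale_add_right)

lemma null_relI:
  "\<lbrakk>cauchy_seq S u; cauchy_seq S v; (\<lambda>n. hnorm S (hdiff S (u n) (v n))) \<longlonglongrightarrow> 0\<rbrakk> \<Longrightarrow> (u, v) \<in> null_rel S"
  by (simp add: null_rel_def)

lemma null_relD:
  assumes "(u, v) \<in> null_rel S"
  shows "cauchy_seq S u" "cauchy_seq S v" "(\<lambda>n. hnorm S (hdiff S (u n) (v n))) \<longlonglongrightarrow> 0"
  using assms by (simp_all add: null_rel_def)

lemma null_rel_equiv: "equiv {u. cauchy_seq S u} (null_rel S)"
proof (rule equivI)
  show "null_rel S \<subseteq> {u. cauchy_seq S u} \<times> {u. cauchy_seq S u}" by (auto simp: null_rel_def)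
  show "refl_on {u. cauchy_seq S u} (null_rel S)"
    by (auto simp: refl_on_def null_rel_def S.hnorm_diff_self cauchy_in)
  show "sym (null_rel S)"
  proof (rule symI)
    fix u v assume "(u, v) \<in> null_rel S"
    note uv = null_relD[OF this]
    then show "(v, u) \<in> null_rel S"
      using S.hnorm_diff_commute[OF cauchy_in[OF uv(1)] cauchy_in[OF uv(2)]] by (simp add: null_rel_def)
  qed
  show "trans (null_rel S)"
  proof (rule transI)
    fix u v w assume "(u, v) \<in> null_rel S" "(v, w) \<in> null_rel S"
    note uv = null_relD[OF this(1)] and vw = null_relD[OF this(2)]
    show "(u, w) \<in> null_rel S"
    proof (rule null_relI[OF uv(1) vw(2)], rule tendsto_sandwich[where f = "\<lambda>_. 0"])
      show "(\<lambda>n. hnorm S (hdiff S (u n) (v n)) + hnorm S (hdiff S (v n) (w n))) \<longlonglongrightarrow> 0"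
        using tendsto_add[OF uv(3) vw(3)] by simp
    qed (simp_all add: S.hnorm_nonneg S.closed cauchy_in[OF uv(1)] cauchy_in[OF uv(2)] cauchy_in[OF vw(2)]
        S.hnorm_diff_triangle)
  qed
qed

sublocale Q: quotient_semi_inner "cauchy_space S" "null_rel S"
proof (intro quotient_semi_inner.intro quotient_semi_inner_axioms.intro semi_inner_cauchy_space)
  show "equiv (carr (cauchy_space S)) (null_rel S)" using null_rel_equiv by simp
  fix u u' assume "(u, u') \<in> null_rel S"
  note u = null_relD[OF this]
  note cu = cauchy_in[OF u(1)] cauchy_in[OF u(2)]
  show "(hscale (cauchy_space S) c u, hscale (cauchy_space S) c u') \<in> null_rel S" for c
    using tendsto_mult_left[OF u(3), of "cmod c"]
    by (intro null_relI) (simp_all add: u cauchy_scale S.hnorm_diff_scale cu)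
  fix v v' assume "(v, v') \<in> null_rel S"
  note v = null_relD[OF this]
  note cv = cauchy_in[OF v(1)] cauchy_in[OF v(2)]
  show "(hadd (cauchy_space S) u v, hadd (cauchy_space S) u' v') \<in> null_rel S"
  proof (rule null_relI)
    show "(\<lambda>n. hnorm S (hdiff S (hadd (cauchy_space S) u v n) (hadd (cauchy_space S) u' v' n))) \<longlonglongrightarrow> 0"
    proof (rule tendsto_sandwich[where f = "\<lambda>_. 0"])
      show "(\<lambda>n. hnorm S (hdiff S (u n) (u' n)) + hnorm S (hdiff S (v n) (v' n))) \<longlonglongrightarrow> 0"
        using tendsto_add[OF u(3) v(3)] by simp
    qed (simp_all add: S.hnorm_nonneg S.closed cu cv S.hnorm_diff_add)
  qed (simp_all add: cauchy_add u v)
  obtain A where A: "0 < A" "\<And>n. hnorm S (u n) \<le> A" using S.cauchy_bounded[OF u(1)] by blast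
  obtain B where B: "0 < B" "\<And>n. hnorm S (v' n) \<le> B" using S.cauchy_bounded[OF v(2)] by blast
  have "(\<lambda>n. hinner S (u n) (v n) - hinner S (u' n) (v' n)) \<longlonglongrightarrow> 0"
  proof (rule tendsto_0_le[where K = 1])
    show "(\<lambda>n. A * hnorm S (hdiff S (v n) (v' n)) + hnorm S (hdiff S (u n) (u' n)) * B) \<longlonglongrightarrow> 0"
      using u(3) v(3) by (auto intro!: tendsto_eq_intros)
    have "cmod (hinner S (u n) (v n) - hinner S (u' n) (v' n)) \<le>
        A * hnorm S (hdiff S (v n) (v' n)) + hnorm S (hdiff S (u n) (u' n)) * B" for n
    proof -
      have "cmod (hinner S (u n) (v n) - hinner S (u' n) (v' n)) \<le>
          hnorm S (u n) * hnorm S (hdiff S (v n) (v' n)) + hnorm S (hdiff S (u n) (u' n)) * hnorm S (v' n)"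
        by (rule S.hinner_diff_bound) (simp_all add: cu cv)
      also have "\<dots> \<le> A * hnorm S (hdiff S (v n) (v' n)) + hnorm S (hdiff S (u n) (u' n)) * B"
        using A B by (intro add_mono mult_mono) (simp_all add: cu cv S.hnorm_nonneg S.closed)
      finally show ?thesis .
    qed
    then show "\<forall>\<^sub>F n in sequentially. norm (hinner S (u n) (v n) - hinner S (u' n) (v' n)) \<le>
        norm (A * hnorm S (hdiff S (v n) (v' n)) + hnorm S (hdiff S (u n) (u' n)) * B) * 1"
      by (intro always_eventually allI) (simp add: order_trans[OF _ abs_ge_self])
  qed
  from tendsto_add[OF this cauchy_inner_convergent[OF u(2) v(2)]]
  have "(\<lambda>n. hinner S (u n) (v n)) \<longlonglongrightarrow> lim (\<lambda>n. hinner S (u' n) (v' n))"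
    by simp
  then show "hinner (cauchy_space S) u v = hinner (cauchy_space S) u' v'" by (simp add: limI)
qed

abbreviation "C \<equiv> completion S"

lemma completion_eq: "C = Q.Q"
  by (simp add: completion_def)

sublocale C: semi_inner_space C
  unfolding completion_eq by (rule Q.semi_inner_quotient)

definition emb :: "'x \<Rightarrow> (nat \<Rightarrow> 'x) set" where
  "emb x = Q.cls (\<lambda>_. x)"

lemma emb_in: "x \<in> carr S \<Longrightarrow> emb x \<in> carr C"
  unfolding emb_def completion_eq by (rule Q.cls_in) (simp add: cauchy_const)

lemma emb_add: "\<lbrakk>x \<in> carr S; y \<in> carr S\<rbrakk> \<Longrightarrow> emb (hadd S x y) = hadd C (emb x) (emb y)"
  by (simp add: emb_def completion_eq Q.Q_add cauchy_const)

lemma emb_scale: "x \<in> carr S \<Longrightarrow> emb (hscale S c x) = hscale C c (emb x)"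
  by (simp add: emb_def completion_eq Q.Q_scale cauchy_const)

lemma emb_inner: "\<lbrakk>x \<in> carr S; y \<in> carr S\<rbrakk> \<Longrightarrow> hinner C (emb x) (emb y) = hinner S x y"
  by (simp add: emb_def completion_eq Q.Q_inner cauchy_const limI)

lemma emb_diff: "\<lbrakk>x \<in> carr S; y \<in> carr S\<rbrakk> \<Longrightarrow> hdiff C (emb x) (emb y) = emb (hdiff S x y)"
  by (simp add: hdiff_def emb_add emb_scale S.closed)

lemma emb_norm: "x \<in> carr S \<Longrightarrow> hnorm C (emb x) = hnorm S x"
  by (simp add: hnorm_def emb_inner)

lemma norm_cls:
  assumes u: "cauchy_seq S u"
  shows "(\<lambda>n. hnorm S (u n)) \<longlonglongrightarrow> hnorm C (Q.cls u)"
  unfolding hnorm_def completion_eq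
  using cauchy_inner_convergent[OF u u] u
  by (auto simp: Q.Q_inner intro!: tendsto_real_sqrt tendsto_Re)

text \<open>The distance from \<open>emb (u m)\<close> to the class of \<open>u\<close> is the limit
  in \<open>n\<close> of the distances from \<open>u m\<close> to \<open>u n\<close>, which are
  small on the tail.\<close>

lemma emb_conv:
  assumes u: "cauchy_seq S u"
  shows "C.conv (\<lambda>n. emb (u n)) (Q.cls u)"
  unfolding C.conv_def
proof (intro conjI allI)
  show "emb (u n) \<in> carr C" for n by (rule emb_in[OF cauchy_in[OF u]])
  show "Q.cls u \<in> carr C" unfolding completion_eq by (rule Q.cls_in) (simp add: u)
  show "(\<lambda>n. hnorm C (hdiff C (emb (u n)) (Q.cls u))) \<longlonglongrightarrow> 0"
  proof (rule LIMSEQ_I)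
    fix e :: real assume e: "0 < e"
    obtain N where N: "\<And>m n. \<lbrakk>N \<le> m; N \<le> n\<rbrakk> \<Longrightarrow> hnorm S (hdiff S (u m) (u n)) < e / 2"
      using S.cauchy_seqD[OF u, of "e / 2"] e by auto
    have "hnorm C (hdiff C (emb (u m)) (Q.cls u)) \<le> e / 2" if m: "N \<le> m" for m
    proof -
      have k: "cauchy_seq S (\<lambda>_. u m)" by (rule cauchy_const[OF cauchy_in[OF u]])
      have d: "cauchy_seq S (\<lambda>n. hdiff S (u m) (u n))"
        unfolding hdiff_def by (intro cauchy_add k cauchy_scale u)
      have "hdiff C (emb (u m)) (Q.cls u) = Q.cls (\<lambda>n. hdiff S (u m) (u n))"
        using u k unfolding emb_def completion_eq by (subst Q.Q_diff) (simp_all add: hdiff_def)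
      then have "(\<lambda>n. hnorm S (hdiff S (u m) (u n))) \<longlonglongrightarrow> hnorm C (hdiff C (emb (u m)) (Q.cls u))"
        using norm_cls[OF d] by simp
      then show ?thesis
        by (rule LIMSEQ_le_const2) (use N m less_imp_le in blast)
    qed
    then have "norm (hnorm C (hdiff C (emb (u m)) (Q.cls u)) - 0) < e" if "N \<le> m" for m
      using that e emb_in[OF cauchy_in[OF u], of m] \<open>Q.cls u \<in> carr C\<close>
      by (fastforce simp: C.hnorm_nonneg C.closed)
    then show "\<exists>N. \<forall>n\<ge>N. norm (hnorm C (hdiff C (emb (u n)) (Q.cls u)) - 0) < e" by blast
  qed
qed

lemma emb_dense:
  assumes "x \<in> carr C"
  obtains u where "\<And>n. u n \<in> carr S" "C.conv (\<lambda>n. emb (u n)) x"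
proof -
  obtain u where u: "cauchy_seq S u" "x = Q.cls u"
    using assms unfolding completion_eq by (auto elim: Q.Q_cases)
  show ?thesis using that[of u] cauchy_in[OF u(1)] emb_conv[OF u(1)] u(2) by simp
qed

lemma hilbert_completion: "hilbert_space C"
proof
  fix x assume "x \<in> carr C" "hinner C x x = 0"
  then obtain u where u: "cauchy_seq S u" "x = Q.cls u"
    unfolding completion_eq by (auto elim: Q.Q_cases)
  have "hnorm C x = 0" using \<open>hinner C x x = 0\<close> by (simp add: hnorm_def)
  then have "(\<lambda>n. hnorm S (u n)) \<longlonglongrightarrow> 0" using norm_cls[OF u(1)] u(2) by simp
  moreover have "hnorm S (hdiff S (u n) (hzero S)) = hnorm S (u n)" for n
    by (rule S.hnorm_cong) (simp add: S.inner_simps S.closed cauchy_in[OF u(1)])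
  ultimately have "(u, \<lambda>_. hzero S) \<in> null_rel S"
    by (intro null_relI u cauchy_const S.zero_in) simp
  then show "x = hzero C" unfolding u(2) completion_eq Q.Q_zero by (simp add: Q.cls_eqI)
next
  fix w assume w: "cauchy_seq C w"
  then have wc: "w k \<in> carr C" for k by (simp add: cauchy_seq_def)
  \<comment> \<open>Every \<open>w k\<close> is approximated within 1/(k+1) by an embedded vector;
    the approximants form a Cauchy sequence in \<open>S\<close> whose class is the limit of
    \<open>w\<close>.\<close>
  have "\<exists>s\<in>carr S. hnorm C (hdiff C (w k) (emb s)) < 1 / real (Suc k)" for k
  proof -
    obtain v where v: "\<And>n. v n \<in> carr S" "C.conv (\<lambda>n. emb (v n)) (w k)" using emb_dense[OF wc] by blast
    then have "\<forall>\<^sub>F n in sequentially. hnorm C (hdiff C (emb (v n)) (w k)) < 1 / real (Suc k)"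
      unfolding C.conv_def by (intro order_tendstoD(2)[where y = 0]) auto
    then obtain n where "hnorm C (hdiff C (emb (v n)) (w k)) < 1 / real (Suc k)"
      by (auto simp: eventually_sequentially)
    then show ?thesis using v(1)[of n] C.hnorm_diff_commute[OF wc emb_in[OF v(1)], of k n]
      by (intro bexI[of _ "v n"]) simp_all
  qed
  then obtain s where s: "\<And>k. s k \<in> carr S" "\<And>k. hnorm C (hdiff C (w k) (emb (s k))) < 1 / real (Suc k)"
    by metis
  note es = emb_in[OF s(1)]
  have "cauchy_seq S s"
    unfolding cauchy_seq_def
  proof (intro conjI allI impI s(1))
    fix e :: real assume e: "0 < e"
    obtain N1 where N1: "\<And>m n. \<lbrakk>N1 \<le> m; N1 \<le> n\<rbrakk> \<Longrightarrow> hnorm C (hdiff C (w m) (w n)) < e / 3"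
      using C.cauchy_seqD[OF w, of "e / 3"] e by auto
    obtain N2 where N2: "1 / real (Suc N2) < e / 3" using nat_approx_posE[of "e / 3"] e by auto
    have small: "hnorm C (hdiff C (w k) (emb (s k))) < e / 3" if "N2 \<le> k" for k
    proof -
      have "1 / real (Suc k) \<le> 1 / real (Suc N2)" using that by (simp add: frac_le)
      then show ?thesis using s(2)[of k] N2 by linarith
    qed
    have "hnorm S (hdiff S (s m) (s n)) < e" if m: "max N1 N2 \<le> m" and n: "max N1 N2 \<le> n" for m n
    proof -
      have "hnorm S (hdiff S (s m) (s n)) = hnorm C (hdiff C (emb (s m)) (emb (s n)))"
        using s by (simp add: emb_diff emb_norm S.closed)
      also have "\<dots> \<le> hnorm C (hdiff C (emb (s m)) (w m)) + hnorm C (hdiff C (w m) (emb (s n)))"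
        by (rule C.hnorm_diff_triangle) (simp_all add: es wc)
      also have "hnorm C (hdiff C (w m) (emb (s n))) \<le>
          hnorm C (hdiff C (w m) (w n)) + hnorm C (hdiff C (w n) (emb (s n)))"
        by (rule C.hnorm_diff_triangle) (simp_all add: es wc)
      finally show ?thesis
        using C.hnorm_diff_commute[OF es wc, of m m] small[of m] small[of n] N1[of m n] m n by simp
    qed
    then show "\<exists>N. \<forall>m\<ge>N. \<forall>n\<ge>N. hnorm S (hdiff S (s m) (s n)) < e" by blast
  qed
  note lim = emb_conv[OF this]
  have "(\<lambda>k. hnorm C (hdiff C (w k) (Q.cls s))) \<longlonglongrightarrow> 0"
  proof (rule tendsto_sandwich[where f = "\<lambda>_. 0"])
    have "(\<lambda>k. 1 / real (Suc k) + hnorm C (hdiff C (emb (s k)) (Q.cls s))) \<longlonglongrightarrow> 0 + 0"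
      using lim by (intro tendsto_add LIMSEQ_Suc lim_1_over_n) (simp add: C.conv_def)
    then show "(\<lambda>k. 1 / real (Suc k) + hnorm C (hdiff C (emb (s k)) (Q.cls s))) \<longlonglongrightarrow> 0" by simp
    have "hnorm C (hdiff C (w k) (Q.cls s)) \<le> 1 / real (Suc k) + hnorm C (hdiff C (emb (s k)) (Q.cls s))" for k
      using C.hnorm_diff_triangle[OF wc es, of "Q.cls s" k k] s(2)[of k] lim by (simp add: C.conv_def)
    then show "\<forall>\<^sub>F k in sequentially. hnorm C (hdiff C (w k) (Q.cls s)) \<le>
        1 / real (Suc k) + hnorm C (hdiff C (emb (s k)) (Q.cls s))"
      by simp
  qed (use lim in \<open>simp_all add: C.conv_def C.hnorm_nonneg C.closed wc\<close>)
  then show "\<exists>x\<in>carr C. (\<lambda>k. hnorm C (hdiff C (w k) x)) \<longlonglongrightarrow> 0"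
    using lim by (auto simp: C.conv_def)
qed (fact C.zero_in C.add_in C.scale_in C.hadd_assoc C.hadd_commute C.hadd_zero C.hadd_inverse
    C.hscale_one C.hscale_scale C.hscale_add_left C.hscale_add_right C.hinner_commute
    C.hinner_add_right C.hinner_scale_right C.hinner_nonneg)+

end

section \<open>Extension of bounded operators from a dense subspace\<close>

text \<open>\<open>Phi\<close> parametrises a dense subspace by formal expressions and need not be
  injective; the estimate on \<open>j\<close> makes the assignment of \<open>j p\<close> to
  \<open>Phi p\<close> consistent. The parameter operations are arguments so that those of a free
  vector space can be inserted.\<close>

lemma bounded_extension:
  fixes S :: "'s set"
  assumes H: "hilbert_space H" and K: "hilbert_space K" and C: "0 \<le> C"
    and pl: "\<And>p q. \<lbrakk>p \<in> S; q \<in> S\<rbrakk> \<Longrightarrow> pl p q \<in> S" and sc: "\<And>c p. p \<in> S \<Longrightarrow> sc c p \<in> S"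
    and Phi: "\<And>p. p \<in> S \<Longrightarrow> Phi p \<in> carr H"
      "\<And>p q. \<lbrakk>p \<in> S; q \<in> S\<rbrakk> \<Longrightarrow> Phi (pl p q) = hadd H (Phi p) (Phi q)"
      "\<And>c p. p \<in> S \<Longrightarrow> Phi (sc c p) = hscale H c (Phi p)"
    and dense: "\<And>x. x \<in> carr H \<Longrightarrow> \<exists>u. (\<forall>n. u n \<in> S) \<and> semi_inner_space.conv H (\<lambda>n. Phi (u n)) x"
    and j: "\<And>p. p \<in> S \<Longrightarrow> j p \<in> carr K"
      "\<And>p q. \<lbrakk>p \<in> S; q \<in> S\<rbrakk> \<Longrightarrow> j (pl p q) = hadd K (j p) (j q)"
      "\<And>c p. p \<in> S \<Longrightarrow> j (sc c p) = hscale K c (j p)"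
    and bound: "\<And>p. p \<in> S \<Longrightarrow> hnorm K (j p) \<le> C * hnorm H (Phi p)"
  obtains W where "W \<in> bounded_ops H K" "\<And>p. p \<in> S \<Longrightarrow> W (Phi p) = j p"
proof -
  interpret H: hilbert_space H by (rule H)
  interpret K: hilbert_space K by (rule K)
  note [simp] = Phi(1) j(1) pl sc
  have j_diff: "hnorm K (hdiff K (j p) (j q)) \<le> C * hnorm H (hdiff H (Phi p) (Phi q))"
    if "p \<in> S" "q \<in> S" for p q
    using bound[of "pl p (sc (-1) q)"] that by (simp add: hdiff_def Phi j)
  have limit: "\<exists>y. K.conv (\<lambda>n. j (u n)) y" if u: "\<And>n. u n \<in> S" and ux: "H.conv (\<lambda>n. Phi (u n)) x" for u x
  proof -
    have "cauchy_seq K (\<lambda>n. j (u n))"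
      unfolding cauchy_seq_def
    proof (intro conjI allI impI)
      show "j (u n) \<in> carr K" for n by (simp add: u)
      fix e :: real assume e: "0 < e"
      have C1: "0 < C + 1" using C by simp
      obtain N where N: "\<And>m n. \<lbrakk>N \<le> m; N \<le> n\<rbrakk> \<Longrightarrow> hnorm H (hdiff H (Phi (u m)) (Phi (u n))) < e / (C + 1)"
        using H.cauchy_seqD[OF H.conv_cauchy[OF ux], of "e / (C + 1)"] e C1 by auto
      have "hnorm K (hdiff K (j (u m)) (j (u n))) < e" if "N \<le> m" "N \<le> n" for m n
      proof -
        have "hnorm K (hdiff K (j (u m)) (j (u n))) \<le> C * hnorm H (hdiff H (Phi (u m)) (Phi (u n)))"
          by (rule j_diff) (simp_all add: u)
        also have "\<dots> \<le> (C + 1) * hnorm H (hdiff H (Phi (u m)) (Phi (u n)))"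
          by (intro mult_right_mono) (simp_all add: H.hnorm_nonneg H.closed u)
        also have "\<dots> < (C + 1) * (e / (C + 1))" using N[OF that] C1 by (intro mult_strict_left_mono)
        finally show ?thesis using C1 by simp
      qed
      then show "\<exists>N. \<forall>m\<ge>N. \<forall>n\<ge>N. hnorm K (hdiff K (j (u m)) (j (u n))) < e" by blast
    qed
    then show ?thesis using K.conv_complete by blast
  qed
  have approx: "hnorm K (hdiff K y (j p)) \<le> C * hnorm H (hdiff H x (Phi p))"
    if u: "\<And>n. u n \<in> S" and ux: "H.conv (\<lambda>n. Phi (u n)) x" and uy: "K.conv (\<lambda>n. j (u n)) y" and p: "p \<in> S"
    for u x y p
  proof (rule LIMSEQ_le)
    have "K.conv (\<lambda>n. hdiff K (j (u n)) (j p)) (hdiff K y (j p))"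
      unfolding hdiff_def using p by (intro K.conv_add K.conv_const uy) (simp add: K.closed)
    then show "(\<lambda>n. hnorm K (hdiff K (j (u n)) (j p))) \<longlonglongrightarrow> hnorm K (hdiff K y (j p))"
      by (rule K.conv_hnorm)
    have "H.conv (\<lambda>n. hdiff H (Phi (u n)) (Phi p)) (hdiff H x (Phi p))"
      unfolding hdiff_def using p by (intro H.conv_add H.conv_const ux) (simp add: H.closed)
    then show "(\<lambda>n. C * hnorm H (hdiff H (Phi (u n)) (Phi p))) \<longlonglongrightarrow> C * hnorm H (hdiff H x (Phi p))"
      by (intro tendsto_mult_left H.conv_hnorm)
  qed (use j_diff u p in blast)
  \<comment> \<open>The estimate pins the value down without naming a sequence: along any
    approximation of \<open>x\<close> by vectors \<open>Phi (u n)\<close> it forces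
    \<open>j (u n)\<close> to converge to \<open>W x\<close>.\<close>
  define W where "W = (\<lambda>x\<in>carr H. SOME y. y \<in> carr K \<and>
      (\<forall>p\<in>S. hnorm K (hdiff K y (j p)) \<le> C * hnorm H (hdiff H x (Phi p))))"
  have W: "W x \<in> carr K \<and> (\<forall>p\<in>S. hnorm K (hdiff K (W x) (j p)) \<le> C * hnorm H (hdiff H x (Phi p)))"
    if x: "x \<in> carr H" for x
  proof -
    obtain u where u: "\<forall>n. u n \<in> S" "H.conv (\<lambda>n. Phi (u n)) x" using dense[OF x] by blast
    then obtain y where y: "K.conv (\<lambda>n. j (u n)) y" using limit by blast
    have "\<exists>y. y \<in> carr K \<and> (\<forall>p\<in>S. hnorm K (hdiff K y (j p)) \<le> C * hnorm H (hdiff H x (Phi p)))"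
      using approx[OF _ u(2) y] u(1) y by (intro exI[of _ y]) (simp add: K.conv_def)
    from someI_ex[OF this] show ?thesis using x by (simp add: W_def)
  qed
  have W_in [simp]: "W x \<in> carr K" if "x \<in> carr H" for x using W[OF that] by blast
  have W_conv: "K.conv (\<lambda>n. j (u n)) (W x)" if u: "\<And>n. u n \<in> S" and ux: "H.conv (\<lambda>n. Phi (u n)) x" for u x
  proof -
    have x: "x \<in> carr H" using ux by (simp add: H.conv_def)
    have "(\<lambda>n. hnorm K (hdiff K (j (u n)) (W x))) \<longlonglongrightarrow> 0"
    proof (rule tendsto_sandwich[where f = "\<lambda>_. 0"])
      show "(\<lambda>n. C * hnorm H (hdiff H (Phi (u n)) x)) \<longlonglongrightarrow> 0"
        using ux by (auto simp: H.conv_def intro!: tendsto_eq_intros)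
      have "hnorm K (hdiff K (j (u n)) (W x)) \<le> C * hnorm H (hdiff H (Phi (u n)) x)" for n
        using W[OF x] u[of n] K.hnorm_diff_commute[of "j (u n)" "W x"]
          H.hnorm_diff_commute[of "Phi (u n)" x] x by simp
      then show "\<forall>\<^sub>F n in sequentially. hnorm K (hdiff K (j (u n)) (W x)) \<le> C * hnorm H (hdiff H (Phi (u n)) x)"
        by simp
    qed (simp_all add: K.hnorm_nonneg K.closed u x)
    then show ?thesis using x by (simp add: K.conv_def u)
  qed
  have "W \<in> bounded_ops H K"
  proof (rule bounded_opsI)
    show "W \<in> extensional (carr H)" by (simp add: W_def)
    show "W x \<in> carr K" if "x \<in> carr H" for x using that by simp
    fix x assume x: "x \<in> carr H"
    obtain u where u: "\<And>n. u n \<in> S" "H.conv (\<lambda>n. Phi (u n)) x" using dense[OF x] by blast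
    note Wu = W_conv[OF u]
    show "hnorm K (W x) \<le> C * hnorm H x"
    proof (rule LIMSEQ_le)
      show "(\<lambda>n. hnorm K (j (u n))) \<longlonglongrightarrow> hnorm K (W x)" by (rule K.conv_hnorm[OF Wu])
      show "(\<lambda>n. C * hnorm H (Phi (u n))) \<longlonglongrightarrow> C * hnorm H x"
        by (intro tendsto_mult_left H.conv_hnorm u(2))
    qed (use bound u(1) in blast)
    show "W (hscale H c x) = hscale K c (W x)" for c
    proof (rule K.conv_unique)
      show "K.conv (\<lambda>n. j (sc c (u n))) (W (hscale H c x))"
        using H.conv_scale[OF u(2), of c] by (intro W_conv) (simp_all add: u Phi)
      show "K.conv (\<lambda>n. j (sc c (u n))) (hscale K c (W x))"
        using K.conv_scale[OF Wu, of c] by (simp add: u j)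
    qed
    fix y assume y: "y \<in> carr H"
    obtain v where v: "\<And>n. v n \<in> S" "H.conv (\<lambda>n. Phi (v n)) y" using dense[OF y] by blast
    show "W (hadd H x y) = hadd K (W x) (W y)"
    proof (rule K.conv_unique)
      show "K.conv (\<lambda>n. j (pl (u n) (v n))) (W (hadd H x y))"
        using H.conv_add[OF u(2) v(2)] by (intro W_conv) (simp_all add: u v Phi)
      show "K.conv (\<lambda>n. j (pl (u n) (v n))) (hadd K (W x) (W y))"
        using K.conv_add[OF Wu W_conv[OF v]] by (simp add: u v j)
    qed
  qed
  moreover have "W (Phi p) = j p" if p: "p \<in> S" for p
    using K.conv_unique[OF W_conv[of "\<lambda>_. p" "Phi p"] K.conv_const[of "j p"]] p
    by (simp add: H.conv_const)
  ultimately show ?thesis using that by blast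
qed

section \<open>Finitely supported functions\<close>

text \<open>The linear functional on the free vector space that takes the values \<open>w\<close> on
  the basis.\<close>

definition lin :: "('a \<Rightarrow> complex) \<Rightarrow> ('a \<Rightarrow>\<^sub>0 complex) \<Rightarrow> complex" where
  "lin w p = (\<Sum>a\<in>Poly_Mapping.keys p. Poly_Mapping.lookup p a * w a)"

abbreviation pm_scale :: "complex \<Rightarrow> ('a \<Rightarrow>\<^sub>0 complex) \<Rightarrow> ('a \<Rightarrow>\<^sub>0 complex)" where
  "pm_scale c \<equiv> Poly_Mapping.map ((*) c)"

lemma lookup_pm_scale [simp]:
  "Poly_Mapping.lookup (pm_scale c p) a = c * Poly_Mapping.lookup p a"
  by (simp add: Poly_Mapping.map.rep_eq when_def)

lemma keys_pm_scale: "Poly_Mapping.keys (pm_scale c p) \<subseteq> Poly_Mapping.keys p"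
  by (auto simp: in_keys_iff)

lemma lin_superset:
  assumes "finite A" "Poly_Mapping.keys p \<subseteq> A"
  shows "lin w p = (\<Sum>a\<in>A. Poly_Mapping.lookup p a * w a)"
  unfolding lin_def using assms by (intro sum.mono_neutral_left) (auto simp: in_keys_iff)

lemma lin_add: "lin w (p + q) = lin w p + lin w q"
proof -
  let ?A = "Poly_Mapping.keys p \<union> Poly_Mapping.keys q"
  have "Poly_Mapping.keys (p + q) \<subseteq> ?A" by (rule Poly_Mapping.keys_add)
  then show ?thesis
    by (simp add: lin_superset[of ?A] lookup_add distrib_right sum.distrib)
qed

lemma lin_scale: "lin w (pm_scale c p) = c * lin w p"
  by (subst lin_superset[OF _ keys_pm_scale]) (simp_all add: lin_def sum_distrib_left mult.assoc)

lemma lin_zero [simp]: "lin w 0 = 0"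
  by (simp add: lin_def)

lemma lin_diff: "lin w (p - q) = lin w p - lin w q"
  using lin_add[of w "p - q" q] by simp

lemma lin_single [simp]: "lin w (Poly_Mapping.single a c) = c * w a"
  by (simp add: lin_superset[of "{a}"])

lemma lin_sum: "lin w (sum P A) = (\<Sum>a\<in>A. lin w (P a))"
  by (induction A rule: infinite_finite_induct) (simp_all add: lin_add)

lemma module_pm_scale: "module (pm_scale :: complex \<Rightarrow> ('a \<Rightarrow>\<^sub>0 complex) \<Rightarrow> _)"
  by unfold_locales (auto intro!: poly_mapping_eqI simp: lookup_add algebra_simps)

text \<open>The linear map of free spaces induced by a map of their bases; operators given on
  generators act on formal sums through it.\<close>

definition push :: "('a \<Rightarrow> 'b) \<Rightarrow> ('a \<Rightarrow>\<^sub>0 complex) \<Rightarrow> ('b \<Rightarrow>\<^sub>0 complex)" where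
  "push g p = (\<Sum>a\<in>Poly_Mapping.keys p. Poly_Mapping.single (g a) (Poly_Mapping.lookup p a))"

lemma lin_push: "lin w (push g p) = lin (\<lambda>a. w (g a)) p"
  by (simp add: push_def lin_sum) (simp add: lin_def)

text \<open>A coefficient is itself a value of a linear functional, so identities for
  \<open>push\<close> reduce to \<open>lin_push\<close>.\<close>

lemma lookup_lin: "Poly_Mapping.lookup p b = lin (\<lambda>a. if a = b then 1 else 0) p"
  by (simp add: lin_def in_keys_iff if_distrib cong: if_cong)

lemma push_add: "push g (p + q) = push g p + push g q"
  by (rule poly_mapping_eqI) (simp add: lookup_lin lin_push lin_add)

lemma push_scale: "push g (pm_scale c p) = pm_scale c (push g p)"
  by (rule poly_mapping_eqI) (simp add: lookup_lin[of "push _ _"] lin_push lin_scale)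

lemma push_single [simp]: "push g (Poly_Mapping.single a c) = Poly_Mapping.single (g a) c"
  by (simp add: push_def)

lemma push_ident: "push (\<lambda>a. a) p = p"
  by (rule poly_mapping_eqI) (simp add: lookup_lin lin_push)

lemma keys_push: "Poly_Mapping.keys (push g p) \<subseteq> g ` Poly_Mapping.keys p"
proof -
  have "Poly_Mapping.keys (push g p) \<subseteq>
      (\<Union>a\<in>Poly_Mapping.keys p. Poly_Mapping.keys (Poly_Mapping.single (g a) (Poly_Mapping.lookup p a)))"
    unfolding push_def by (rule Poly_Mapping.keys_sum)
  also have "\<dots> \<subseteq> g ` Poly_Mapping.keys p" by auto
  finally show ?thesis .
qed

text \<open>The sesquilinear extension of a kernel on the basis, conjugate-linear in
  \<open>p\<close>; the inner product of \<open>free_space\<close> is of this kind.\<close>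

definition kform :: "('a \<Rightarrow> 'a \<Rightarrow> complex) \<Rightarrow> ('a \<Rightarrow>\<^sub>0 complex) \<Rightarrow> ('a \<Rightarrow>\<^sub>0 complex) \<Rightarrow> complex" where
  "kform k p q = (\<Sum>a\<in>Poly_Mapping.keys p. \<Sum>b\<in>Poly_Mapping.keys q.
     cnj (Poly_Mapping.lookup p a) * Poly_Mapping.lookup q b * k a b)"

lemma kform_right: "kform k p q = (\<Sum>a\<in>Poly_Mapping.keys p. cnj (Poly_Mapping.lookup p a) * lin (k a) q)"
  by (simp add: kform_def lin_def sum_distrib_left mult.assoc)

lemma kform_left: "kform k p q = lin (\<lambda>b. cnj (lin (\<lambda>a. cnj (k a b)) p)) q"
  unfolding kform_def lin_def by (subst sum.swap) (simp add: sum_distrib_left mult_ac)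

lemma kform_add: "kform k p (q + q') = kform k p q + kform k p q'"
  by (simp add: kform_left lin_add)

lemma kform_scale: "kform k p (pm_scale c q) = c * kform k p q"
  by (simp add: kform_left lin_scale)

lemma kform_zero: "kform k p 0 = 0"
  by (simp add: kform_left)

lemma kform_push: "kform k (push g p) (push h q) = kform (\<lambda>a b. k (g a) (h b)) p q"
  by (simp add: kform_left lin_push)

lemma kform_cong:
  assumes "\<And>a b. \<lbrakk>a \<in> Poly_Mapping.keys p; b \<in> Poly_Mapping.keys q\<rbrakk> \<Longrightarrow> k a b = k' a b"
  shows "kform k p q = kform k' p q"
  unfolding kform_def using assms by (intro sum.cong refl) simp

lemma kform_commute:
  assumes "\<And>a b. \<lbrakk>a \<in> Poly_Mapping.keys p; b \<in> Poly_Mapping.keys q\<rbrakk> \<Longrightarrow> k a b = cnj (k b a)"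
  shows "kform k p q = cnj (kform k q p)"
proof -
  have "kform k p q = (\<Sum>a\<in>Poly_Mapping.keys p. \<Sum>b\<in>Poly_Mapping.keys q.
      cnj (cnj (Poly_Mapping.lookup q b) * Poly_Mapping.lookup p a * k b a))"
    unfolding kform_def using assms by (intro sum.cong refl) simp
  also have "\<dots> = cnj (kform k q p)" unfolding kform_def by (subst sum.swap) simp
  finally show ?thesis .
qed

text \<open>
  Boundedness without square roots: if \<open>a m\<close> stands for \<open>\<langle>\<xi>, R\<^sup>m \<xi>\<rangle>\<close> with \<open>R\<close> symmetric, then
  Cauchy-Schwarz bounds \<open>a 1 ^ 2\<^sup>n\<close> by \<open>a 0 ^ (2\<^sup>n - 1) * a (2\<^sup>n)\<close>, so that
  the exponential growth rate of \<open>a\<close> bounds \<open>a 1 / a 0\<close>.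
\<close>

lemma growth_rate_bound:
  fixes a :: "nat \<Rightarrow> real"
  assumes a0: "0 \<le> a 0" and double: "\<And>m. (a m)\<^sup>2 \<le> a 0 * a (2 * m)"
    and growth: "\<And>m. a m \<le> K * N ^ m" and N: "0 \<le> N"
  shows "a 1 \<le> N * a 0"
proof (cases "a 0 = 0")
  case True
  then show ?thesis using double[of 1] by simp
next
  case False
  then have a0: "0 < a 0" using a0 by simp
  show ?thesis
  proof (rule ccontr)
    assume "\<not> a 1 \<le> N * a 0"
    define b where "b = a 1 / a 0"
    have b: "N < b" using \<open>\<not> a 1 \<le> N * a 0\<close> a0 by (simp add: b_def field_simps)
    \<comment> \<open>Repeated doubling: squaring the lower bound at \<open>2 ^ n\<close> and
      applying \<open>double\<close> gives the bound at the next power, after one factor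
      \<open>a 0\<close> cancels.\<close>
    have pow: "a 0 * b ^ (2 ^ n) \<le> a (2 ^ n)" for n
    proof (induction n)
      case 0
      then show ?case using a0 by (simp add: b_def)
    next
      case (Suc n)
      have "0 \<le> a 0 * b ^ (2 ^ n)" using a0 b N by simp
      then have "(a 0 * b ^ (2 ^ n))\<^sup>2 \<le> (a (2 ^ n))\<^sup>2" using Suc by (intro power_mono)
      also have "\<dots> \<le> a 0 * a (2 ^ Suc n)" using double[of "2 ^ n"] by simp
      finally have "a 0 * (a 0 * b ^ (2 ^ Suc n)) \<le> a 0 * a (2 ^ Suc n)"
        by (simp add: power_mult_distrib power2_eq_square power_add[symmetric] mult_2 mult_ac)
      then show ?case using a0 by simp
    qed
    have le: "a 0 * b ^ (2 ^ n) \<le> K * N ^ (2 ^ n)" for n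
      using pow[of n] growth[of "2 ^ n"] by simp
    show False
    \<comment> \<open>For \<open>N = 0\<close> the instance \<open>n = 0\<close> of
      \<open>le\<close> contradicts the positivity of \<open>a 0 * b\<close>; otherwise the ratio
      \<open>b / N\<close> is available.\<close>
    proof (cases "N = 0")
      case True
      then show False using le[of 0] a0 b by (simp add: mult_le_0_iff)
    next
      case False
      then have N: "0 < N" using N by simp
      then have "1 < b / N" using b by simp
      then obtain n where n: "K / a 0 < (b / N) ^ n" using real_arch_pow by blast
      \<comment> \<open>The Archimedean property gives some exponent \<open>n\<close>; the exponent
        \<open>2 ^ n\<close> is at least as large.\<close>
      have "(b / N) ^ n \<le> (b / N) ^ (2 ^ n)"
        using \<open>1 < b / N\<close> by (intro power_increasing) (simp_all add: less_imp_le)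
      then have "K / a 0 < b ^ (2 ^ n) / N ^ (2 ^ n)" using n by (simp add: power_divide)
      then have "K * N ^ (2 ^ n) < a 0 * b ^ (2 ^ n)" using a0 N by (simp add: field_simps)
      then show False using le[of n] by simp
    qed
  qed
qed

section \<open>The standard form and the algebra it represents\<close>

lemma linear_mapD:
  assumes "linear_map H A K B f"
  shows "a \<in> A \<Longrightarrow> f a \<in> B"
    and "\<lbrakk>a \<in> A; b \<in> A\<rbrakk> \<Longrightarrow> f (op_add H H a b) = op_add K K (f a) (f b)"
    and "a \<in> A \<Longrightarrow> f (op_scale H H c a) = op_scale K K c (f a)"
  using assms by (auto simp: linear_map_def)

lemma unital_star_homD:
  assumes "unital_star_hom mul H A K B f"
  shows "linear_map H A K B f" and "f (op_id H) = op_id K"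
    and "\<lbrakk>a \<in> A; b \<in> A\<rbrakk> \<Longrightarrow> f (mul a b) = compose (carr K) (f a) (f b)"
    and "a \<in> A \<Longrightarrow> f (adj H H a) = adj K K (f a)"
  using assms by (auto simp: unital_star_hom_def)

section \<open>Right modules and their bounded module maps\<close>

locale right_mod =
  fixes s :: "'s vn_algebra" and X :: "('s, 'x, 'm) rmod_scheme"
  assumes right_module: "right_module s X"
begin

lemma hilbert_right [simp]: "hilbert_space X"
  using right_module by (simp add: right_module_def)

lemma ract_hom: "unital_star_hom (op_mult_rev (hspace s)) (hspace s) (ops s) X (bounded_ops X X) (ract X)"
  using right_module by (simp add: right_module_def)

lemma ract_bounded: "b \<in> ops s \<Longrightarrow> ract X b \<in> bounded_ops X X"
  by (rule linear_mapD(1)[OF unital_star_homD(1)[OF ract_hom]])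

lemma ract_in: "\<lbrakk>b \<in> ops s; x \<in> carr X\<rbrakk> \<Longrightarrow> ract X b x \<in> carr X"
  by (rule op_in[OF ract_bounded])

lemma ract_adj: "b \<in> ops s \<Longrightarrow> ract X (adj (hspace s) (hspace s) b) = adj X X (ract X b)"
  by (rule unital_star_homD(4)[OF ract_hom])

end

lemma rhomD:
  assumes "T \<in> rhom s X Y"
  shows "T \<in> bounded_ops X Y" and "\<lbrakk>b \<in> ops s; x \<in> carr X\<rbrakk> \<Longrightarrow> T (ract X b x) = ract Y b (T x)"
  using assms by (auto simp: rhom_def)

text \<open>Since the right action preserves adjoints, the relation of \<open>T\<close> with the
  adjoint of \<open>b\<close> transposes to the relation of \<open>adj X Y T\<close> with
  \<open>b\<close>.\<close>

lemma rhom_adj: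
  assumes X: "right_module s X" and Y: "right_module s Y" and T: "T \<in> rhom s X Y"
    and adj: "\<And>b. b \<in> ops s \<Longrightarrow> adj (hspace s) (hspace s) b \<in> ops s"
  shows "adj X Y T \<in> rhom s Y X"
proof -
  interpret X: right_mod s X by (rule right_mod.intro[OF X])
  interpret Y: right_mod s Y by (rule right_mod.intro[OF Y])
  note T' = rhomD[OF T]
  have "adj X Y T (ract Y b y) = ract X b (adj X Y T y)" if b: "b \<in> ops s" and y: "y \<in> carr Y" for b y
  proof (rule hilbert_space.vec_eqI[OF X.hilbert_right])
    note [simp] = T'(1) Y.ract_in[OF b] X.ract_in[OF b]
    show "adj X Y T (ract Y b y) \<in> carr X" "ract X b (adj X Y T y) \<in> carr X" using y by simp_all
    fix z assume z: "z \<in> carr X"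
    have z': "ract X (adj (hspace s) (hspace s) b) z \<in> carr X" by (rule X.ract_in[OF adj[OF b] z])
    have "hinner X z (adj X Y T (ract Y b y)) = hinner Y (T z) (ract Y b y)"
      using y z by (simp add: adj_right)
    also have "\<dots> = hinner Y (ract Y (adj (hspace s) (hspace s) b) (T z)) y"
      using y z by (simp add: Y.ract_adj[OF b] adj_left Y.ract_bounded[OF b] op_in[OF T'(1)])
    also have "\<dots> = hinner Y (T (ract X (adj (hspace s) (hspace s) b) z)) y"
      using T'(2)[OF adj[OF b] z] by simp
    also have "\<dots> = hinner X (ract X (adj (hspace s) (hspace s) b) z) (adj X Y T y)"
      using y z' by (simp add: adj_right)
    also have "\<dots> = hinner X z (ract X b (adj X Y T y))"
      using y z by (simp add: X.ract_adj[OF b] adj_left X.ract_bounded[OF b])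
    finally show "hinner X z (adj X Y T (ract Y b y)) = hinner X z (ract X b (adj X Y T y))" .
  qed
  then show ?thesis by (simp add: rhom_def T'(1))
qed

lemma rhom_compose:
  assumes X: "right_module s X" and Y: "right_module s Y"
    and S: "S \<in> rhom s Y Z" and T: "T \<in> rhom s X Y"
  shows "compose (carr X) S T \<in> rhom s X Z"
proof -
  interpret X: right_mod s X by (rule right_mod.intro[OF X])
  interpret Y: right_mod s Y by (rule right_mod.intro[OF Y])
  note S' = rhomD[OF S] and T' = rhomD[OF T]
  have "compose (carr X) S T \<in> bounded_ops X Z"
    by (rule compose_in[OF S'(1) T'(1)]) simp_all
  then show ?thesis
    by (simp add: rhom_def compose_eq X.ract_in T'(2) S'(2) op_in[OF T'(1)])
qed

lemma rhom_add:
  assumes X: "right_module s X" and Y: "right_module s Y"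
    and S: "S \<in> rhom s X Y" and T: "T \<in> rhom s X Y"
  shows "op_add X Y S T \<in> rhom s X Y"
proof -
  interpret X: right_mod s X by (rule right_mod.intro[OF X])
  interpret Y: right_mod s Y by (rule right_mod.intro[OF Y])
  note S' = rhomD[OF S] and T' = rhomD[OF T]
  show ?thesis
    by (simp add: rhom_def S'(1) T'(1) X.ract_in S'(2) T'(2) op_hadd[OF Y.ract_bounded]
        op_in[OF S'(1)] op_in[OF T'(1)])
qed

lemma rhom_scale:
  assumes X: "right_module s X" and Y: "right_module s Y" and T: "T \<in> rhom s X Y"
  shows "op_scale X Y c T \<in> rhom s X Y"
proof -
  interpret X: right_mod s X by (rule right_mod.intro[OF X])
  interpret Y: right_mod s Y by (rule right_mod.intro[OF Y])
  note T' = rhomD[OF T]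
  show ?thesis
    by (simp add: rhom_def T'(1) X.ract_in T'(2) op_hscale[OF Y.ract_bounded] op_in[OF T'(1)])
qed

lemma rhom_id:
  assumes X: "right_module s X"
  shows "op_id X \<in> rhom s X X"
proof -
  interpret X: right_mod s X by (rule right_mod.intro[OF X])
  show ?thesis by (simp add: rhom_def X.ract_in)
qed

section \<open>The standard form, module and bimodule of a Connes fusion\<close>

locale fusion_setting =
  fixes r :: "'r vn_algebra" and s :: "'s vn_algebra" and L :: "('r, 'r, 'l) bimod"
    and X :: "('r, 'x) rmod" and E :: "('r, 's, 'e) bimod"
  assumes vn_r: "von_neumann_algebra r"
    and std: "standard_form r L"
    and X_mod: "right_module r X"
    and E_bimod: "bimodule r s E"
begin

definition M :: "('l \<Rightarrow> 'l) set" where "M = lact L ` ops r"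

text \<open>f^* g is an operator on \<open>L\<close>, not an element of \<open>r\<close>. Reading
  the left action on \<open>E\<close> through the faithful action on \<open>L\<close> lets such
  operators act on \<open>E\<close>.\<close>

definition sigma :: "('l \<Rightarrow> 'l) \<Rightarrow> 'e \<Rightarrow> 'e" where
  "sigma m = lact E (the_inv_into (ops r) (lact L) m)"

lemma L_bimod: "bimodule r r L" and L_inj: "inj_on (lact L) (ops r)"
  using std by (simp_all add: standard_form_def)

lemma L_mod: "right_module r L" and E_mod: "right_module s E"
  using L_bimod E_bimod by (simp_all add: bimodule_def)

sublocale L: right_mod r L by (rule right_mod.intro[OF L_mod])
sublocale X: right_mod r X by (rule right_mod.intro[OF X_mod])
sublocale E: right_mod s E by (rule right_mod.intro[OF E_mod])

lemma adj_ops: "a \<in> ops r \<Longrightarrow> adj (hspace r) (hspace r) a \<in> ops r"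
  using vn_r by (simp add: von_neumann_algebra_def)

lemma lact_L_hom: "unital_star_hom (op_mult (hspace r)) (hspace r) (ops r) L (bounded_ops L L) (lact L)"
  using L_bimod by (simp add: bimodule_def)

lemma lact_E_hom: "unital_star_hom (op_mult (hspace r)) (hspace r) (ops r) E (bounded_ops E E) (lact E)"
  using E_bimod by (simp add: bimodule_def)

lemma lact_L_bounded: "a \<in> ops r \<Longrightarrow> lact L a \<in> bounded_ops L L"
  by (rule linear_mapD(1)[OF unital_star_homD(1)[OF lact_L_hom]])

lemma lact_E_bounded: "a \<in> ops r \<Longrightarrow> lact E a \<in> bounded_ops E E"
  by (rule linear_mapD(1)[OF unital_star_homD(1)[OF lact_E_hom]])

lemma lact_L_adj: "a \<in> ops r \<Longrightarrow> adj L L (lact L a) = lact L (adj (hspace r) (hspace r) a)"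
  by (rule unital_star_homD(4)[OF lact_L_hom, symmetric])

lemma lact_E_adj: "a \<in> ops r \<Longrightarrow> adj E E (lact E a) = lact E (adj (hspace r) (hspace r) a)"
  by (rule unital_star_homD(4)[OF lact_E_hom, symmetric])

lemma M_bounded: "m \<in> M \<Longrightarrow> m \<in> bounded_ops L L"
  by (auto simp: M_def lact_L_bounded)

text \<open>Both facts follow from J M J = M'. If \<open>T\<close> commutes with M', then J T J
  commutes with \<open>M\<close>, so it lies in M' = J M J, and hence \<open>T\<close> lies in
  \<open>M\<close>. For the second fact, the right action of \<open>r\<close> exhausts M'.\<close>

lemma standard_form_commutants:
  shows "commutant L (commutant L M) = M"
    and "\<lbrakk>T \<in> bounded_ops L L; \<And>b x. \<lbrakk>b \<in> ops r; x \<in> carr L\<rbrakk> \<Longrightarrow> T (ract L b x) = ract L b (T x)\<rbrakk> \<Longrightarrow> T \<in> M"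
proof -
  define conj where "conj J a = compose (carr L) J (compose (carr L) a J)"
    for J a :: "'l \<Rightarrow> 'l"
  obtain J where J: "J \<in> carr L \<rightarrow>\<^sub>E carr L"
    and J_add: "\<forall>x\<in>carr L. \<forall>y\<in>carr L. J (hadd L x y) = hadd L (J x) (J y)"
    and J_scale: "\<forall>c. \<forall>x\<in>carr L. J (hscale L c x) = hscale L (cnj c) (J x)"
    and J_inner: "\<forall>x\<in>carr L. \<forall>y\<in>carr L. hinner L (J x) (J y) = hinner L y x"
    and J_J: "\<forall>x\<in>carr L. J (J x) = x"
    and conj_M: "conj J ` M = commutant L M"
    and ract: "\<forall>a\<in>ops r. ract L a = conj J (adj L L (lact L a))"
    using std unfolding standard_form_def Let_def M_def[symmetric] conj_def[symmetric]
    by (elim conjE exE) (rule that; assumption)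
  have J_in [simp]: "J x \<in> carr L" if "x \<in> carr L" for x using J that by auto
  have conj_apply: "conj J a x = J (a (J x))" if "x \<in> carr L" for a x
    using that by (simp add: conj_def compose_eq)
  have J_norm: "hnorm L (J x) = hnorm L x" if "x \<in> carr L" for x
    using that J_inner by (simp add: hnorm_def)
  have conj_bounded: "conj J T \<in> bounded_ops L L" if T: "T \<in> bounded_ops L L" for T
  proof -
    note [simp] = op_in[OF T] op_hadd[OF T] op_hscale[OF T]
    obtain C where C: "\<And>x. x \<in> carr L \<Longrightarrow> hnorm L (T x) \<le> C * hnorm L x"
      using op_bound[OF T hilbert_semi_inner[OF L.hilbert_right]] by blast
    show ?thesis
    proof (rule bounded_opsI)
      show "conj J T \<in> extensional (carr L)" by (simp add: conj_def)
      show "hnorm L (conj J T x) \<le> C * hnorm L x" if "x \<in> carr L" for x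
        using that C[of "J x"] by (simp add: conj_apply J_norm)
    qed (simp_all add: conj_apply J_add J_scale)
  qed
  have conj_conj: "conj J (conj J T) = T" if T: "T \<in> bounded_ops L L" for T
    by (rule op_eqI[of _ L L]) (simp_all add: conj_bounded T conj_apply J_J op_in[OF T])
  have M'D: "S (m x) = m (S x)" if "S \<in> commutant L M" "m \<in> M" "x \<in> carr L" for S m x
    using that by (auto simp: commutant_def fun_eq_iff compose_def split: if_splits)
  have bicomm: "T \<in> M" if T: "T \<in> bounded_ops L L"
    and comm: "\<And>S x. \<lbrakk>S \<in> commutant L M; x \<in> carr L\<rbrakk> \<Longrightarrow> T (S x) = S (T x)" for T
  proof -
    \<comment> \<open>Commuting with J m J for \<open>m\<close> in \<open>M\<close> becomes, after
      conjugation by \<open>J\<close>, commuting of J T J with \<open>m\<close>.\<close>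
    have "conj J T \<in> commutant L M"
      unfolding commutant_def
    proof (intro CollectI conjI ballI)
      show "conj J T \<in> bounded_ops L L" by (rule conj_bounded[OF T])
      fix m assume m: "m \<in> M"
      note mb = M_bounded[OF m]
      have "conj J m \<in> commutant L M" using conj_M m by blast
      then have "T (conj J m x) = conj J m (T x)" if "x \<in> carr L" for x using comm that by blast
      then have *: "T (J (m (J x))) = J (m (J (T x)))" if "x \<in> carr L" for x
        using that by (simp add: conj_apply op_in[OF T])
      have "conj J T (m x) = m (conj J T x)" if x: "x \<in> carr L" for x
        using *[of "J x"] x by (simp add: conj_apply J_J op_in[OF mb] op_in[OF T])
      then show "compose (carr L) (conj J T) m = compose (carr L) m (conj J T)"
        by (auto simp: compose_def)
    qed
    then obtain m where m: "m \<in> M" "conj J T = conj J m" using conj_M by auto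
    then have "T = m" using conj_conj[OF T] conj_conj[OF M_bounded[OF m(1)]] by metis
    then show "T \<in> M" using m by simp
  qed
  show "commutant L (commutant L M) = M"
  proof
    show "M \<subseteq> commutant L (commutant L M)"
      using M'D M_bounded by (auto simp: commutant_def[of L "commutant L M"] compose_def)
    show "commutant L (commutant L M) \<subseteq> M"
    proof
      fix T assume T: "T \<in> commutant L (commutant L M)"
      show "T \<in> M"
      proof (rule bicomm)
        show "T \<in> bounded_ops L L" using T by (simp add: commutant_def)
        fix S x assume S: "S \<in> commutant L M" and x: "x \<in> carr L"
        have "compose (carr L) T S = compose (carr L) S T" using T S by (simp add: commutant_def)
        from fun_cong[OF this, of x] x show "T (S x) = S (T x)" by (simp add: compose_eq)
      qed
    qed
  qed
  show "T \<in> M" if T: "T \<in> bounded_ops L L"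
    and comm: "\<And>b x. \<lbrakk>b \<in> ops r; x \<in> carr L\<rbrakk> \<Longrightarrow> T (ract L b x) = ract L b (T x)"
  proof (rule bicomm[OF T])
    fix S x assume "S \<in> commutant L M" and x: "x \<in> carr L"
    then obtain a where a: "a \<in> ops r" "S = conj J (lact L a)" using conj_M by (auto simp: M_def)
    \<comment> \<open>The standard form defines the right action of \<open>a\<close> by J a^* J;
      acting by the adjoint of \<open>a\<close> therefore yields J a J, which is
      \<open>S\<close>.\<close>
    have "ract L (adj (hspace r) (hspace r) a) = conj J (adj L L (adj L L (lact L a)))"
      using ract adj_ops[OF a(1)] a(1) by (simp add: lact_L_adj)
    also have "\<dots> = S" using a by (simp add: adj_adj lact_L_bounded)
    finally show "T (S x) = S (T x)" using comm[OF adj_ops[OF a(1)] x] by simp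
  qed
qed

text \<open>
  A von Neumann algebra is represented on its own Hilbert space by the identity, which provides the
  closure properties of \<^term>\<open>ops r\<close>.
\<close>

sublocale A: star_rep "hspace r" "hspace r" "ops r" "\<lambda>a. a"
proof (intro star_rep.intro star_rep_axioms.intro)
  show "hilbert_space (hspace r)" "hilbert_space (hspace r)"
    using vn_r by (simp_all add: von_neumann_algebra_def)
qed (use vn_r in \<open>auto simp: von_neumann_algebra_def\<close>)

lemma sigma_lact: "a \<in> ops r \<Longrightarrow> sigma (lact L a) = lact E a"
  by (simp add: sigma_def the_inv_into_f_f[OF L_inj])

sublocale star_rep L E M sigma
proof (intro star_rep.intro star_rep_axioms.intro L.hilbert_right E.hilbert_right)
  note hL = unital_star_homD[OF lact_L_hom] linear_mapD[OF unital_star_homD(1)[OF lact_L_hom]]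
  note hE = unital_star_homD[OF lact_E_hom] linear_mapD[OF unital_star_homD(1)[OF lact_E_hom]]
  show "commutant L (commutant L M) = M" by (rule standard_form_commutants)
  have "lact L (op_id (hspace r)) = op_id L" by (rule hL)
  then show "sigma (op_id L) = op_id E" using sigma_lact[OF A.M_id] hE(2) by simp
  fix m assume "m \<in> M"
  then obtain a where a: "a \<in> ops r" "m = lact L a" by (auto simp: M_def)
  show "m \<in> bounded_ops L L" using a by (simp add: lact_L_bounded)
  show "adj L L m \<in> M" using a by (simp add: lact_L_adj M_def adj_ops)
  show "sigma m \<in> bounded_ops E E" using a by (simp add: sigma_lact lact_E_bounded)
  show "sigma (adj L L m) = adj E E (sigma m)"
    using a by (simp add: lact_L_adj sigma_lact adj_ops lact_E_adj)
  show "sigma (op_scale L L c m) = op_scale E E c (sigma m)" for c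
    using sigma_lact[OF A.M_scale[OF a(1)], of c] hL(7)[OF a(1)] hE(7)[OF a(1)] a
    by (simp add: sigma_lact)
  fix n assume "n \<in> M"
  then obtain b where b: "b \<in> ops r" "n = lact L b" by (auto simp: M_def)
  show "sigma (op_add L L m n) = op_add E E (sigma m) (sigma n)"
    using sigma_lact[OF A.M_add[OF a(1) b(1)]] hL(6)[OF a(1) b(1)] hE(6)[OF a(1) b(1)] a b
    by (simp add: sigma_lact)
  show "sigma (compose (carr L) m n) = compose (carr E) (sigma m) (sigma n)"
    using sigma_lact[OF A.M_mult[OF a(1) b(1)]] hL(3)[OF a(1) b(1)] hE(3)[OF a(1) b(1)] a b
    by (simp add: sigma_lact)
qed

abbreviation "F \<equiv> rhom r L X"

lemma lact_rhom: "b \<in> ops r \<Longrightarrow> lact L b \<in> rhom r L L"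
proof -
  assume b: "b \<in> ops r"
  have "lact L b (ract L c x) = ract L c (lact L b x)" if c: "c \<in> ops r" and x: "x \<in> carr L" for c x
  proof -
    have "compose (carr L) (lact L b) (ract L c) = compose (carr L) (ract L c) (lact L b)"
      using L_bimod b c by (simp add: bimodule_def)
    from fun_cong[OF this, of x] x show ?thesis by (simp add: compose_eq)
  qed
  then show ?thesis using lact_L_bounded[OF b] by (simp add: rhom_def)
qed

sublocale module_rep L E M sigma X F
proof (intro module_rep.intro module_rep_axioms.intro star_rep_axioms X.hilbert_right)
  fix f assume f: "f \<in> F"
  show "f \<in> bounded_ops L X" by (rule rhomD(1)[OF f])
  show "op_scale L X c f \<in> F" for c by (rule rhom_scale[OF L_mod X_mod f])
  show "op_add L X f g \<in> F" if "g \<in> F" for g by (rule rhom_add[OF L_mod X_mod f that])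
  \<comment> \<open>This operator is right \<open>r\<close>-linear on \<open>L\<close>, so the
    second standard-form fact places it in \<open>M\<close>: the isomorphism behind the fusion
    form.\<close>
  show "compose (carr L) (adj L X f) g \<in> M" if g: "g \<in> F" for g
  proof -
    have "compose (carr L) (adj L X f) g \<in> rhom r L L"
      by (rule rhom_compose[OF L_mod X_mod rhom_adj[OF L_mod X_mod f adj_ops] g])
    from rhomD[OF this] show ?thesis by (rule standard_form_commutants(2))
  qed
  show "compose (carr L) f m \<in> F" if "m \<in> M" for m
    using that rhom_compose[OF L_mod L_mod f lact_rhom] by (auto simp: M_def)
qed

subsection \<open>The fusion space\<close>

abbreviation "D \<equiv> F \<times> carr E"
abbreviation "FS \<equiv> free_space r L X E"
abbreviation "H \<equiv> fusion_space r L X E"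

lemma fusion_form_ip: "fusion_form r L X E (f, y) (g, z) = hinner E y (ip f g z)"
  by (simp add: fusion_form_def ip_def sigma_def)

lemma fusion_form_commute:
  "\<lbrakk>a \<in> D; b \<in> D\<rbrakk> \<Longrightarrow> fusion_form r L X E a b = cnj (fusion_form r L X E b a)"
  by (cases a; cases b) (simp add: fusion_form_ip ip_adj E.hinner_commute[symmetric])

lemma free_space_simps [simp]:
  "carr FS = {p. Poly_Mapping.keys p \<subseteq> D}" "hzero FS = 0" "hadd FS = (+)"
  "hscale FS = pm_scale" "hinner FS = kform (fusion_form r L X E)"
  by (simp_all add: free_space_def kform_def fun_eq_iff)

lemma kform_fusion_commute:
  "\<lbrakk>Poly_Mapping.keys p \<subseteq> D; Poly_Mapping.keys q \<subseteq> D\<rbrakk> \<Longrightarrow>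
    kform (fusion_form r L X E) p q = cnj (kform (fusion_form r L X E) q p)"
  by (intro kform_commute fusion_form_commute) auto

text \<open>Absorbing each coefficient into its vector of \<open>E\<close> gives the sum treated in
  \<open>gram_nonneg\<close>; conjugate symmetry removes the imaginary part.\<close>

lemma kform_fusion_nonneg:
  assumes p: "Poly_Mapping.keys p \<subseteq> D"
  shows "kform (fusion_form r L X E) p p \<in> \<real>\<^sub>\<ge>\<^sub>0"
proof -
  have "kform (fusion_form r L X E) p p = (\<Sum>a\<in>Poly_Mapping.keys p. \<Sum>b\<in>Poly_Mapping.keys p.
      hinner E (hscale E (Poly_Mapping.lookup p a) (snd a))
        (ip (fst a) (fst b) (hscale E (Poly_Mapping.lookup p b) (snd b))))"
    unfolding kform_def
  proof (intro sum.cong refl)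
    fix a b assume "a \<in> Poly_Mapping.keys p" "b \<in> Poly_Mapping.keys p"
    then have ab: "fst a \<in> F" "snd a \<in> carr E" "fst b \<in> F" "snd b \<in> carr E" using p by auto
    show "cnj (Poly_Mapping.lookup p a) * Poly_Mapping.lookup p b * fusion_form r L X E a b =
      hinner E (hscale E (Poly_Mapping.lookup p a) (snd a))
        (ip (fst a) (fst b) (hscale E (Poly_Mapping.lookup p b) (snd b)))"
      using ab fusion_form_ip[of "fst a" "snd a" "fst b" "snd b"]
      by (simp add: op_hscale[OF ip_in])
  qed
  also have "0 \<le> Re \<dots>"
    using p by (intro gram_nonneg) auto
  finally have "0 \<le> Re (kform (fusion_form r L X E) p p)" .
  moreover have "Im (kform (fusion_form r L X E) p p) = 0"
    using kform_fusion_commute[OF p p] by (simp add: complex_eq_iff)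
  ultimately show ?thesis by (simp add: complex_nonneg_Reals_iff)
qed

sublocale FS: semi_inner_space FS
proof
  fix x y assume "x \<in> carr FS" "y \<in> carr FS"
  then show "hadd FS x y \<in> carr FS"
    using Poly_Mapping.keys_add[of x y] by auto
  show "hinner FS x y = cnj (hinner FS y x)"
    using kform_fusion_commute[of x y] \<open>x \<in> carr FS\<close> \<open>y \<in> carr FS\<close> by simp
next
  fix x c assume "x \<in> carr FS"
  then show "hscale FS c x \<in> carr FS" using keys_pm_scale[of c x] by auto
  from \<open>x \<in> carr FS\<close> show "hinner FS x x \<in> \<real>\<^sub>\<ge>\<^sub>0" by (simp add: kform_fusion_nonneg)
qed (auto intro!: poly_mapping_eqI simp: lookup_add algebra_simps kform_add kform_scale)

interpretation pm: module pm_scale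
  by (rule module_pm_scale)

lemma free_tens_relations:
  assumes a: "a \<in> D" and t: "t \<in> tensor_relations r L X E"
  shows "lin (fusion_form r L X E a) t = 0"
proof -
  obtain g z where g: "a = (g, z)" "g \<in> F" "z \<in> carr E" using a by auto
  show ?thesis
    using t unfolding tensor_relations_def
    by (elim UnE; clarsimp simp: g lin_diff fusion_form_ip ip_add_right ip_scale_right
        op_hadd[OF ip_in] op_hscale[OF ip_in] ip_mult_right M_def sigma_lact op_in[OF lact_E_bounded])
qed

text \<open>Each tensor relation is annihilated in the second variable, and the annihilated elements
  form a subspace. Thus the form descends to the algebraic tensor product.\<close>

lemma kform_span:
  assumes b: "Poly_Mapping.keys b \<subseteq> D" and p: "p \<in> module.span pm_scale (tensor_relations r L X E)"
  shows "kform (fusion_form r L X E) b p = 0"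
proof -
  have "pm.subspace {p. kform (fusion_form r L X E) b p = 0}"
    by (auto simp: pm.subspace_def kform_add kform_scale kform_zero)
  moreover have "tensor_relations r L X E \<subseteq> {p. kform (fusion_form r L X E) b p = 0}"
    using b by (auto simp: kform_right free_tens_relations subset_iff intro!: sum.neutral)
  ultimately show ?thesis using pm.span_minimal p by blast
qed

sublocale Q: quotient_semi_inner FS "tensor_rel r L X E"
proof (intro quotient_semi_inner.intro quotient_semi_inner_axioms.intro FS.semi_inner_space_axioms)
  let ?N = "module.span pm_scale (tensor_relations r L X E)"
  have R: "(p, q) \<in> tensor_rel r L X E \<longleftrightarrow> p \<in> carr FS \<and> q \<in> carr FS \<and> p - q \<in> ?N" for p q
    by (simp add: tensor_rel_def)
  show "equiv (carr FS) (tensor_rel r L X E)"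
  proof (rule equivI)
    show "tensor_rel r L X E \<subseteq> carr FS \<times> carr FS" by (auto simp: R)
    show "refl_on (carr FS) (tensor_rel r L X E)" by (auto simp: refl_on_def R pm.span_zero)
    show "sym (tensor_rel r L X E)"
    proof (rule symI)
      fix p q assume "(p, q) \<in> tensor_rel r L X E"
      then show "(q, p) \<in> tensor_rel r L X E" using pm.span_neg[of "p - q"] by (simp add: R)
    qed
    show "trans (tensor_rel r L X E)"
    proof (rule transI)
      fix p q t assume "(p, q) \<in> tensor_rel r L X E" "(q, t) \<in> tensor_rel r L X E"
      then show "(p, t) \<in> tensor_rel r L X E"
        using pm.span_add[of "p - q" _ "q - t"] by (simp add: R)
    qed
  qed
  fix p p' assume p: "(p, p') \<in> tensor_rel r L X E"
  show "(hscale FS c p, hscale FS c p') \<in> tensor_rel r L X E" for c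
    using p pm.span_scale[of "p - p'" _ c] FS.scale_in[of p c] FS.scale_in[of p' c]
    unfolding R by (simp add: pm.scale_right_diff_distrib)
  fix q q' assume q: "(q, q') \<in> tensor_rel r L X E"
  show "(hadd FS p q, hadd FS p' q') \<in> tensor_rel r L X E"
    using p q pm.span_add[of "p - p'" _ "q - q'"] FS.add_in[of p q] FS.add_in[of p' q']
    unfolding R by (simp add: algebra_simps)
  have diff: "kform (fusion_form r L X E) a b = kform (fusion_form r L X E) a b'"
    if "a \<in> carr FS" "(b, b') \<in> tensor_rel r L X E" for a b b'
    using kform_span[of a "b - b'"] kform_add[of _ a "b - b'" b'] that by (simp add: R)
  \<comment> \<open>\<open>diff\<close> changes the second argument; conjugate symmetry carries this
    over to the first.\<close>
  have "kform (fusion_form r L X E) p q = kform (fusion_form r L X E) p q'"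
    using p q by (intro diff) (simp_all add: R)
  also have "\<dots> = cnj (kform (fusion_form r L X E) q' p)"
    using p q by (intro kform_fusion_commute) (simp_all add: R)
  also have "kform (fusion_form r L X E) q' p = kform (fusion_form r L X E) q' p'"
    using p q by (intro diff) (simp_all add: R)
  also have "cnj \<dots> = kform (fusion_form r L X E) p' q'"
    using p q by (intro kform_fusion_commute[symmetric]) (simp_all add: R)
  finally show "hinner FS p q = hinner FS p' q'" by simp
qed

sublocale T: completion_of "alg_tensor r L X E"
  unfolding alg_tensor_def by (rule completion_of.intro[OF Q.semi_inner_quotient])

sublocale H: hilbert_space H
  unfolding fusion_space_def by (rule T.hilbert_completion)

lemma hilbert_H [simp]: "hilbert_space H"
  by (rule H.hilbert_space_axioms)

text \<open>The canonical map from formal sums to the fusion space, along which operators are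
  constructed and checked.\<close>

definition Phi :: "((('l \<Rightarrow> 'x) \<times> 'e) \<Rightarrow>\<^sub>0 complex) \<Rightarrow> ('l, 'x, 'e) fusion_pt" where
  "Phi p = T.emb (Q.cls p)"

lemma cls_in_alg: "p \<in> carr FS \<Longrightarrow> Q.cls p \<in> carr (alg_tensor r L X E)"
  unfolding alg_tensor_def by (rule Q.cls_in)

lemma Phi_in: "p \<in> carr FS \<Longrightarrow> Phi p \<in> carr H"
  unfolding Phi_def fusion_space_def by (intro T.emb_in cls_in_alg)

lemma Phi_add: "\<lbrakk>p \<in> carr FS; q \<in> carr FS\<rbrakk> \<Longrightarrow> Phi (p + q) = hadd H (Phi p) (Phi q)"
  using T.emb_add[OF cls_in_alg[of p] cls_in_alg[of q]] Q.Q_add[of p q]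
  by (simp add: Phi_def fusion_space_def alg_tensor_def)

lemma Phi_scale: "p \<in> carr FS \<Longrightarrow> Phi (pm_scale c p) = hscale H c (Phi p)"
  using T.emb_scale[OF cls_in_alg[of p], of c] Q.Q_scale[of p c]
  by (simp add: Phi_def fusion_space_def alg_tensor_def)

lemma Phi_inner: "\<lbrakk>p \<in> carr FS; q \<in> carr FS\<rbrakk> \<Longrightarrow>
    hinner H (Phi p) (Phi q) = kform (fusion_form r L X E) p q"
  using T.emb_inner[OF cls_in_alg[of p] cls_in_alg[of q]] Q.Q_inner[of p q]
  by (simp add: Phi_def fusion_space_def alg_tensor_def)

lemma Phi_dense:
  assumes "x \<in> carr H"
  shows "\<exists>u. (\<forall>n. u n \<in> carr FS) \<and> H.conv (\<lambda>n. Phi (u n)) x"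
proof -
  obtain v where v: "\<And>n. v n \<in> carr (alg_tensor r L X E)" "H.conv (\<lambda>n. T.emb (v n)) x"
    using T.emb_dense[of x] assms unfolding fusion_space_def by blast
  have "\<exists>p. p \<in> carr FS \<and> v n = Q.cls p" for n
    by (rule Q.Q_cases[OF v(1)[of n, unfolded alg_tensor_def]]) auto
  then obtain u where "\<forall>n. u n \<in> carr FS \<and> v n = Q.cls (u n)" by metis
  then show ?thesis using v(2) by (auto simp: Phi_def intro!: exI[of _ u])
qed

abbreviation "tn \<equiv> tens r L X E"

lemma tens_Phi: "tn f y = Phi (free_tens f y)"
  by (simp add: tens_def Phi_def T.emb_def)

lemma free_tens_in: "\<lbrakk>f \<in> F; y \<in> carr E\<rbrakk> \<Longrightarrow> Poly_Mapping.single (f, y) c \<in> carr FS"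
  by (auto split: if_splits)

lemma tens_in [simp]: "\<lbrakk>f \<in> F; y \<in> carr E\<rbrakk> \<Longrightarrow> tn f y \<in> carr H"
  unfolding tens_Phi by (intro Phi_in free_tens_in)

lemma tens_inner: "\<lbrakk>f \<in> F; y \<in> carr E; g \<in> F; z \<in> carr E\<rbrakk> \<Longrightarrow>
    hinner H (tn f y) (tn g z) = hinner E y (ip f g z)"
  unfolding tens_Phi by (simp add: Phi_inner[OF free_tens_in free_tens_in] kform_right fusion_form_ip)

text \<open>Simple tensors span the range of \<open>Phi\<close>, which is dense; orthogonality
  passes to the limit and gives \<open>hinner H x x = 0\<close>.\<close>

lemma tens_total:
  assumes x: "x \<in> carr H" and orth: "\<And>f y. \<lbrakk>f \<in> F; y \<in> carr E\<rbrakk> \<Longrightarrow> hinner H (tn f y) x = 0"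
  shows "x = hzero H"
proof -
  have single: "hinner H (Phi (Poly_Mapping.single a c)) x = 0" if "a \<in> D" for a c
  proof -
    from that obtain f y where a: "a = (f, y)" "f \<in> F" "y \<in> carr E" by auto
    have "Poly_Mapping.single a c = pm_scale c (free_tens f y)"
      by (rule poly_mapping_eqI) (simp add: a lookup_single when_def)
    then have "Phi (Poly_Mapping.single a c) = hscale H c (tn f y)"
      using Phi_scale[OF free_tens_in[OF a(2,3)], where c = c] by (simp add: tens_Phi a) (metis mult_1_right)
    then show ?thesis using x a orth by simp
  qed
  have zero: "hinner H (Phi 0) x = 0"
  proof -
    have "pm_scale 0 0 = (0 :: (('l \<Rightarrow> 'x) \<times> 'e) \<Rightarrow>\<^sub>0 complex)" by (rule poly_mapping_eqI) simp
    then have "Phi 0 = hscale H 0 (Phi 0)" using Phi_scale[of 0 0] by simp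
    moreover have "hinner H (hscale H 0 (Phi 0)) x = 0"
      using x Phi_in[of 0] by simp
    ultimately show ?thesis by simp
  qed
  have sum: "sum P A \<in> carr FS \<and> hinner H (Phi (sum P A)) x = 0"
    if "finite A" "\<And>a. a \<in> A \<Longrightarrow> P a \<in> carr FS \<and> hinner H (Phi (P a)) x = 0"
    for P :: "('l \<Rightarrow> 'x) \<times> 'e \<Rightarrow> (('l \<Rightarrow> 'x) \<times> 'e) \<Rightarrow>\<^sub>0 complex" and A
    using that
  proof (induction A rule: finite_induct)
    case empty
    then show ?case using zero by simp
  next
    case (insert a A)
    then have *: "P a \<in> carr FS" "sum P A \<in> carr FS" by auto
    then have "P a + sum P A \<in> carr FS" using FS.add_in by fastforce
    then show ?case using insert x * by (simp add: Phi_add Phi_in del: free_space_simps(1))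
  qed
  have Phi0: "hinner H (Phi p) x = 0" if p: "p \<in> carr FS" for p
  proof -
    \<comment> \<open>Pushing along the identity rewrites \<open>p\<close> as the sum of its
      one-term parts, to which \<open>sum\<close> applies.\<close>
    have "push (\<lambda>a. a) p \<in> carr FS \<and> hinner H (Phi (push (\<lambda>a. a) p)) x = 0"
      unfolding push_def
    proof (rule sum, simp)
      fix a assume "a \<in> Poly_Mapping.keys p"
      then have "a \<in> D" using p by auto
      then show "Poly_Mapping.single a (Poly_Mapping.lookup p a) \<in> carr FS \<and>
          hinner H (Phi (Poly_Mapping.single a (Poly_Mapping.lookup p a))) x = 0"
        using single free_tens_in by (cases a) simp
    qed
    then show ?thesis by (simp add: push_ident)
  qed
  obtain u where u: "\<forall>n. u n \<in> carr FS" "H.conv (\<lambda>n. Phi (u n)) x" using Phi_dense[OF x] by blast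
  have "(\<lambda>n. hinner H (Phi (u n)) x) \<longlonglongrightarrow> hinner H x x"
    by (rule H.conv_hinner[OF u(2) H.conv_const[OF x]])
  then have "hinner H x x = 0" using Phi0 u(1) by (simp add: LIMSEQ_const_iff)
  then show ?thesis using x H.inner_definite by blast
qed

lemma tens_eqI:
  assumes "x \<in> carr H" "x' \<in> carr H"
    and "\<And>f y. \<lbrakk>f \<in> F; y \<in> carr E\<rbrakk> \<Longrightarrow> hinner H (tn f y) x = hinner H (tn f y) x'"
  shows "x = x'"
proof -
  have "hdiff H x x' = hzero H" using assms by (intro tens_total) simp_all
  then show ?thesis using H.hdiff_eq_0[of x x'] assms by (simp add: H.hnorm_zero)
qed

text \<open>The adjoints of \<open>W\<close> and \<open>W'\<close> map each \<open>k\<close> to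
  vectors with equal inner products against all simple tensors, so \<open>tens_eqI\<close>
  identifies the adjoints first.\<close>

lemma op_eq_on_tens:
  assumes K: "hilbert_space K" and W: "W \<in> bounded_ops H K" and W': "W' \<in> bounded_ops H K"
    and eq: "\<And>f y. \<lbrakk>f \<in> F; y \<in> carr E\<rbrakk> \<Longrightarrow> W (tn f y) = W' (tn f y)"
  shows "W = W'"
proof (rule op_eqI[OF W W'])
  fix x assume x: "x \<in> carr H"
  note [simp] = K W W' op_in[OF W] op_in[OF W']
  show "W x = W' x"
  proof (rule hilbert_space.vec_eqI[OF K])
    fix k assume k: "k \<in> carr K"
    have "adj H K W k = adj H K W' k"
      using k eq by (intro tens_eqI) (simp_all add: adj_right)
    then show "hinner K k (W x) = hinner K k (W' x)" using k x by (metis adj_left K W W' hilbert_H)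
  qed (use x in simp_all)
qed

lemma ip_bound:
  assumes f: "f \<in> F" and g: "g \<in> F"
  obtains C where "0 < C" "\<And>y. y \<in> carr E \<Longrightarrow> hnorm E (ip f g y) \<le> C * hnorm E y"
  using op_bound[OF ip_in[OF f g]] by auto

text \<open>The squared norm of \<open>tn g y\<close> is \<open>hinner E y (ip g g y)\<close>, so
  boundedness is that of \<open>ip g g\<close>. The adjoint of this map slices vectors of the fusion
  space down to \<open>E\<close> in \<open>hom_imp_unitary\<close>.\<close>

lemma theta_bounded:
  assumes g: "g \<in> F"
  shows "(\<lambda>y\<in>carr E. tn g y) \<in> bounded_ops E H"
proof -
  obtain C where C: "0 < C" "\<And>y. y \<in> carr E \<Longrightarrow> hnorm E (ip g g y) \<le> C * hnorm E y"
    using ip_bound[OF g g] by blast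
  show ?thesis
  proof (rule restrict_bounded_opsI)
    fix y assume y: "y \<in> carr E"
    have "(hnorm H (tn g y))\<^sup>2 = Re (hinner E y (ip g g y))"
      using g y by (simp add: H.hnorm_sq tens_inner)
    also have "\<dots> \<le> hnorm E y * hnorm E (ip g g y)"
      using order_trans[OF complex_Re_le_cmod E.Cauchy_Schwarz[of y "ip g g y"]] y g by simp
    also have "\<dots> \<le> hnorm E y * (C * hnorm E y)"
      using C y by (intro mult_left_mono) (auto simp: E.hnorm_nonneg)
    also have "\<dots> = (sqrt C * hnorm E y)\<^sup>2" using C by (simp add: power_mult_distrib power2_eq_square mult_ac)
    finally show "hnorm H (tn g y) \<le> sqrt C * hnorm E y"
      by (rule power2_le_imp_le) (use C y in \<open>simp add: E.hnorm_nonneg\<close>)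
  qed (simp_all add: g, (rule tens_eqI; simp add: g tens_inner op_hadd[OF ip_in] op_hscale[OF ip_in])+)
qed

lemma tens_add: "\<lbrakk>g \<in> F; y \<in> carr E; z \<in> carr E\<rbrakk> \<Longrightarrow> tn g (hadd E y z) = hadd H (tn g y) (tn g z)"
  using op_hadd[OF theta_bounded, of g y z] by simp

lemma tens_scale: "\<lbrakk>g \<in> F; y \<in> carr E\<rbrakk> \<Longrightarrow> tn g (hscale E c y) = hscale H c (tn g y)"
  using op_hscale[OF theta_bounded, of g y c] by simp

lemma tens_mult: "\<lbrakk>f \<in> F; m \<in> M; y \<in> carr E\<rbrakk> \<Longrightarrow> tn (compose (carr L) f m) y = tn f (sigma m y)"
  by (rule tens_eqI) (simp_all add: F_mult tens_inner ip_mult_right)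

subsection \<open>Fusion of operators\<close>

text \<open>The admissible right factors of \<open>fuse_map\<close>. Bimodule maps would not do:
  \<open>ract E b\<close> commutes with the left action but in general not with the right
  one.\<close>

definition lhom :: "('e \<Rightarrow> 'e) set" where
  "lhom = {S \<in> bounded_ops E E. \<forall>a\<in>ops r. \<forall>y\<in>carr E. S (lact E a y) = lact E a (S y)}"

lemma lhomD:
  assumes "S \<in> lhom"
  shows "S \<in> bounded_ops E E" and "\<lbrakk>m \<in> M; y \<in> carr E\<rbrakk> \<Longrightarrow> S (sigma m y) = sigma m (S y)"
  using assms by (auto simp: lhom_def M_def sigma_lact)

lemma lhom_id: "op_id E \<in> lhom"
  by (simp add: lhom_def op_in[OF lact_E_bounded])

lemma lhom_adj:
  assumes S: "S \<in> lhom"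
  shows "adj E E S \<in> lhom"
proof -
  note S' = lhomD[OF S]
  note [simp] = S'(1) op_in[OF S'(1)] op_in[OF lact_E_bounded]
  have "adj E E S (lact E a y) = lact E a (adj E E S y)" if a: "a \<in> ops r" and y: "y \<in> carr E" for a y
  proof (rule E.vec_eqI)
    let ?a = "adj (hspace r) (hspace r) a"
    have a': "?a \<in> ops r" using a by (rule adj_ops)
    fix z assume z: "z \<in> carr E"
    have "hinner E z (adj E E S (lact E a y)) = hinner E (S z) (lact E a y)"
      using a y z by (simp add: adj_right)
    also have "\<dots> = hinner E (lact E ?a (S z)) y"
      using a y z by (simp add: lact_E_adj[symmetric] adj_left lact_E_bounded)
    also have "\<dots> = hinner E (S (lact E ?a z)) y"
      using S a' z by (simp add: lhom_def)
    also have "\<dots> = hinner E (lact E ?a z) (adj E E S y)"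
      using a' y z by (simp add: adj_right)
    also have "\<dots> = hinner E z (lact E a (adj E E S y))"
      using a y z by (simp add: lact_E_adj[symmetric] adj_left lact_E_bounded)
    finally show "hinner E z (adj E E S (lact E a y)) = hinner E z (lact E a (adj E E S y))" .
  qed (use a y in simp_all)
  then show ?thesis by (simp add: lhom_def)
qed

lemma End_F [simp]: "\<lbrakk>T \<in> end_alg r X; f \<in> F\<rbrakk> \<Longrightarrow> compose (carr L) T f \<in> F"
  by (rule rhom_compose[OF L_mod X_mod])

lemma End_adj [simp]: "T \<in> end_alg r X \<Longrightarrow> adj X X T \<in> end_alg r X"
  by (rule rhom_adj[OF X_mod X_mod _ adj_ops])

lemma ip_End:
  assumes T: "T \<in> end_alg r X" and f: "f \<in> F" and g: "g \<in> F"
  shows "ip (compose (carr L) T f) g = ip f (compose (carr L) (adj X X T) g)"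
proof -
  have "adj L X (compose (carr L) T f) = compose (carr X) (adj L X f) (adj X X T)"
    by (rule adj_compose) (simp_all add: F_bounded f rhomD[OF T])
  then have "compose (carr L) (adj L X (compose (carr L) T f)) g =
      compose (carr L) (adj L X f) (compose (carr L) (adj X X T) g)"
    using g by (auto simp: compose_def fun_eq_iff)
  then show ?thesis by (simp add: ip_def)
qed

abbreviation (input) "fuse_gen T S \<equiv> \<lambda>(f, y). (compose (carr L) T f, S y)"

lemma fuse_gen_in:
  assumes "T \<in> end_alg r X" "S \<in> lhom" "a \<in> D"
  shows "fuse_gen T S a \<in> D"
  using assms lhomD(1)[OF assms(2)] by (auto simp: op_in)

text \<open>The adjoint of a fused operator is visible on generators before boundedness is known;
  this makes the moments in \<open>push_gen_bounded\<close> symmetric.\<close>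

lemma fusion_form_adj:
  assumes T: "T \<in> end_alg r X" and S: "S \<in> lhom" and a: "a \<in> D" and b: "b \<in> D"
  shows "fusion_form r L X E (fuse_gen T S a) b =
    fusion_form r L X E a (fuse_gen (adj X X T) (adj E E S) b)"
proof -
  obtain f y g z where ab: "a = (f, y)" "b = (g, z)" by (cases a, cases b)
  have fg: "f \<in> F" "y \<in> carr E" "g \<in> F" "z \<in> carr E" using a b by (auto simp: ab)
  let ?g = "compose (carr L) (adj X X T) g"
  have g': "?g \<in> F" using T fg by simp
  note S' = lhomD[OF S]
  have "hinner E (S y) (ip f ?g z) = hinner E y (adj E E S (ip f ?g z))"
    using fg g' S' by (simp add: adj_right)
  also have "adj E E S (ip f ?g z) = ip f ?g (adj E E S z)"
    using lhomD(2)[OF lhom_adj[OF S]] fg g' by (simp add: ip_def F_inner)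
  finally show ?thesis by (simp add: ab fusion_form_ip ip_End[OF T fg(1,3)])
qed

text \<open>The constant may depend on \<open>a\<close> and \<open>b\<close> but not on
  \<open>m\<close>: each iterate multiplies the bound of the operator component by \<open>NT\<close>
  and that of the vector by \<open>NS\<close>, and \<open>sigma_contractive\<close> transfers the
  operator bound to \<open>ip\<close>.\<close>

lemma fusion_form_growth:
  assumes T: "T \<in> bounded_ops X X" and TF: "\<And>f. f \<in> F \<Longrightarrow> compose (carr L) T f \<in> F"
    and S: "S \<in> bounded_ops E E"
    and NT: "0 < NT" "\<And>x. x \<in> carr X \<Longrightarrow> hnorm X (T x) \<le> NT * hnorm X x"
    and NS: "0 < NS" "\<And>y. y \<in> carr E \<Longrightarrow> hnorm E (S y) \<le> NS * hnorm E y"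
    and a: "a \<in> D" and b: "b \<in> D"
  shows "\<exists>c. \<forall>m. cmod (fusion_form r L X E a ((fuse_gen T S ^^ m) b)) \<le> c * (NT * NS) ^ m"
proof -
  obtain f y g z where ab: "a = (f, y)" "b = (g, z)" by (cases a, cases b)
  have fg: "f \<in> F" "y \<in> carr E" "g \<in> F" "z \<in> carr E" using a b by (auto simp: ab)
  have fa: "adj L X f \<in> bounded_ops X L" using F_bounded[OF fg(1)] by simp
  obtain Cf where Cf: "0 < Cf" "\<And>x. x \<in> carr X \<Longrightarrow> hnorm L (adj L X f x) \<le> Cf * hnorm X x"
    using op_bound[OF fa] by auto
  obtain Cg where Cg: "0 < Cg" "\<And>x. x \<in> carr L \<Longrightarrow> hnorm X (g x) \<le> Cg * hnorm L x"
    using op_bound[OF F_bounded[OF fg(3)]] by auto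
  have iter: "\<exists>h w. (fuse_gen T S ^^ m) b = (h, w) \<and> h \<in> F \<and> w \<in> carr E \<and>
      (\<forall>x\<in>carr L. hnorm X (h x) \<le> NT ^ m * Cg * hnorm L x) \<and> hnorm E w \<le> NS ^ m * hnorm E z" for m
  proof (induction m)
    case 0
    then show ?case using fg Cg by (simp add: ab)
  next
    case (Suc m)
    then obtain h w where hw: "(fuse_gen T S ^^ m) b = (h, w)" "h \<in> F" "w \<in> carr E"
      "\<forall>x\<in>carr L. hnorm X (h x) \<le> NT ^ m * Cg * hnorm L x" "hnorm E w \<le> NS ^ m * hnorm E z"
      by blast
    have "hnorm X (compose (carr L) T h x) \<le> NT ^ Suc m * Cg * hnorm L x" if x: "x \<in> carr L" for x
    proof -
      have "hnorm X (T (h x)) \<le> NT * hnorm X (h x)" using NT hw x by simp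
      also have "\<dots> \<le> NT * (NT ^ m * Cg * hnorm L x)" using NT hw x by (intro mult_left_mono) auto
      finally show ?thesis using x by (simp add: compose_eq mult_ac)
    qed
    moreover have "hnorm E (S w) \<le> NS ^ Suc m * hnorm E z"
    proof -
      have "hnorm E (S w) \<le> NS * hnorm E w" using NS hw by simp
      also have "\<dots> \<le> NS * (NS ^ m * hnorm E z)" using NS hw by (intro mult_left_mono) auto
      finally show ?thesis by (simp add: mult_ac)
    qed
    ultimately show ?case using hw TF op_in[OF S] by simp
  qed
  have "cmod (fusion_form r L X E a ((fuse_gen T S ^^ m) b)) \<le>
      (hnorm E y * Cf * Cg * hnorm E z) * (NT * NS) ^ m" for m
  proof -
    obtain h w where hw: "(fuse_gen T S ^^ m) b = (h, w)" "h \<in> F" "w \<in> carr E"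
      "\<forall>x\<in>carr L. hnorm X (h x) \<le> NT ^ m * Cg * hnorm L x" "hnorm E w \<le> NS ^ m * hnorm E z"
      using iter[of m] by blast
    have NTm: "0 \<le> NT ^ m * Cg" using NT Cg by simp
    have "hnorm E (ip f h w) \<le> (Cf * (NT ^ m * Cg)) * hnorm E w"
      unfolding ip_def
    proof (rule sigma_contractive[OF F_inner[OF fg(1) hw(2)] _ _ hw(3)])
      fix x assume x: "x \<in> carr L"
      have "hnorm L (adj L X f (h x)) \<le> Cf * hnorm X (h x)" using Cf hw x by simp
      also have "\<dots> \<le> Cf * (NT ^ m * Cg * hnorm L x)" using Cf hw x by (intro mult_left_mono) auto
      finally show "hnorm L (compose (carr L) (adj L X f) h x) \<le> Cf * (NT ^ m * Cg) * hnorm L x"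
        using x by (simp add: compose_eq mult_ac)
    qed (use Cf NTm in simp)
    also have "\<dots> \<le> (Cf * (NT ^ m * Cg)) * (NS ^ m * hnorm E z)"
      using Cf NTm hw by (intro mult_left_mono) auto
    finally have "hnorm E y * hnorm E (ip f h w) \<le> hnorm E y * ((Cf * (NT ^ m * Cg)) * (NS ^ m * hnorm E z))"
      using fg by (intro mult_left_mono) (auto simp: E.hnorm_nonneg)
    moreover have "cmod (hinner E y (ip f h w)) \<le> hnorm E y * hnorm E (ip f h w)"
      using fg hw by (intro E.Cauchy_Schwarz) simp_all
    ultimately show ?thesis
      by (simp add: hw(1) ab(1) fusion_form_ip power_mult_distrib mult_ac)
  qed
  then show ?thesis by blast
qed

text \<open>The squared seminorm of the image of \<open>p\<close> is the first moment at
  \<open>p\<close> of \<open>R\<close>, the generator form of T^* T tensor S^* S. All moments grow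
  at most like powers of \<open>NA * NB\<close>, so \<open>growth_rate_bound\<close> gives the
  estimate although \<open>R\<close> is not yet a bounded operator.\<close>

lemma push_gen_bounded:
  assumes T: "T \<in> end_alg r X" and S: "S \<in> lhom"
  obtains N where "0 \<le> N" "\<And>p. p \<in> carr FS \<Longrightarrow>
    Re (kform (fusion_form r L X E) (push (fuse_gen T S) p) (push (fuse_gen T S) p)) \<le>
      N * Re (kform (fusion_form r L X E) p p)"
proof -
  let ?k = "fusion_form r L X E"
  let ?g = "fuse_gen T S"
  note T' = rhomD[OF T] and S' = lhomD[OF S]
  define A where "A = compose (carr X) (adj X X T) T"
  define B where "B = compose (carr E) (adj E E S) S"
  have A: "A \<in> end_alg r X" unfolding A_def by (rule rhom_compose[OF X_mod X_mod End_adj[OF T] T])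
  have B: "B \<in> lhom"
    using S'(1) lhomD(1)[OF lhom_adj[OF S]] lhom_adj[OF S] S unfolding B_def lhom_def
    by (auto simp: compose_eq op_in[OF lact_E_bounded] op_in[OF S'(1)]
        compose_in[OF lhomD(1)[OF lhom_adj[OF S]] S'(1)])
  define R where "R = fuse_gen A B"
  have R_in: "R a \<in> D" if "a \<in> D" for a unfolding R_def by (rule fuse_gen_in[OF A B that])
  have Rm_in: "(R ^^ m) a \<in> D" if "a \<in> D" for a m by (induction m) (use that R_in in auto)
  have gR: "?k (?g a) (?g b) = ?k a (R b)" if a: "a \<in> D" and b: "b \<in> D" for a b
  proof -
    have "fuse_gen (adj X X T) (adj E E S) (?g b) = R b"
      using b by (auto simp: R_def A_def B_def compose_def)
    then show ?thesis using fusion_form_adj[OF T S a fuse_gen_in[OF T S b]] by simp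
  qed
  have R_sym: "?k (R a) b = ?k a (R b)" if a: "a \<in> D" and b: "b \<in> D" for a b
  proof -
    have "?k (R a) b = cnj (?k b (R a))" using a b R_in by (intro fusion_form_commute)
    also have "\<dots> = cnj (?k (?g b) (?g a))" using gR[OF b a] by simp
    also have "\<dots> = ?k (?g a) (?g b)"
      using fusion_form_commute[OF fuse_gen_in[OF T S a] fuse_gen_in[OF T S b]] by simp
    finally show ?thesis using gR[OF a b] by simp
  qed
  have Rm_sym: "?k ((R ^^ m) a) b = ?k a ((R ^^ m) b)" if "a \<in> D" "b \<in> D" for m a b
    using that
  proof (induction m arbitrary: b)
    case (Suc m)
    then show ?case using R_sym[OF Rm_in[OF Suc.prems(1)], of b m] R_in[of b] by (simp add: funpow_swap1)
  qed simp
  obtain NA where NA: "0 < NA" "\<And>x. x \<in> carr X \<Longrightarrow> hnorm X (A x) \<le> NA * hnorm X x"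
    using op_bound[OF rhomD(1)[OF A]] by auto
  obtain NB where NB: "0 < NB" "\<And>y. y \<in> carr E \<Longrightarrow> hnorm E (B y) \<le> NB * hnorm E y"
    using op_bound[OF lhomD(1)[OF B]] by auto
  have "\<exists>c. \<forall>m. cmod (?k a ((R ^^ m) b)) \<le> c * (NA * NB) ^ m" if "a \<in> D" "b \<in> D" for a b
    unfolding R_def
    by (rule fusion_form_growth[OF rhomD(1)[OF A] End_F[OF A] lhomD(1)[OF B] NA NB that])
  then obtain c where c: "\<And>a b m. \<lbrakk>a \<in> D; b \<in> D\<rbrakk> \<Longrightarrow> cmod (?k a ((R ^^ m) b)) \<le> c a b * (NA * NB) ^ m"
    by metis
  have kpush: "kform ?k p (push h q) = kform (\<lambda>a b. ?k a (h b)) p q" for p q h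
    using kform_push[of ?k "\<lambda>a. a" p h q] by (simp add: push_ident)
  have "Re (kform ?k (push ?g p) (push ?g p)) \<le> (NA * NB) * Re (kform ?k p p)" if p: "p \<in> carr FS" for p
  proof -
    have pD: "a \<in> D" if "a \<in> Poly_Mapping.keys p" for a using p that by auto
    \<comment> \<open>The moments of \<open>R\<close> at \<open>p\<close>; \<open>a 0\<close> is the
      squared seminorm of \<open>p\<close>.\<close>
    define a where "a m = Re (kform ?k p (push (R ^^ m) p))" for m
    have pm: "push (R ^^ m) p \<in> carr FS" for m
    proof -
      have "(R ^^ m) ` Poly_Mapping.keys p \<subseteq> D" using Rm_in pD by blast
      then show ?thesis using keys_push[of "R ^^ m" p] by auto
    qed
    have "a 1 \<le> (NA * NB) * a 0"
    proof (rule growth_rate_bound)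
      show "0 \<le> a 0" using FS.Re_hinner_nonneg[OF p] by (simp add: a_def push_ident id_def)
      show "(a m)\<^sup>2 \<le> a 0 * a (2 * m)" for m
      proof -
        \<comment> \<open>Symmetry moves half of the iterates to the left argument, so
          Cauchy-Schwarz for \<open>p\<close> and its \<open>m\<close>-th iterate becomes the
          doubling hypothesis.\<close>
        have "kform ?k (push (R ^^ m) p) (push (R ^^ m) p) = kform ?k p (push (R ^^ (2 * m)) p)"
          unfolding kform_push kpush
          by (rule kform_cong) (simp add: Rm_sym pD Rm_in mult_2 funpow_add)
        moreover have "(a m)\<^sup>2 \<le> (cmod (kform ?k p (push (R ^^ m) p)))\<^sup>2"
          unfolding a_def by (rule power2_le_iff_abs_le[THEN iffD2]) (simp_all add: abs_Re_le_cmod)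
        moreover have "(cmod (kform ?k p (push (R ^^ m) p)))\<^sup>2 \<le> (hnorm FS p * hnorm FS (push (R ^^ m) p))\<^sup>2"
          using FS.Cauchy_Schwarz[OF p pm] by (intro power_mono) simp_all
        ultimately show ?thesis
          using FS.hnorm_sq[OF p] FS.hnorm_sq[OF pm, of m]
          by (simp add: power_mult_distrib a_def push_ident id_def)
      qed
      \<comment> \<open>\<open>p\<close> has finitely many terms, so the constants of the pairs
        combine into one that is independent of \<open>m\<close>.\<close>
      show "a m \<le> (\<Sum>b\<in>Poly_Mapping.keys p. \<Sum>d\<in>Poly_Mapping.keys p.
          cmod (Poly_Mapping.lookup p b) * cmod (Poly_Mapping.lookup p d) * c b d) * (NA * NB) ^ m" for m
      proof -
        have "a m \<le> cmod (kform (\<lambda>a b. ?k a ((R ^^ m) b)) p p)"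
          unfolding a_def kpush by (rule complex_Re_le_cmod)
        also have "\<dots> \<le> (\<Sum>b\<in>Poly_Mapping.keys p. \<Sum>d\<in>Poly_Mapping.keys p.
            cmod (Poly_Mapping.lookup p b) * cmod (Poly_Mapping.lookup p d) * (c b d * (NA * NB) ^ m))"
          unfolding kform_def
          by (intro sum_norm_le) (simp add: norm_mult mult_left_mono c pD)
        finally show ?thesis by (simp add: sum_distrib_right mult.assoc)
      qed
      show "0 \<le> NA * NB" using NA NB by simp
    qed
    moreover have "kform ?k (push ?g p) (push ?g p) = kform ?k p (push (R ^^ 1) p)"
      unfolding kform_push kpush by (rule kform_cong) (simp add: gR pD)
    ultimately show ?thesis by (simp add: a_def push_ident id_def)
  qed
  then show ?thesis using that[of "NA * NB"] NA NB by simp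
qed

abbreviation "fm \<equiv> fuse_map r L X E X E"

text \<open>Resolves the definite description in \<open>fuse_map\<close>: the estimate on formal
  sums extends to an operator by \<open>bounded_extension\<close>, and \<open>op_eq_on_tens\<close>
  gives uniqueness.\<close>

lemma fuse_map_spec:
  assumes T: "T \<in> end_alg r X" and S: "S \<in> lhom"
  shows "fm T S \<in> bounded_ops H H"
    and "\<lbrakk>f \<in> F; y \<in> carr E\<rbrakk> \<Longrightarrow> fm T S (tn f y) = tn (compose (carr L) T f) (S y)"
proof -
  let ?g = "fuse_gen T S"
  obtain N where N: "0 \<le> N" "\<And>p. p \<in> carr FS \<Longrightarrow>
      Re (kform (fusion_form r L X E) (push ?g p) (push ?g p)) \<le> N * Re (kform (fusion_form r L X E) p p)"
    using push_gen_bounded[OF T S] by blast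
  have push_in: "push ?g p \<in> carr FS" if "p \<in> carr FS" for p
  proof -
    have "?g ` Poly_Mapping.keys p \<subseteq> D" using fuse_gen_in[OF T S] that by auto
    then show ?thesis using keys_push[of ?g p] by auto
  qed
  have bound: "hnorm H (Phi (push ?g p)) \<le> sqrt N * hnorm H (Phi p)" if p: "p \<in> carr FS" for p
    unfolding hnorm_def Phi_inner[OF p p] Phi_inner[OF push_in[OF p] push_in[OF p]]
      real_sqrt_mult[symmetric]
    by (rule real_sqrt_le_mono) (rule N(2)[OF p])
  obtain W where W: "W \<in> bounded_ops H H" "\<And>p. p \<in> carr FS \<Longrightarrow> W (Phi p) = Phi (push ?g p)"
  proof (rule bounded_extension[where S = "carr FS" and Phi = Phi and j = "\<lambda>p. Phi (push ?g p)"
        and pl = "(+)" and sc = pm_scale and C = "sqrt N", OF hilbert_H hilbert_H])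
    show "p + q \<in> carr FS" if "p \<in> carr FS" "q \<in> carr FS" for p q
      using FS.add_in[OF that] by simp
    show "pm_scale c p \<in> carr FS" if "p \<in> carr FS" for c p
      using FS.scale_in[OF that] by simp
    show "Phi (push ?g (p + q)) = hadd H (Phi (push ?g p)) (Phi (push ?g q))"
      if "p \<in> carr FS" "q \<in> carr FS" for p q
      unfolding push_add by (intro Phi_add push_in that)
    show "Phi (push ?g (pm_scale c p)) = hscale H c (Phi (push ?g p))" if "p \<in> carr FS" for c p
      unfolding push_scale by (intro Phi_scale push_in that)
    show "\<exists>u. (\<forall>n. u n \<in> carr FS) \<and> H.conv (\<lambda>n. Phi (u n)) x" if "x \<in> carr H" for x
      by (rule Phi_dense[OF that])
    show "0 \<le> sqrt N" using N(1) by simp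
  qed (rule Phi_in Phi_add Phi_scale push_in bound that; assumption?)+
  have tens: "W (tn f y) = tn (compose (carr L) T f) (S y)" if "f \<in> F" "y \<in> carr E" for f y
    using W(2)[OF free_tens_in[OF that, of 1]] by (simp add: tens_Phi)
  have "fm T S = W"
    unfolding fuse_map_def
  proof (rule the_equality)
    show "W \<in> bounded_ops H H \<and> (\<forall>f\<in>F. \<forall>y\<in>carr E. W (tn f y) = tn (compose (carr L) T f) (S y))"
      using W(1) tens by blast
    fix W' assume "W' \<in> bounded_ops H H \<and> (\<forall>f\<in>F. \<forall>y\<in>carr E. W' (tn f y) = tn (compose (carr L) T f) (S y))"
    then show "W' = W" using tens by (intro op_eq_on_tens[OF hilbert_H _ W(1)]) simp_all
  qed
  then show "fm T S \<in> bounded_ops H H"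
    and "\<lbrakk>f \<in> F; y \<in> carr E\<rbrakk> \<Longrightarrow> fm T S (tn f y) = tn (compose (carr L) T f) (S y)"
    using W(1) tens by simp_all
qed

lemma End_id: "op_id X \<in> end_alg r X"
  by (rule rhom_id[OF X_mod])

lemma compose_id_F: "f \<in> F \<Longrightarrow> compose (carr L) (op_id X) f = f"
  by (rule compose_id_left[OF F_bounded])

lemma fuse_map_id: "fm (op_id X) (op_id E) = op_id H"
  by (rule op_eq_on_tens[OF hilbert_H])
    (simp_all add: fuse_map_spec End_id lhom_id compose_id_F)

lemma fuse_map_adj:
  assumes T: "T \<in> end_alg r X" and S: "S \<in> lhom"
  shows "adj H H (fm T S) = fm (adj X X T) (adj E E S)"
proof (rule op_eq_on_tens[OF hilbert_H])
  note W = fuse_map_spec[OF T S] and W' = fuse_map_spec[OF End_adj[OF T] lhom_adj[OF S]]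
  note S' = lhomD(1)[OF S] lhomD(1)[OF lhom_adj[OF S]]
  show "adj H H (fm T S) \<in> bounded_ops H H" using W by simp
  show "fm (adj X X T) (adj E E S) \<in> bounded_ops H H" by (rule W')
  fix f y assume fy: "f \<in> F" "y \<in> carr E"
  show "adj H H (fm T S) (tn f y) = fm (adj X X T) (adj E E S) (tn f y)"
  proof (rule tens_eqI)
    fix g z assume gz: "g \<in> F" "z \<in> carr E"
    show "hinner H (tn g z) (adj H H (fm T S) (tn f y)) = hinner H (tn g z) (fm (adj X X T) (adj E E S) (tn f y))"
      using fusion_form_adj[OF T S, of "(g, z)" "(f, y)"] fy gz T
      by (simp add: adj_right W W' tens_inner op_in[OF S'(1)] op_in[OF S'(2)] fusion_form_ip)
  qed (use fy T in \<open>simp_all add: W W' op_in[OF S'(2)]\<close>)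
qed

lemma fuse_map_compose:
  assumes T: "T \<in> end_alg r X" and T': "T' \<in> end_alg r X"
  shows "fm (compose (carr X) T T') (op_id E) = compose (carr H) (fm T (op_id E)) (fm T' (op_id E))"
proof (rule op_eq_on_tens[OF hilbert_H])
  note W = fuse_map_spec[OF T lhom_id] and W' = fuse_map_spec[OF T' lhom_id]
  have TT': "compose (carr X) T T' \<in> end_alg r X" by (rule rhom_compose[OF X_mod X_mod T T'])
  show "fm (compose (carr X) T T') (op_id E) \<in> bounded_ops H H" by (rule fuse_map_spec[OF TT' lhom_id])
  show "compose (carr H) (fm T (op_id E)) (fm T' (op_id E)) \<in> bounded_ops H H"
    by (rule compose_in[OF W(1) W'(1)]) simp_all
  fix f y assume fy: "f \<in> F" "y \<in> carr E"
  have "compose (carr L) (compose (carr X) T T') f = compose (carr L) T (compose (carr L) T' f)"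
    using fy by (auto simp: compose_def fun_eq_iff)
  then show "fm (compose (carr X) T T') (op_id E) (tn f y) =
      compose (carr H) (fm T (op_id E)) (fm T' (op_id E)) (tn f y)"
    using fy T T' by (simp add: fuse_map_spec[OF TT' lhom_id] W W' compose_eq)
qed

end

section \<open>Representations\<close>

text \<open>\<open>fusion\<close> adds an action to \<open>fusion_space\<close>, giving another
  record type on the same space. These rules and the next three transport operators, adjoints and
  unitarity between the two.\<close>

lemma fusion_simps [simp]:
  "carr (fusion r L X E) = carr (fusion_space r L X E)"
  "hadd (fusion r L X E) = hadd (fusion_space r L X E)"
  "hscale (fusion r L X E) = hscale (fusion_space r L X E)"
  "hinner (fusion r L X E) = hinner (fusion_space r L X E)"
  "ract (fusion r L X E) = (\<lambda>b. fuse_map r L X E X E (op_id X) (ract E b))"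
  by (simp_all add: fusion_def hilb.defs rmod.defs)

lemma bounded_ops_fusion: "bounded_ops Y (fusion r L X E) = bounded_ops Y (fusion_space r L X E)"
  by (simp add: bounded_ops_def hnorm_def)

lemma adj_fusion: "adj Y (fusion r L X E) V = adj Y (fusion_space r L X E) V"
  by (simp add: adj_def)

lemma unitary_op_fusion: "unitary_op Y (fusion r L X E) V \<longleftrightarrow> unitary_op Y (fusion_space r L X E) V"
  by (simp add: unitary_op_def adj_fusion op_id_def)

text \<open>A representation without its universal property, with separate point types for the
  spaces; minimality reaches \<open>hom_imp_unitary\<close> as a uniqueness hypothesis.\<close>

locale represented_map = fusion_setting r s L X E
  for r :: "'r vn_algebra" and s :: "'s vn_algebra" and L :: "('r, 'r, 'l) bimod"
    and X :: "('r, 'x) rmod" and E :: "('r, 's, 'e) bimod" +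
  fixes Y :: "('s, 'y) rmod" and f :: "('x \<Rightarrow> 'x) \<Rightarrow> ('y \<Rightarrow> 'y)" and V :: "'y \<Rightarrow> ('l, 'x, 'e) fusion_pt"
  assumes Y_mod: "right_module s Y"
    and V_rhom: "V \<in> rhom s Y (fusion r L X E)"
    and f_rep: "a \<in> end_alg r X \<Longrightarrow> f a = compose (carr Y) (adj Y (fusion r L X E) V)
        (compose (carr Y) (fuse_map r L X E X E a (op_id E)) V)"
begin

sublocale Y: right_mod s Y by (rule right_mod.intro[OF Y_mod])

sublocale YH: hilbert_space Y by (rule Y.hilbert_right)

lemma V_bounded [simp]: "V \<in> bounded_ops Y H"
  using V_rhom by (simp add: rhom_def bounded_ops_fusion)

lemma V_in [simp]: "y \<in> carr Y \<Longrightarrow> V y \<in> carr H"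
  by (rule op_in[OF V_bounded])

lemma V_ract: "\<lbrakk>b \<in> ops s; y \<in> carr Y\<rbrakk> \<Longrightarrow> V (ract Y b y) = fm (op_id X) (ract E b) (V y)"
  using rhomD(2)[OF V_rhom] by simp

lemma fm_in [simp]: "\<lbrakk>a \<in> end_alg r X; x \<in> carr H\<rbrakk> \<Longrightarrow> fm a (op_id E) x \<in> carr H"
  by (rule op_in[OF fuse_map_spec(1)[OF _ lhom_id]])

lemma fm_adj:
  "\<lbrakk>a \<in> end_alg r X; x \<in> carr H; z \<in> carr H\<rbrakk> \<Longrightarrow>
    hinner H x (fm (adj X X a) (op_id E) z) = hinner H (fm a (op_id E) x) z"
  using fuse_map_adj[OF _ lhom_id, of a]
    adj_right[OF hilbert_H hilbert_H fuse_map_spec(1)[OF _ lhom_id], of a z x]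
  by (simp add: adj_op_id)

lemma f_apply: "\<lbrakk>a \<in> end_alg r X; y \<in> carr Y\<rbrakk> \<Longrightarrow> f a y = adj Y H V (fm a (op_id E) (V y))"
  by (simp add: f_rep adj_fusion compose_eq)

lemma f_bounded: "a \<in> end_alg r X \<Longrightarrow> f a \<in> bounded_ops Y Y"
  unfolding f_rep adj_fusion
  by (rule compose_in[where K = H] compose_in[where K = H] adj_in fuse_map_spec(1) lhom_id V_bounded;
      simp?)+

lemma f_in [simp]: "\<lbrakk>a \<in> end_alg r X; y \<in> carr Y\<rbrakk> \<Longrightarrow> f a y \<in> carr Y"
  by (rule op_in[OF f_bounded])

lemma unitary_imp_hom:
  assumes lin: "linear_map X (end_alg r X) Y (end_alg s Y) f" and V: "unitary_op Y H V"
  shows "unital_star_hom (op_mult X) X (end_alg r X) Y (end_alg s Y) f"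
proof -
  have VV: "V (adj Y H V x) = x" if "x \<in> carr H" for x
    using fun_cong[OF conjunct2[OF V[unfolded unitary_op_def]], of x] that by (simp add: compose_eq)
  have V_V: "adj Y H V (V y) = y" if "y \<in> carr Y" for y
    using fun_cong[OF conjunct1[OF V[unfolded unitary_op_def]], of y] that by (simp add: compose_eq)
  show ?thesis
    unfolding unital_star_hom_def
  proof (intro conjI ballI lin)
    show "f (op_id X) = op_id Y"
      by (rule op_eqI[OF f_bounded]) (simp_all add: End_id f_apply fuse_map_id V_V)
  next
    fix a b assume a: "a \<in> end_alg r X" and b: "b \<in> end_alg r X"
    have ab: "compose (carr X) a b \<in> end_alg r X" by (rule rhom_compose[OF X_mod X_mod a b])
    show "f (compose (carr X) a b) = compose (carr Y) (f a) (f b)"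
    proof (rule op_eqI[OF f_bounded[OF ab]])
      show "compose (carr Y) (f a) (f b) \<in> bounded_ops Y Y"
        by (rule compose_in[OF f_bounded[OF a] f_bounded[OF b]]) simp_all
      fix y assume y: "y \<in> carr Y"
      then show "f (compose (carr X) a b) y = compose (carr Y) (f a) (f b) y"
        by (simp add: compose_eq f_apply[OF ab] fuse_map_compose[OF a b] f_apply[OF b]
            f_apply[OF a] VV a b)
    qed
  next
    fix a assume a: "a \<in> end_alg r X"
    note a' = End_adj[OF a]
    have "adj Y Y (f a) = f (adj X X a)"
    proof (rule adjI[OF _ _ f_bounded[OF a] f_bounded[OF a']])
      fix y z assume yz: "y \<in> carr Y" "z \<in> carr Y"
      then show "hinner Y z (f (adj X X a) y) = hinner Y (f a z) y"
        by (simp add: f_apply a a' adj_right adj_left fm_adj)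
    qed simp_all
    then show "f (adj X X a) = adj Y Y (f a)" by simp
  qed
qed

lemma hom_imp_intertwining:
  assumes hom: "unital_star_hom (op_mult X) X (end_alg r X) Y (end_alg s Y) f"
  shows "y \<in> carr Y \<Longrightarrow> adj Y H V (V y) = y"
    and "\<lbrakk>a \<in> end_alg r X; y \<in> carr Y\<rbrakk> \<Longrightarrow> fm a (op_id E) (V y) = V (f a y)"
proof -
  note h = unital_star_homD[OF hom]
  show iso: "adj Y H V (V y) = y" if "y \<in> carr Y" for y
    using f_apply[OF End_id that] h(2) that by (simp add: fuse_map_id)
  fix y assume a: "a \<in> end_alg r X" and y: "y \<in> carr Y"
  note a' = End_adj[OF a]
  let ?A = "fm a (op_id E) (V y)"
  have aa: "compose (carr X) (adj X X a) a \<in> end_alg r X" by (rule rhom_compose[OF X_mod X_mod a' a])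
  have *: "hinner H (V (f a y)) ?A = hinner Y (f a y) (f a y)"
    using a y by (simp add: f_apply[OF a y] adj_right)
  have VfVf: "hinner H (V (f a y)) (V (f a y)) = hinner Y (f a y) (f a y)"
    using adj_right[OF Y.hilbert_right hilbert_H V_bounded, of "V (f a y)" "f a y"] a y iso[of "f a y"]
    by simp
  \<comment> \<open>Multiplicativity enters here: the value of \<open>f\<close> at a^* a is the
    adjoint of \<open>f a\<close> composed with \<open>f a\<close>.\<close>
  have "hinner H ?A ?A = hinner Y y (f (compose (carr X) (adj X X a) a) y)"
    using a a' y by (simp add: f_apply[OF aa y] fuse_map_compose[OF a' a] compose_eq adj_right fm_adj[OF a])
  also have "\<dots> = hinner Y (f a y) (f a y)"
    using a a' y by (simp add: h(3)[OF a' a] h(4)[OF a] compose_eq adj_right f_bounded)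
  finally have AA: "hinner H ?A ?A = hinner Y (f a y) (f a y)" .
  have "hinner H ?A (V (f a y)) = cnj (hinner H (V (f a y)) ?A)"
    using a y by (intro H.hinner_commute) simp_all
  then have "hinner H ?A (V (f a y)) = hinner Y (f a y) (f a y)"
    using * YH.hinner_commute[of "f a y" "f a y"] a y by simp
  then have "hinner H (hdiff H ?A (V (f a y))) (hdiff H ?A (V (f a y))) = 0"
    using * AA VfVf a y by simp
  then show "?A = V (f a y)"
    using a y by (intro H.hdiff_eq_0) (simp_all add: hnorm_def)
qed

text \<open>
  The range of \<^term>\<open>V\<close> is invariant under \<open>End(X) \<otimes> 1\<close> and under \<^term>\<open>s\<close>. The vectors \<open>y\<close> with
  \<open>g \<otimes> y\<close> in that range for all \<open>g\<close> form a sub-bimodule of \<^term>\<open>E\<close>; the projection \<open>p\<close> onto it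
  satisfies \<open>(1 \<otimes> p) V = V\<close>, since \<open>\<theta>\<^sub>h \<theta>\<^sub>g\<^sup>* = h g\<^sup>* \<otimes> 1\<close> for \<open>\<theta>\<^sub>g y = g \<otimes> y\<close>.
\<close>

lemma hom_imp_unitary:
  assumes vn_s: "von_neumann_algebra s"
    and hom: "unital_star_hom (op_mult X) X (end_alg r X) Y (end_alg s Y) f"
    and unique: "\<And>p. \<lbrakk>p \<in> bihom r s E E; adj E E p = p; V = compose (carr Y) (fm (op_id X) p) V\<rbrakk> \<Longrightarrow> p = op_id E"
  shows "unitary_op Y H V"
proof -
  note iso = hom_imp_intertwining(1)[OF hom] and inter = hom_imp_intertwining(2)[OF hom]
  have Vadj_in [simp]: "adj Y H V x \<in> carr Y" if "x \<in> carr H" for x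
    using that by simp
  define Ran where "Ran = V ` carr Y"
  have RanI: "x \<in> Ran" if "x \<in> carr H" "V (adj Y H V x) = x" for x
    using that unfolding Ran_def by (metis Vadj_in image_eqI)
  have RanD: "V (adj Y H V x) = x" "x \<in> carr H" if "x \<in> Ran" for x
    using that iso by (auto simp: Ran_def)
  \<comment> \<open>Quantifying over all \<open>g\<close> makes \<open>N\<close> invariant under
    \<open>r\<close>: inserting \<open>g\<close> in front of \<open>lact E a y\<close> equals
    inserting the composite of \<open>g\<close> and \<open>lact L a\<close> in front of
    \<open>y\<close>.\<close>
  define N where "N = {y \<in> carr E. \<forall>g\<in>F. tn g y \<in> Ran}"
  \<comment> \<open>\<open>V\<close> is isometric, so this is the projection onto its range.
    Membership in \<open>Ran\<close> becomes \<open>P x = x\<close>, an equation stable under linear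
    operations and limits.\<close>
  define P where "P = compose (carr H) V (adj Y H V)"
  have P: "P \<in> bounded_ops H H"
    unfolding P_def by (rule compose_in[OF V_bounded]) simp_all
  have P_apply: "P x = V (adj Y H V x)" if "x \<in> carr H" for x using that by (simp add: P_def compose_eq)
  have Ran_iff: "x \<in> Ran \<longleftrightarrow> P x = x" if "x \<in> carr H" for x
    using that RanI RanD by (auto simp: P_apply)
  interpret N: subspace_projection E N
  proof
    show "closed_subspace E N"
      unfolding closed_subspace_def
    proof (intro conjI ballI allI impI)
      show "N \<subseteq> carr E" by (auto simp: N_def)
      have "tn g (hzero E) = hzero H" if "g \<in> F" for g
        using op_hzero[OF theta_bounded[OF that]] E.closed(1) by simp
      then show "hzero E \<in> N"
        by (simp add: N_def Ran_iff H.closed(1) op_hzero[OF P])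
      show "hadd E x y \<in> N" if "x \<in> N" "y \<in> N" for x y
        using that by (auto simp: N_def Ran_iff tens_add op_hadd[OF P])
      show "hscale E c x \<in> N" if "x \<in> N" for c x
        using that by (auto simp: N_def Ran_iff tens_scale op_hscale[OF P])
      fix u x assume ux: "(\<forall>n. u n \<in> N) \<and> E.conv u x"
      then have u: "\<And>n. u n \<in> carr E" "x \<in> carr E" by (auto simp: N_def E.conv_def)
      have "tn g x \<in> Ran" if g: "g \<in> F" for g
      proof -
        have c: "H.conv (\<lambda>n. tn g (u n)) (tn g x)"
          using op_conv[OF theta_bounded[OF g] _ _ conjunct2[OF ux]] u by simp
        have "P (tn g (u n)) = tn g (u n)" for n
          using ux u g by (auto simp: N_def Ran_iff)
        then have "H.conv (\<lambda>n. tn g (u n)) (P (tn g x))"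
          using op_conv[OF P _ _ c] by simp
        from H.conv_unique[OF this c] show ?thesis using u g by (simp add: Ran_iff)
      qed
      then show "x \<in> N" using u by (simp add: N_def)
    qed
  qed
  have ract_N: "ract E b y \<in> N" if b: "b \<in> ops s" and y: "y \<in> N" for b y
  proof -
    have yE: "y \<in> carr E" using y by (simp add: N_def)
    have lb: "ract E b \<in> lhom"
    proof -
      have "ract E b (lact E a z) = lact E a (ract E b z)" if "a \<in> ops r" "z \<in> carr E" for a z
      proof -
        have "compose (carr E) (lact E a) (ract E b) = compose (carr E) (ract E b) (lact E a)"
          using E_bimod b that by (simp add: bimodule_def)
        from fun_cong[OF this, of z] that show ?thesis by (simp add: compose_eq)
      qed
      then show ?thesis using E.ract_bounded[OF b] by (simp add: lhom_def)
    qed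
    have "tn g (ract E b y) \<in> Ran" if g: "g \<in> F" for g
    proof -
      obtain z where z: "z \<in> carr Y" "tn g y = V z" using y g by (auto simp: N_def Ran_def)
      have "tn g (ract E b y) = fm (op_id X) (ract E b) (tn g y)"
        using fuse_map_spec(2)[OF End_id lb g yE] by (simp add: compose_id_F g)
      also have "\<dots> = V (ract Y b z)" using z V_ract[OF b] by simp
      finally show ?thesis using Y.ract_in[OF b z(1)] by (simp add: Ran_def)
    qed
    then show ?thesis using E.ract_in[OF b yE] by (simp add: N_def)
  qed
  have lact_N: "lact E a y \<in> N" if a: "a \<in> ops r" and y: "y \<in> N" for a y
  proof -
    have yE: "y \<in> carr E" using y by (simp add: N_def)
    have m: "lact L a \<in> M" using a by (simp add: M_def)
    have "tn g (lact E a y) \<in> Ran" if g: "g \<in> F" for g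
    proof -
      have "tn (compose (carr L) g (lact L a)) y \<in> Ran"
        using y F_mult[OF g m] by (simp add: N_def)
      then show ?thesis using tens_mult[OF g m yE] a by (simp add: sigma_lact)
    qed
    then show ?thesis using op_in[OF lact_E_bounded[OF a] yE] by (simp add: N_def)
  qed
  define p where "p = proj E N"
  have p_bihom: "p \<in> bihom r s E E"
  proof -
    have "p (ract E b y) = ract E b (p y)" if b: "b \<in> ops s" and y: "y \<in> carr E" for b y
    proof -
      have b': "adj (hspace s) (hspace s) b \<in> ops s" using vn_s b by (simp add: von_neumann_algebra_def)
      show ?thesis
        unfolding p_def
      proof (rule N.proj_commute[OF E.ract_bounded[OF b] ract_N[OF b] _ y])
        show "adj E E (ract E b) x \<in> N" if "x \<in> N" for x
          using ract_N[OF b' that] by (simp add: E.ract_adj[OF b])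
      qed
    qed
    moreover have "p (lact E a y) = lact E a (p y)" if a: "a \<in> ops r" and y: "y \<in> carr E" for a y
      unfolding p_def
    proof (rule N.proj_commute[OF lact_E_bounded[OF a] lact_N[OF a] _ y])
      show "adj E E (lact E a) x \<in> N" if "x \<in> N" for x
        using lact_N[OF adj_ops[OF a] that] by (simp add: lact_E_adj[OF a])
    qed
    ultimately show ?thesis by (simp add: bihom_def rhom_def p_def)
  qed
  have p_in [simp]: "p y \<in> carr E" if "y \<in> carr E" for y using that by (simp add: p_def)
  have p_adj: "adj E E p = p"
    unfolding p_def by (rule adjI) (simp_all add: N.proj_selfadjoint)
  have p_lhom: "p \<in> lhom" using p_bihom by (simp add: lhom_def bihom_def rhom_def)
  \<comment> \<open>The operator 1 tensor p. By the choice of \<open>N\<close> its range lies in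
    that of \<open>V\<close>, which is \<open>PQ\<close>; the reverse containment is
    \<open>QV\<close>.\<close>
  define Q where "Q = fm (op_id X) p"
  have Q: "Q \<in> bounded_ops H H" unfolding Q_def by (rule fuse_map_spec[OF End_id p_lhom])
  note Q_in = op_in[OF Q]
  have Q_tens: "Q (tn g y) = tn g (p y)" if "g \<in> F" "y \<in> carr E" for g y
    unfolding Q_def using that by (simp add: fuse_map_spec[OF End_id p_lhom] compose_id_F)
  have pN: "p y \<in> N" if "y \<in> carr E" for y
    unfolding p_def by (rule N.proj_in_subspace[OF that])
  have QQ: "Q (Q x) = Q x" if x: "x \<in> carr H" for x
  proof -
    have "compose (carr H) Q Q = Q"
    proof (rule op_eq_on_tens[OF hilbert_H _ Q])
      show "compose (carr H) Q Q \<in> bounded_ops H H" by (rule compose_in[OF Q Q]) simp_all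
      show "compose (carr H) Q Q (tn g y) = Q (tn g y)" if "g \<in> F" "y \<in> carr E" for g y
        using that N.proj_fix[OF pN[OF that(2)]] by (simp add: compose_eq Q_tens flip: p_def)
    qed
    from fun_cong[OF this, of x] x show ?thesis by (simp add: compose_eq)
  qed
  have PQ: "P (Q x) = Q x" if x: "x \<in> carr H" for x
  proof -
    have "compose (carr H) P Q = Q"
    proof (rule op_eq_on_tens[OF hilbert_H _ Q])
      show "compose (carr H) P Q \<in> bounded_ops H H" by (rule compose_in[OF P Q]) simp_all
      show "compose (carr H) P Q (tn g y) = Q (tn g y)" if "g \<in> F" "y \<in> carr E" for g y
        using that pN[OF that(2)] by (simp add: compose_eq Q_tens Ran_iff[symmetric] N_def)
    qed
    from fun_cong[OF this, of x] x show ?thesis by (simp add: compose_eq)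
  qed
  have Q_self: "hinner H (Q x) z = hinner H x (Q z)" if "x \<in> carr H" "z \<in> carr H" for x z
  proof -
    have "adj H H Q = Q"
      unfolding Q_def fuse_map_adj[OF End_id p_lhom] by (simp add: p_adj adj_op_id)
    then show ?thesis using adj_right[OF hilbert_H hilbert_H Q that(2,1)] by simp
  qed
  have QV: "Q (V y) = V y" if y: "y \<in> carr Y" for y
  proof -
    \<comment> \<open>The part of \<open>V y\<close> missed by \<open>Q\<close>. It stays in the
      range of \<open>V\<close> and is killed by \<open>Q\<close>; pairing it with simple tensors
      will show that it is zero.\<close>
    define eta where "eta = hdiff H (V y) (Q (V y))"
    have eta_in: "eta \<in> carr H" using y by (simp add: eta_def Q_in)
    have P_eta: "P eta = eta"
      using y iso[OF y] by (simp add: eta_def op_hdiff[OF P] Q_in PQ P_apply[of "V y"])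
    have Q_eta: "Q eta = hzero H"
      using y by (simp add: eta_def op_hdiff[OF Q] Q_in QQ) (simp add: hdiff_def H.hadd_inverse Q_in)
    have "eta = hzero H"
    proof (rule tens_total[OF eta_in])
      fix g z assume g: "g \<in> F" and z: "z \<in> carr E"
      define th where "th = (\<lambda>y\<in>carr E. tn g y)"
      have th: "th \<in> bounded_ops E H" unfolding th_def by (rule theta_bounded[OF g])
      \<comment> \<open>The slice of \<open>eta\<close> by \<open>g\<close>. Once \<open>w\<close>
        lies in \<open>N\<close>, \<open>p\<close> fixes it, and pairing through \<open>p\<close>
        only sees \<open>Q eta\<close>, which is zero.\<close>
      define w where "w = adj E H th eta"
      have w: "w \<in> carr E" unfolding w_def using th eta_in by simp
      have th_w: "hinner H (tn g z) eta = hinner E z w" if "z \<in> carr E" for z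
        using adj_right[OF E.hilbert_right hilbert_H th eta_in that] that by (simp add: w_def th_def)
      have "w \<in> N"
        unfolding N_def
      proof (intro CollectI conjI ballI w)
        fix h assume h: "h \<in> F"
        \<comment> \<open>The operator h g^* on \<open>X\<close>. Fused with the identity it slices
          by \<open>g\<close> and inserts \<open>h\<close>, so it maps \<open>eta\<close> to
          \<open>tn h w\<close>; the intertwining property of \<open>V\<close> puts this vector into
          \<open>Ran\<close>.\<close>
        define a where "a = compose (carr X) h (adj L X g)"
        have a: "a \<in> end_alg r X"
          unfolding a_def by (rule rhom_compose[OF X_mod L_mod h rhom_adj[OF L_mod X_mod g adj_ops]])
        define T where "T = compose (carr H) (\<lambda>y\<in>carr E. tn h y) (adj E H th)"
        have T: "T \<in> bounded_ops H H"
          unfolding T_def using th by (intro compose_in[OF theta_bounded[OF h]]) simp_all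
        have "fm a (op_id E) = T"
        proof (rule op_eq_on_tens[OF hilbert_H fuse_map_spec(1)[OF a lhom_id] T])
          fix k v assume k: "k \<in> F" and v: "v \<in> carr E"
          have "adj E H th (tn k v) = ip g k v"
          proof (rule E.vec_eqI)
            fix u assume u: "u \<in> carr E"
            show "hinner E u (adj E H th (tn k v)) = hinner E u (ip g k v)"
              using u k v g th by (simp add: adj_right) (simp add: th_def tens_inner)
          qed (use g k v th in simp_all)
          then have "T (tn k v) = tn h (ip g k v)" using g k v by (simp add: T_def compose_eq)
          also have "\<dots> = tn (compose (carr L) h (compose (carr L) (adj L X g) k)) v"
            unfolding ip_def by (rule tens_mult[OF h F_inner[OF g k] v, symmetric])
          also have "compose (carr L) h (compose (carr L) (adj L X g) k) = compose (carr L) a k"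
            using k by (auto simp: a_def compose_def fun_eq_iff)
          finally show "fm a (op_id E) (tn k v) = T (tn k v)"
            using k v by (simp add: fuse_map_spec[OF a lhom_id])
        qed
        then have "tn h w = fm a (op_id E) eta"
          using eta_in w by (simp add: T_def compose_eq flip: w_def)
        also have "\<dots> = V (f a (adj Y H V eta))"
          using inter[OF a, of "adj Y H V eta"] P_eta P_apply[OF eta_in] eta_in by simp
        finally show "tn h w \<in> Ran" using a eta_in by (simp add: Ran_def)
      qed
      then have "p w = w" unfolding p_def by (rule N.proj_fix)
      then have "hinner E z w = hinner E (p z) w"
        using N.proj_selfadjoint[OF z w] by (simp add: p_def)
      also have "\<dots> = hinner H (Q (tn g z)) eta" using th_w[of "p z"] z g by (simp add: Q_tens)
      also have "\<dots> = hinner H (tn g z) (Q eta)" using z g eta_in by (intro Q_self) simp_all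
      also have "\<dots> = 0" using z g by (simp add: Q_eta)
      finally show "hinner H (tn g z) eta = 0" using th_w[OF z] by simp
    qed
    then show ?thesis
      using H.hdiff_eq_0[of "V y" "Q (V y)"] y by (simp add: eta_def[symmetric] H.hnorm_zero Q_in)
  qed
  have "V = compose (carr Y) Q V"
  proof (rule op_eqI[OF V_bounded])
    show "compose (carr Y) Q V \<in> bounded_ops Y H" by (rule compose_in[OF Q V_bounded]) simp_all
  qed (simp add: compose_eq QV)
  \<comment> \<open>With \<open>p\<close> the identity, \<open>N\<close> is all of \<open>E\<close>,
    so every simple tensor lies in the range of \<open>V\<close>.\<close>
  then have "p = op_id E" using unique[OF p_bihom p_adj] by (simp add: Q_def)
  then have "tn g y \<in> Ran" if "g \<in> F" "y \<in> carr E" for g y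
    using pN[OF that(2)] that by (simp add: N_def)
  then have "P = op_id H"
    by (intro op_eq_on_tens[OF hilbert_H P]) (simp_all add: Ran_iff)
  moreover have "compose (carr Y) (adj Y H V) V = op_id Y"
    by (rule op_eqI[of _ Y Y]) (simp_all add: compose_in[OF adj_in V_bounded] compose_eq iso)
  ultimately show ?thesis by (simp add: unitary_op_def P_def)
qed

end

theorem proposition1p4:
  fixes r :: "'r vn_algebra" and s :: "'s vn_algebra"
    and L2r :: "('r, 'r, 'u) bimod"
    and X :: "('r, 'u) rmod" and Y :: "('s, 'u) rmod"
    and f :: "('u \<Rightarrow> 'u) \<Rightarrow> ('u \<Rightarrow> 'u)"
    and E :: "('r, 's, 'u) bimod" and V :: "'u \<Rightarrow> ('u, 'u, 'u) fusion_pt"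
  assumes "von_neumann_algebra r" and "von_neumann_algebra s"
    and "standard_form r L2r"
    and "generating r X" and "generating s Y"
    and "completely_positive X (end_alg r X) Y (end_alg s Y) f"
    and "normal_map X (end_alg r X) Y (end_alg s Y) f"
    and "minimal_representation r s L2r X Y f E V"
  shows "unital_star_hom (op_mult X) X (end_alg r X) Y (end_alg s Y) f \<longleftrightarrow>
    unitary_op Y (fusion r L2r X E) V"
proof -
  have rep: "representation r s L2r X Y f E V"
    \<comment> \<open>The universal property applied to the representation itself, where it says
      that there is exactly one endomorphism.\<close>
    and minimal: "\<exists>!\<sigma>. rep_morphism r s L2r X Y E V E V \<sigma>"
    using assms(8) by (auto simp: minimal_representation_def)
  interpret represented_map r s L2r X E Y f V
    using assms(1,3,4,5) rep
    by unfold_locales (auto simp: generating_def representation_def)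
  have "linear_map X (end_alg r X) Y (end_alg s Y) f"
    using assms(6) by (simp add: completely_positive_def)
  moreover have "p = op_id E"
    if "p \<in> bihom r s E E" "adj E E p = p" "V = compose (carr Y) (fm (op_id X) p) V" for p
  proof -
    \<comment> \<open>Self-adjointness of \<open>p\<close> makes the two equations required of a
      morphism of representations coincide.\<close>
    have "rep_morphism r s L2r X Y E V E V p" using that by (simp add: rep_morphism_def End_id)
    moreover have "op_id E \<in> bihom r s E E"
      using rhom_id[OF E_mod] lhom_id by (simp add: bihom_def lhom_def)
    then have "rep_morphism r s L2r X Y E V E V (op_id E)"
      by (simp add: rep_morphism_def adj_op_id fuse_map_id compose_id_left[OF V_bounded])
    ultimately show ?thesis using minimal by blast
  qed
  ultimately show ?thesis
    using unitary_imp_hom hom_imp_unitary[OF assms(2)] by (auto simp: unitary_op_fusion)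
qed

end
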